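(* Let $M$ be a monotone $\sigma$-complete effect algebra with the Riesz Decomposition Property and let $(\Omega,\mathcal T,h)$ be the canonical representation of $M$. Suppose that every $f\in\mathcal T$ is $\mathcal B_0(\mathcal T)$-measurable. Then to every $a\in M$ one can assign a sharp observable $\Lambda_a:\mathcal B([0,1])\to\mathrm{Sh}(M)$ such that the mapping $a\mapsto\Lambda_a$ is injective and, for every $a\in M$ and every $\sigma$-additive state $m$ on $M$, $$m(a)=\int_0^1\lambda\,\mathrm d\,m(\Lambda_a(\lambda)),$$ that is, $m(a)$ is the integral of the identity function on $[0,1]$ with respect to the probability measure $E\mapsto m(\Lambda_a(E))$ on the Borel $\sigma$-algebra $\mathcal B([0,1])$.
   Context: An effect algebra is a partial algebra $(M;+,0,1)$ with a partial operation $+$ and constants $0,1$ (with $0\neq 1$) such that: (i) $+$ is commutative ($a+b$ is defined iff $b+a$ is, and then they are equal); (ii) $+$ is associative ($a+b$ and $(a+b)+c$ are defined iff $b+c$ and $a+(b+c)$ are defined, and then $(a+b)+c=a+(b+c)$); (iii) for each $a$ there is a unique $a'$ with $a+a'=1$; (iv) if $a+1$ is defined then $a=0$. It is partially ordered by $a\le b$ iff $a+c=b$ for some $c$; then $c$ is written $b-a$, and $a'=1-a$. $M$ has the Riesz Decomposition Property (RDP) if whenever $a_1+a_2=b_1+b_2$ in $M$ there are $c_{11},c_{12},c_{21},c_{22}\in M$ with $a_1=c_{11}+c_{12}$, $a_2=c_{21}+c_{22}$, $b_1=c_{11}+c_{21}$, $b_2=c_{12}+c_{22}$. $M$ is monotone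 $\sigma$-complete if every increasing sequence $a_1\le a_2\le\cdots$ has a supremum in $M$; $\{a_n\}\nearrow a$ means the sequence is increasing with supremum $a$. A homomorphism of effect algebras preserves $1$ and $+$; a $\sigma$-homomorphism additionally satisfies: $\{a_n\}\nearrow a$ implies $\{h(a_n)\}\nearrow h(a)$. An element $a$ is sharp if $a\wedge a'$ exists and equals $0$; $\mathrm{Sh}(M)$ is the set of sharp elements (for $M$ with RDP it is a Boolean algebra). An observable is a $\sigma$-homomorphism of effect algebras from a $\sigma$-algebra $\mathcal S$ of subsets of a set (where $+$ is union of disjoint sets) into $M$. An observable is sharp if all its values lie in $\mathrm{Sh}(M)$. A state on $M$ is a map $s:M\to[0,1]$ with $s(1)=1$ and $s(a+b)=s(a)+s(b)$ whenever $a+b$ is defined. It is $\sigma$-additive if $\{a_n\}\nearrow a$ implies $s(a)=\lim_n s(a_n)$. $\mathcal S(M)$ is the convex set of all states with the topology of pointwise convergence on $M$ (it is nonempty when $M$ has RDP), and $\partial_e\mathcal S(M)$ is its set of extreme points with the relative topology. For $a\in M$, $\hat a:\mathcal S(M)\to[0,1]$ is $\hat a(s)=s(a)$. For a real-valued function $f$ on $\mathcal S(M)$, $N(f)=\{s\in\partial_e\mathcal S(M): f(s)\neq0\}$. Effect-tribe: a system $\mathcal T\subseteq[0,1]^\Omega$, $\Omega\neq\emptyset$, with $1\in\mathcal T$; $f\in\mathcal T\Rightarrow 1-f\in\mathcal T$; $f,g\in\mathcal T$, $f\le1-g\Rightarrow f+g\in\mathcal T$; and closed under pointwise limits of increasing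 sequences. It is a monotone $\sigma$-complete effect algebra under pointwise operations. Canonical representation $(\Omega,\mathcal T,h)$ of a monotone $\sigma$-complete effect algebra $M$ with RDP: $\Omega=\mathcal S(M)$; $\mathcal T$ is the set of all $f:\Omega\to[0,1]$ for which there is $b\in M$ such that $N(f-\hat b)$ is a meager subset of $\partial_e\mathcal S(M)$ (written $f\sim b$); and $h(f):=b$ if $f\sim b$. It is a known result (the Loomis–Sikorski theorem for such algebras) that $\mathcal T$ is an effect-tribe with RDP and that $h$ is a well-defined $\sigma$-homomorphism of $\mathcal T$ onto $M$. $\mathcal B_0(\mathcal T)=\{A\subseteq\Omega:\chi_A\in\mathrm{Sh}(\mathcal T)\}$, where $\chi_A$ is the indicator function of $A$; this is known to be a $\sigma$-algebra of subsets of $\Omega$. *)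

theory Defs
  imports "HOL-Probability.Probability"
begin

text \<open>The partial addition is option-valued: \<open>eplus M a b = None\<close> means that the sum of \<open>a\<close> and
  \<open>b\<close> is undefined. Only its values on the carrier matter.\<close>

record 'a effect_alg =
  ecarrier :: "'a set"
  eplus :: "'a \<Rightarrow> 'a \<Rightarrow> 'a option"
  ezero :: 'a
  eone :: 'a

text \<open>With \<open>Option.bind\<close>, associativity says that one side is defined iff the other one is, and that
  they are then equal.\<close>

locale effect_algebra =
  fixes M :: "'a effect_alg"
  assumes zero_closed: "ezero M \<in> ecarrier M"
    and one_closed: "eone M \<in> ecarrier M"
    and zero_neq_one: "ezero M \<noteq> eone M"
    and plus_closed: "\<lbrakk>a \<in> ecarrier M; b \<in> ecarrier M; eplus M a b = Some c\<rbrakk> \<Longrightarrow> c \<in> ecarrier M"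
    and plus_commute: "\<lbrakk>a \<in> ecarrier M; b \<in> ecarrier M\<rbrakk> \<Longrightarrow> eplus M a b = eplus M b a"
    and plus_assoc: "\<lbrakk>a \<in> ecarrier M; b \<in> ecarrier M; c \<in> ecarrier M\<rbrakk> \<Longrightarrow>
      Option.bind (eplus M a b) (\<lambda>d. eplus M d c) = Option.bind (eplus M b c) (\<lambda>d. eplus M a d)"
    and ex1_compl: "a \<in> ecarrier M \<Longrightarrow> \<exists>!a'. a' \<in> ecarrier M \<and> eplus M a a' = Some (eone M)"
    and plus_one: "\<lbrakk>a \<in> ecarrier M; eplus M a (eone M) \<noteq> None\<rbrakk> \<Longrightarrow> a = ezero M"

definition ecompl :: "'a effect_alg \<Rightarrow> 'a \<Rightarrow> 'a" where
  "ecompl M a = (THE a'. a' \<in> ecarrier M \<and> eplus M a a' = Some (eone M))"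

definition ele :: "'a effect_alg \<Rightarrow> 'a \<Rightarrow> 'a \<Rightarrow> bool" where
  "ele M a b \<longleftrightarrow> a \<in> ecarrier M \<and> b \<in> ecarrier M \<and> (\<exists>c\<in>ecarrier M. eplus M a c = Some b)"

definition RDP :: "'a effect_alg \<Rightarrow> bool" where
  "RDP M \<longleftrightarrow>
    (\<forall>a1\<in>ecarrier M. \<forall>a2\<in>ecarrier M. \<forall>b1\<in>ecarrier M. \<forall>b2\<in>ecarrier M.
      eplus M a1 a2 \<noteq> None \<and> eplus M a1 a2 = eplus M b1 b2 \<longrightarrow>
      (\<exists>c11\<in>ecarrier M. \<exists>c12\<in>ecarrier M. \<exists>c21\<in>ecarrier M. \<exists>c22\<in>ecarrier M.
        eplus M c11 c12 = Some a1 \<and> eplus M c21 c22 = Some a2 \<and>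
        eplus M c11 c21 = Some b1 \<and> eplus M c12 c22 = Some b2))"

definition is_esup :: "'a effect_alg \<Rightarrow> 'a set \<Rightarrow> 'a \<Rightarrow> bool" where
  "is_esup M A s \<longleftrightarrow> s \<in> ecarrier M \<and> (\<forall>a\<in>A. ele M a s) \<and>
    (\<forall>u\<in>ecarrier M. (\<forall>a\<in>A. ele M a u) \<longrightarrow> ele M s u)"

definition is_einf :: "'a effect_alg \<Rightarrow> 'a set \<Rightarrow> 'a \<Rightarrow> bool" where
  "is_einf M A s \<longleftrightarrow> s \<in> ecarrier M \<and> (\<forall>a\<in>A. ele M s a) \<and>
    (\<forall>l\<in>ecarrier M. (\<forall>a\<in>A. ele M l a) \<longrightarrow> ele M l s)"

definition eincseq :: "'a effect_alg \<Rightarrow> (nat \<Rightarrow> 'a) \<Rightarrow> bool" where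
  "eincseq M a \<longleftrightarrow> (\<forall>n. a n \<in> ecarrier M) \<and> (\<forall>n. ele M (a n) (a (Suc n)))"

definition increases_to :: "'a effect_alg \<Rightarrow> (nat \<Rightarrow> 'a) \<Rightarrow> 'a \<Rightarrow> bool" where
  "increases_to M a s \<longleftrightarrow> eincseq M a \<and> is_esup M (range a) s"

definition monotone_sigma_complete :: "'a effect_alg \<Rightarrow> bool" where
  "monotone_sigma_complete M \<longleftrightarrow> (\<forall>a. eincseq M a \<longrightarrow> (\<exists>s. is_esup M (range a) s))"

definition Sh :: "'a effect_alg \<Rightarrow> 'a set" where
  "Sh M = {a \<in> ecarrier M. is_einf M {a, ecompl M a} (ezero M)}"

definition effect_hom :: "'a effect_alg \<Rightarrow> 'b effect_alg \<Rightarrow> ('a \<Rightarrow> 'b) \<Rightarrow> bool" where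
  "effect_hom M N h \<longleftrightarrow> h \<in> ecarrier M \<rightarrow> ecarrier N \<and> h (eone M) = eone N \<and>
    (\<forall>a\<in>ecarrier M. \<forall>b\<in>ecarrier M. \<forall>c. eplus M a b = Some c \<longrightarrow> eplus N (h a) (h b) = Some (h c))"

definition sigma_hom :: "'a effect_alg \<Rightarrow> 'b effect_alg \<Rightarrow> ('a \<Rightarrow> 'b) \<Rightarrow> bool" where
  "sigma_hom M N h \<longleftrightarrow> effect_hom M N h \<and>
    (\<forall>a s. increases_to M a s \<longrightarrow> increases_to N (\<lambda>n. h (a n)) (h s))"

text \<open>The \<open>\<sigma>\<close>-algebra carried by a measure space \<open>S\<close> (its measure is irrelevant), regarded as an
  effect algebra.\<close>

definition sets_alg :: "'w measure \<Rightarrow> 'w set effect_alg" where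
  "sets_alg S = \<lparr>ecarrier = sets S,
    eplus = (\<lambda>A B. if A \<inter> B = {} then Some (A \<union> B) else None),
    ezero = {}, eone = space S\<rparr>"

definition observable :: "'w measure \<Rightarrow> 'a effect_alg \<Rightarrow> ('w set \<Rightarrow> 'a) \<Rightarrow> bool" where
  "observable S M x \<longleftrightarrow> sigma_hom (sets_alg S) M x"

definition sharp_observable :: "'w measure \<Rightarrow> 'a effect_alg \<Rightarrow> ('w set \<Rightarrow> 'a) \<Rightarrow> bool" where
  "sharp_observable S M x \<longleftrightarrow> observable S M x \<and> (\<forall>E\<in>sets S. x E \<in> Sh M)"

definition borel01 :: "real measure" where
  "borel01 = restrict_space borel {0..1}"

text \<open>The set function \<open>E \<mapsto> m (x E)\<close> on the \<open>\<sigma>\<close>-algebra of \<open>S\<close>, as a measure. The library's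
  \<open>measure_of\<close> returns the null measure if this set function is not countably additive.\<close>

definition observable_distr :: "'w measure \<Rightarrow> ('a \<Rightarrow> real) \<Rightarrow> ('w set \<Rightarrow> 'a) \<Rightarrow> 'w measure" where
  "observable_distr S m x = measure_of (space S) (sets S) (\<lambda>E. ennreal (m (x E)))"

text \<open>States are extensional functions (\<open>undefined\<close> outside the carrier), so that equality of states
  is equality on \<open>M\<close> and states are points of the product space \<open>\<real>\<^sup>M\<close>.\<close>

definition states :: "'a effect_alg \<Rightarrow> ('a \<Rightarrow> real) set" where
  "states M = {s \<in> ecarrier M \<rightarrow>\<^sub>E {0..1}. s (eone M) = 1 \<and>
    (\<forall>a\<in>ecarrier M. \<forall>b\<in>ecarrier M. \<forall>c. eplus M a b = Some c \<longrightarrow> s c = s a + s b)}"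

definition sigma_additive :: "'a effect_alg \<Rightarrow> ('a \<Rightarrow> real) \<Rightarrow> bool" where
  "sigma_additive M s \<longleftrightarrow> (\<forall>a b. increases_to M a b \<longrightarrow> (\<lambda>n. s (a n)) \<longlonglongrightarrow> s b)"

definition state_topology :: "'a effect_alg \<Rightarrow> ('a \<Rightarrow> real) topology" where
  "state_topology M = subtopology (product_topology (\<lambda>_. euclideanreal) (ecarrier M)) (states M)"

text \<open>The library's \<open>extreme_point_of\<close> needs a real vector space structure on the type, which the
  function type does not have.\<close>

definition extreme_states :: "'a effect_alg \<Rightarrow> ('a \<Rightarrow> real) set" where
  "extreme_states M = {s \<in> states M. \<forall>s1\<in>states M. \<forall>s2\<in>states M. \<forall>t. 0 < t \<and> t < 1 \<and>
    (\<forall>a\<in>ecarrier M. s a = t * s1 a + (1 - t) * s2 a) \<longrightarrow> s1 = s \<and> s2 = s}"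

definition extreme_topology :: "'a effect_alg \<Rightarrow> ('a \<Rightarrow> real) topology" where
  "extreme_topology M = subtopology (state_topology M) (extreme_states M)"

definition nowhere_dense_in :: "'b topology \<Rightarrow> 'b set \<Rightarrow> bool" where
  "nowhere_dense_in X A \<longleftrightarrow> A \<subseteq> topspace X \<and> X interior_of (X closure_of A) = {}"

definition meager_in :: "'b topology \<Rightarrow> 'b set \<Rightarrow> bool" where
  "meager_in X A \<longleftrightarrow> (\<exists>F :: nat \<Rightarrow> 'b set. (\<forall>n. nowhere_dense_in X (F n)) \<and> A = (\<Union>n. F n))"

text \<open>A system \<open>T\<close> of extensional functions \<open>\<Omega> \<rightarrow> [0,1]\<close> with the pointwise partial addition.\<close>

definition tribe_alg :: "'w set \<Rightarrow> ('w \<Rightarrow> real) set \<Rightarrow> ('w \<Rightarrow> real) effect_alg" where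
  "tribe_alg \<Omega> T = \<lparr>ecarrier = T,
    eplus = (\<lambda>f g. if \<forall>w\<in>\<Omega>. f w \<le> 1 - g w then Some (\<lambda>w\<in>\<Omega>. f w + g w) else None),
    ezero = (\<lambda>w\<in>\<Omega>. 0), eone = (\<lambda>w\<in>\<Omega>. 1)\<rparr>"

definition B0 :: "'w set \<Rightarrow> ('w \<Rightarrow> real) set \<Rightarrow> 'w set set" where
  "B0 \<Omega> T = {A. A \<subseteq> \<Omega> \<and> restrict (indicat_real A) \<Omega> \<in> Sh (tribe_alg \<Omega> T)}"

definition hat :: "'a effect_alg \<Rightarrow> 'a \<Rightarrow> ('a \<Rightarrow> real) \<Rightarrow> real" where
  "hat M a = (\<lambda>s\<in>states M. s a)"

definition Nset :: "'a effect_alg \<Rightarrow> (('a \<Rightarrow> real) \<Rightarrow> real) \<Rightarrow> ('a \<Rightarrow> real) set" where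
  "Nset M f = {s \<in> extreme_states M. f s \<noteq> 0}"

definition canonical_rel :: "'a effect_alg \<Rightarrow> (('a \<Rightarrow> real) \<Rightarrow> real) \<Rightarrow> 'a \<Rightarrow> bool" where
  "canonical_rel M f b \<longleftrightarrow> meager_in (extreme_topology M) (Nset M (\<lambda>s. f s - hat M b s))"

definition canonical_tribe :: "'a effect_alg \<Rightarrow> (('a \<Rightarrow> real) \<Rightarrow> real) set" where
  "canonical_tribe M = {f \<in> states M \<rightarrow>\<^sub>E {0..1}. \<exists>b\<in>ecarrier M. canonical_rel M f b}"

definition canonical_hom :: "'a effect_alg \<Rightarrow> (('a \<Rightarrow> real) \<Rightarrow> real) \<Rightarrow> 'a" where
  "canonical_hom M = (\<lambda>f\<in>canonical_tribe M. THE b. b \<in> ecarrier M \<and> canonical_rel M f b)"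

definition canonical_representation :: "'a effect_alg \<Rightarrow>
    ('a \<Rightarrow> real) set \<times> (('a \<Rightarrow> real) \<Rightarrow> real) set \<times> ((('a \<Rightarrow> real) \<Rightarrow> real) \<Rightarrow> 'a)" where
  "canonical_representation M = (states M, canonical_tribe M, canonical_hom M)"

end

theory Submission
  imports Defs "HOL-Library.Poly_Mapping"
begin

text \<open>
  The observable is \<open>\<Lambda>\<^sub>a(E) = h(\<chi>)\<close> with \<open>\<chi>\<close> the indicator function of \<open>{s. s(a) \<in> E}\<close>, so that the
  value of an extreme state \<open>s\<close> at \<open>\<Lambda>\<^sub>a(E)\<close> is the indicator of \<open>E\<close> at \<open>s(a)\<close>, except for a meager set of
  states \<open>s\<close>. Everything follows once an inequality between finite linear combinations of
  evaluations that holds off a meager set of extreme states holds at every state, and the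
  states determine the order of \<open>M\<close>. In particular, the Loomis--Sikorski theorem itself is not needed.

  The first fact combines Bauer's maximum principle with Choquet's theorem that the extreme boundary
  of a compact convex set is a Baire space.

  For the second, formal sums of elements of \<open>M\<close> modulo common refinement form a cancellative
  refinement monoid, hence the positive cone of an interpolation group in which \<open>M\<close> is the unit
  interval. Monotone \<open>\<sigma>\<close>-completeness passes from \<open>M\<close> to this group and makes it Archimedean and
  unperforated, so a Hahn--Banach argument shows that its order is determined by states.
\<close>

section \<open>Groups with a Riesz cone and an order unit\<close>

text \<open>Positive functionals are constructed where differences and multiples exist, so the order
  of \<open>M\<close> is studied in a group. This group has no real scalars: homogeneity is asked
  for natural multiples only, and the gauge of an element is an infimum of fractions. The group is
  also never formed as a quotient: the free abelian group on the elements is merely preordered by a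
  cone, and representatives and suprema are determined up to equivalence in this preorder. On the
  side of states, bumps concentrated near an extreme state can be chosen convex but in general not
  affine. Hence the maximum principle is set up for convex functions, although it is finally applied
  to linear combinations of evaluations. The measurability assumption places the indicator of the
  states whose value at \<open>a\<close> lies in \<open>E\<close> in the tribe, so that
  \<open>h\<close> applies to it. A sigma-additive \<open>m\<close> need not be extreme, so the
  integral formula is reached by approximation: on a grid of mesh \<open>1 / N\<close> the identity
  differs little from a step function, this finite linear inequality passes from nearly all extreme
  states to \<open>m\<close>, and the integral is compared with the same step function.\<close>

primrec nmul :: "nat \<Rightarrow> 'g::ab_group_add \<Rightarrow> 'g" where
  "nmul 0 x = 0"
| "nmul (Suc n) x = x + nmul n x"

lemma nmul_add: "nmul (m + n) x = nmul m x + nmul n x"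
  by (induction m) (simp_all add: add.assoc)

lemma nmul_plus: "nmul n (x + y) = nmul n x + nmul n y"
  by (induction n) (simp_all add: algebra_simps)

lemma nmul_zero [simp]: "nmul n 0 = 0"
  by (induction n) simp_all

lemma nmul_minus: "nmul n (- x) = - nmul n x"
  by (induction n) simp_all

lemma nmul_diff: "nmul n (x - y) = nmul n x - nmul n y"
  using nmul_plus[of n x "- y"] by (simp add: nmul_minus)

lemma nmul_mult: "nmul (m * n) x = nmul m (nmul n x)"
  by (induction m) (simp_all add: nmul_add)

section \<open>Hahn-Banach for sublinear functionals on an abelian group\<close>

definition sublinear :: "('g::ab_group_add \<Rightarrow> real) \<Rightarrow> bool" where
  "sublinear p \<longleftrightarrow> (\<forall>x y. p (x + y) \<le> p x + p y) \<and> (\<forall>n x. p (nmul n x) = real n * p x)"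

lemma sublinearD:
  assumes "sublinear p"
  shows "p (x + y) \<le> p x + p y" "p (nmul n x) = real n * p x" "p 0 = 0" "- p (- x) \<le> p x"
proof -
  show 1: "p (x + y) \<le> p x + p y" and 2: "p (nmul n x) = real n * p x" for x y n
    using assms by (auto simp: sublinear_def)
  show 3: "p 0 = 0" using 2[of 0 0] by simp
  show "- p (- x) \<le> p x" using 1[of x "- x"] 3 by simp
qed

text \<open>Descends from \<open>p\<close> along the ray spanned by \<open>y\<close>; a minimal sublinear functional
  admits no descent, which is exactly additivity.\<close>

definition ray_inf :: "('g::ab_group_add \<Rightarrow> real) \<Rightarrow> 'g \<Rightarrow> 'g \<Rightarrow> real" where
  "ray_inf p y x = (INF n. p (x + nmul n y) - real n * p y)"

lemma ray_inf_bdd: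
  assumes "sublinear p"
  shows "bdd_below (range (\<lambda>n. p (x + nmul n y) - real n * p y))"
proof (rule bdd_belowI2)
  fix n
  have "p (nmul n y) \<le> p (x + nmul n y) + p (- x)"
    using sublinearD(1)[OF assms, of "x + nmul n y" "- x"] by simp
  then show "- p (- x) \<le> p (x + nmul n y) - real n * p y"
    by (simp add: sublinearD(2)[OF assms])
qed

lemma ray_inf_le:
  assumes "sublinear p"
  shows "ray_inf p y x \<le> p (x + nmul n y) - real n * p y"
  unfolding ray_inf_def by (rule cINF_lower[OF ray_inf_bdd[OF assms]]) simp

text \<open>By subadditivity the terms of the infimum decrease in \<open>n\<close>, so restricting
  to indices divisible by \<open>j\<close> loses nothing; this gives homogeneity. For subadditivity
  the indices of the two infima are added.\<close>

lemma sublinear_ray_inf: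
  assumes p: "sublinear p"
  shows "sublinear (ray_inf p y)"
proof -
  let ?q = "ray_inf p y"
  have ge: "c \<le> ?q x" if "\<And>n. c \<le> p (x + nmul n y) - real n * p y" for c x
    unfolding ray_inf_def by (rule cINF_greatest) (use that in auto)
  have sub: "?q (x + z) \<le> ?q x + ?q z" for x z
  proof -
    have *: "?q (x + z) \<le> (p (x + nmul n y) - real n * p y) + (p (z + nmul m y) - real m * p y)" for n m
    proof -
      have "p (x + z + nmul (n + m) y) \<le> p (x + nmul n y) + p (z + nmul m y)"
        using sublinearD(1)[OF p, of "x + nmul n y" "z + nmul m y"]
        by (simp add: nmul_add algebra_simps)
      then show ?thesis
        using ray_inf_le[OF p, of y "x + z" "n + m"] by (simp add: algebra_simps)
    qed
    have "?q (x + z) - (p (z + nmul m y) - real m * p y) \<le> ?q x" for m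
      by (rule ge) (use *[of _ m] in \<open>simp add: algebra_simps\<close>)
    then have "?q (x + z) - ?q x \<le> p (z + nmul m y) - real m * p y" for m
      by (simp add: algebra_simps)
    from ge[OF this] show ?thesis by simp
  qed
  have zero: "?q 0 = 0"
    using ray_inf_le[OF p, of y 0 0] sublinearD(3)[OF p]
    by (intro antisym ge) (simp_all add: sublinearD(2)[OF p])
  have le: "?q (nmul j x) \<le> real j * ?q x" for j x
  proof (induction j)
    case (Suc j)
    then show ?case using sub[of x "nmul j x"] by (simp add: algebra_simps)
  qed (simp add: zero)
  have "real j * ?q x \<le> ?q (nmul j x)" for j x
  proof (rule ge)
    fix n
    show "real j * ?q x \<le> p (nmul j x + nmul n y) - real n * p y"
    proof (cases "j = 0")
      case True
      then show ?thesis by (simp add: sublinearD(2)[OF p])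
    next
      case False
      \<comment> \<open>The index \<open>j * n\<close> is at least \<open>n\<close>, and the surplus
        multiples of \<open>y\<close> cost at most their own value under \<open>p\<close>.\<close>
      have "j * n = n + (j - 1) * n" using False by (cases j) auto
      then have e: "nmul (j * n) y = nmul n y + nmul ((j - 1) * n) y" "real (j * n) = real n + real ((j - 1) * n)"
        by (metis nmul_add, metis of_nat_add)
      have "real j * ?q x \<le> real j * (p (x + nmul n y) - real n * p y)"
        by (rule mult_left_mono[OF ray_inf_le[OF p]]) simp
      also have "\<dots> = p (nmul j x + nmul (j * n) y) - real (j * n) * p y"
        using sublinearD(2)[OF p, of j "x + nmul n y"]
        by (simp add: nmul_plus nmul_mult right_diff_distrib)
      also have "\<dots> \<le> p (nmul j x + nmul n y) - real n * p y"
        using sublinearD(1)[OF p, of "nmul j x + nmul n y" "nmul ((j - 1) * n) y"] e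
        by (simp add: sublinearD(2)[OF p] algebra_simps)
      finally show ?thesis .
    qed
  qed
  with le sub show ?thesis unfolding sublinear_def by (meson antisym)
qed

text \<open>Zorn's lemma downwards. The pointwise infimum of a chain is finite because each member
  is at least \<open>- p0 (- x)\<close> at \<open>x\<close>, and it is subadditive because two
  members of a chain can be replaced by the smaller one.\<close>

lemma minimal_sublinear_exists:
  assumes p0: "sublinear p0"
  shows "\<exists>p. sublinear p \<and> p \<le> p0 \<and> (\<forall>q. sublinear q \<longrightarrow> q \<le> p \<longrightarrow> q = p)"
proof -
  define A where "A = {p. sublinear p \<and> p \<le> p0}"
  have "\<exists>m\<in>A. \<forall>a\<in>A. m \<ge> a \<longrightarrow> a = m"
  proof (rule predicate_Zorn)
    show "partial_order_on A (relation_of (\<ge>) A)"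
      unfolding partial_order_on_def preorder_on_def refl_on_def trans_def antisym_def relation_of_def
      by auto
  next
    fix C assume C: "C \<in> Chains (relation_of (\<ge>) A)"
    then have CA: "C \<subseteq> A" and lin: "\<And>p q. p \<in> C \<Longrightarrow> q \<in> C \<Longrightarrow> p \<le> q \<or> q \<le> p"
      unfolding Chains_def relation_of_def by auto
    show "\<exists>b\<in>A. \<forall>a\<in>C. a \<ge> b"
    proof (cases "C = {}")
      case True
      then show ?thesis using p0 by (auto simp: A_def)
    next
      case False
      define b where "b x = (INF p\<in>C. p x)" for x
      have sl: "sublinear p" and lep: "p x \<le> p0 x" if "p \<in> C" for p x
        using CA that by (auto simp: A_def le_fun_def)
      have bdd: "bdd_below ((\<lambda>p. p x) ` C)" for x
      proof (rule bdd_belowI2)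
        fix p assume "p \<in> C"
        then show "- p0 (- x) \<le> p x"
          using sublinearD(4)[OF sl, of p x] lep[of p "- x"] by linarith
      qed
      have low: "b x \<le> p x" if "p \<in> C" for p x
        unfolding b_def by (rule cINF_lower[OF bdd that])
      have ge: "c \<le> b x" if "\<And>p. p \<in> C \<Longrightarrow> c \<le> p x" for c x
        unfolding b_def by (rule cINF_greatest[OF False that])
      have "b (x + y) \<le> b x + b y" for x y
      proof -
        have *: "b (x + y) \<le> p x + q y" if "p \<in> C" "q \<in> C" for p q
        proof -
          obtain r where "r \<in> C" "r \<le> p" "r \<le> q" using lin \<open>p \<in> C\<close> \<open>q \<in> C\<close> by blast
          then show ?thesis
            using low[of r "x + y"] sublinearD(1)[OF sl, of r x y]
            by (smt (verit) le_funD)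
        qed
        have "b (x + y) - q y \<le> b x" if "q \<in> C" for q
          by (rule ge) (use *[OF _ that] in \<open>simp add: algebra_simps\<close>)
        then have "b (x + y) - b x \<le> b y"
          by (intro ge) (simp add: algebra_simps)
        then show ?thesis by simp
      qed
      moreover have "b (nmul n x) = real n * b x" for n x
      proof (cases "n = 0")
        case True
        have "(\<lambda>p. p 0) ` C = {0}" using sublinearD(3)[OF sl] False by force
        then have "b 0 = 0" by (simp add: b_def)
        with True show ?thesis by simp
      next
        case n: False
        have "real n * b x \<le> b (nmul n x)"
          by (rule ge) (simp add: sublinearD(2)[OF sl] low mult_left_mono)
        moreover have "b (nmul n x) / real n \<le> b x"
        proof (rule ge)
          fix p assume "p \<in> C"
          then show "b (nmul n x) / real n \<le> p x"
            using low[of p "nmul n x"] n by (simp add: sublinearD(2)[OF sl] field_simps)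
        qed
        ultimately show ?thesis using n by (simp add: field_simps)
      qed
      ultimately have "sublinear b" by (simp add: sublinear_def)
      moreover have "b \<le> p0"
        using False low lep by (metis le_funI equals0I order.trans)
      ultimately show ?thesis using low by (auto simp: A_def le_fun_def)
    qed
  qed
  then show ?thesis unfolding A_def by (auto intro: order.trans)
qed

text \<open>Start from the descent of \<open>p\<close> along \<open>z\<close>, whose value at
  \<open>- z\<close> is at most \<open>- p z\<close>, and take a minimal sublinear functional below
  it. Additivity then turns the bound at \<open>- z\<close> into equality at
  \<open>z\<close>.\<close>

lemma additive_below_sublinear:
  assumes p: "sublinear p"
  obtains s where "\<And>x y. s (x + y) = s x + s y" "\<And>x. s x \<le> p x" "s z = p z"
proof -
  obtain s where s: "sublinear s" "s \<le> ray_inf p z" and min: "\<And>q. sublinear q \<Longrightarrow> q \<le> s \<Longrightarrow> q = s"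
    using minimal_sublinear_exists[OF sublinear_ray_inf[OF p, of z]] by blast
  have le: "s x \<le> p x" for x
    using le_funD[OF s(2), of x] ray_inf_le[OF p, of z x 0] by simp
  have "ray_inf s y = s" for y
    by (rule min[OF sublinear_ray_inf[OF s(1)]]) (use ray_inf_le[OF s(1), of y _ 0] in \<open>simp add: le_fun_def\<close>)
  then have "s x + s y \<le> s (x + y)" for x y
    using ray_inf_le[OF s(1), of y x 1] by simp
  then have add: "s (x + y) = s x + s y" for x y
    using sublinearD(1)[OF s(1), of x y] by (meson antisym)
  have "s (- z) \<le> - p z"
    using le_funD[OF s(2), of "- z"] ray_inf_le[OF p, of z "- z" 1] sublinearD(3)[OF p] by simp
  then have "s z = p z"
    using add[of z "- z"] le[of z] sublinearD(3)[OF s(1)] by simp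
  with add le show ?thesis by (rule that)
qed

section \<open>The gauge of an order unit and positive functionals\<close>

locale unital_cone =
  fixes P :: "'g::ab_group_add set" and u :: 'g
  assumes zero: "0 \<in> P"
    and add: "x \<in> P \<Longrightarrow> y \<in> P \<Longrightarrow> x + y \<in> P"
    and unit_pos: "u \<in> P"
    and unit: "\<exists>n. nmul n u - x \<in> P"
    and unit_proper: "- u \<notin> P"
begin

text \<open>Only a preorder: \<open>P\<close> may contain both \<open>x\<close> and
  \<open>- x\<close>. This allows the universal group to be given by generators and a cone instead
  of a quotient.\<close>

definition le :: "'g \<Rightarrow> 'g \<Rightarrow> bool" (infix "\<preceq>" 50) where
  "x \<preceq> y \<longleftrightarrow> y - x \<in> P"

definition positive_functional :: "('g \<Rightarrow> real) \<Rightarrow> bool" where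
  "positive_functional s \<longleftrightarrow> (\<forall>x y. s (x + y) = s x + s y) \<and> (\<forall>x\<in>P. 0 \<le> s x) \<and> s u = 1"

lemma le_refl [simp]: "x \<preceq> x"
  by (simp add: le_def zero)

lemma le_trans [trans]: "x \<preceq> y \<Longrightarrow> y \<preceq> z \<Longrightarrow> x \<preceq> z"
  unfolding le_def using add[of "y - x" "z - y"] by simp

lemma le_add_mono: "x \<preceq> y \<Longrightarrow> x' \<preceq> y' \<Longrightarrow> x + x' \<preceq> y + y'"
  unfolding le_def using add[of "y - x" "y' - x'"] by (simp add: algebra_simps)

lemma le_add_right [simp]: "x + z \<preceq> y + z \<longleftrightarrow> x \<preceq> y"
  by (simp add: le_def)

lemma le_diff_iff: "x \<preceq> y - z \<longleftrightarrow> x + z \<preceq> y"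
  by (simp add: le_def algebra_simps)

lemma diff_le_iff: "x - z \<preceq> y \<longleftrightarrow> x \<preceq> y + z"
  by (simp add: le_def algebra_simps)

lemma nonneg_iff: "0 \<preceq> x \<longleftrightarrow> x \<in> P"
  by (simp add: le_def)

lemma nmul_pos: "x \<in> P \<Longrightarrow> nmul n x \<in> P"
  by (induction n) (auto intro: zero add)

lemma nmul_mono: "x \<preceq> y \<Longrightarrow> nmul n x \<preceq> nmul n y"
  unfolding le_def using nmul_pos[of "y - x" n] by (simp add: nmul_diff)

lemma nmul_mono_left:
  assumes "m \<le> n" "x \<in> P"
  shows "nmul m x \<preceq> nmul n x"
proof -
  have "nmul n x = nmul m x + nmul (n - m) x" using assms(1) by (simp flip: nmul_add)
  then show ?thesis using nmul_pos[OF assms(2)] by (simp add: le_def)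
qed

text \<open>A triple records that \<open>x\<close> is at most \<open>(k - l) / n\<close> times
  \<open>u\<close>, cleared of denominators and of negative multiples.\<close>

definition bounds :: "'g \<Rightarrow> (nat \<times> nat \<times> nat) set" where
  "bounds x = {(k, l, n). 0 < n \<and> nmul n x + nmul l u \<preceq> nmul k u}"

definition unit_gauge :: "'g \<Rightarrow> real" where
  "unit_gauge x = (INF (k, l, n)\<in>bounds x. (real k - real l) / real n)"

text \<open>This keeps the gauge from collapsing: a reversed inequality would put \<open>- u\<close>
  into \<open>P\<close> after adding a positive multiple of \<open>u\<close>.\<close>

lemma unit_multiple_le:
  assumes "nmul l u \<preceq> nmul k u"
  shows "l \<le> k"
proof (rule ccontr)
  assume "\<not> l \<le> k"
  then obtain d where d: "l = Suc (k + d)" using less_imp_Suc_add not_le by blast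
  have "nmul k u - nmul l u \<in> P" using assms by (simp add: le_def)
  moreover have "nmul k u - nmul l u = - u - nmul d u" by (simp add: d nmul_add)
  ultimately have "- u - nmul d u \<in> P" by simp
  from add[OF this nmul_pos[OF unit_pos, of d]] show False using unit_proper by simp
qed

lemma bounds_nonempty: "bounds x \<noteq> {}"
proof -
  obtain k where "nmul k u - x \<in> P" using unit by blast
  then have "(k, 0, 1) \<in> bounds x" by (simp add: bounds_def le_def)
  then show ?thesis by blast
qed

lemma unit_gauge_bdd: "bdd_below ((\<lambda>(k, l, n). (real k - real l) / real n) ` bounds x)"
proof -
  obtain m where m: "nmul m u - (- x) \<in> P" using unit by blast
  have "- real m \<le> (real k - real l) / real n" if "(k, l, n) \<in> bounds x" for k l n
  proof -
    have n: "0 < n" and b: "nmul k u - (nmul n x + nmul l u) \<in> P"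
      using that by (auto simp: bounds_def le_def)
    have "nmul n (nmul m u + x) \<in> P" using nmul_pos[OF m] by simp
    from add[OF b this] have "nmul l u \<preceq> nmul (k + n * m) u"
      by (simp add: le_def nmul_plus nmul_add nmul_mult diff_add_eq)
    from unit_multiple_le[OF this] have "real l \<le> real k + real n * real m"
      by (metis of_nat_add of_nat_le_iff of_nat_mult)
    then show ?thesis using n by (simp add: field_simps)
  qed
  then show ?thesis by (intro bdd_belowI2[where m = "- real m"]) auto
qed

lemma unit_gauge_le:
  assumes "0 < n" "nmul n x + nmul l u \<preceq> nmul k u"
  shows "unit_gauge x \<le> (real k - real l) / real n"
  using cINF_lower[OF unit_gauge_bdd, of "(k, l, n)" x] assms
  unfolding unit_gauge_def by (simp add: bounds_def)

lemma unit_gauge_ge: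
  assumes "\<And>k l n. 0 < n \<Longrightarrow> nmul n x + nmul l u \<preceq> nmul k u \<Longrightarrow> c \<le> (real k - real l) / real n"
  shows "c \<le> unit_gauge x"
  unfolding unit_gauge_def using assms by (intro cINF_greatest[OF bounds_nonempty]) (auto simp: bounds_def)

lemma sublinear_unit_gauge: "sublinear unit_gauge"
proof -
  have sub: "unit_gauge (x + y) \<le> unit_gauge x + unit_gauge y" for x y
  proof -
    have *: "unit_gauge (x + y) \<le> (real k - real l) / real n + (real k' - real l') / real n'"
      if n: "0 < n" "nmul n x + nmul l u \<preceq> nmul k u" and n': "0 < n'" "nmul n' y + nmul l' u \<preceq> nmul k' u"
      for k l n k' l' n'
    proof -
      have "nmul n' (nmul n x + nmul l u) + nmul n (nmul n' y + nmul l' u) \<preceq> nmul n' (nmul k u) + nmul n (nmul k' u)"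
        using n(2) n'(2) by (intro le_add_mono nmul_mono)
      moreover have "nmul n' (nmul n x + nmul l u) + nmul n (nmul n' y + nmul l' u)
          = nmul (n * n') (x + y) + nmul (n' * l + n * l') u"
        using nmul_mult[of n' n x] nmul_mult[of n n' x]
        by (simp add: nmul_plus nmul_add nmul_mult mult.commute[of n' n] add_ac)
      ultimately have "nmul (n * n') (x + y) + nmul (n' * l + n * l') u \<preceq> nmul (n' * k + n * k') u"
        by (simp add: nmul_add nmul_mult)
      from unit_gauge_le[OF _ this] n(1) n'(1) show ?thesis
        by (simp add: field_simps)
    qed
    have "unit_gauge (x + y) - (real k' - real l') / real n' \<le> unit_gauge x"
      if "0 < n'" "nmul n' y + nmul l' u \<preceq> nmul k' u" for k' l' n'
      by (rule unit_gauge_ge) (use *[OF _ _ that] in \<open>simp add: algebra_simps\<close>)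
    then have "unit_gauge (x + y) - unit_gauge x \<le> unit_gauge y"
      by (intro unit_gauge_ge) (simp add: algebra_simps)
    then show ?thesis by simp
  qed
  have zero: "unit_gauge 0 = 0"
  proof (rule antisym)
    show "unit_gauge 0 \<le> 0" using unit_gauge_le[of 1 0 0 0] by simp
    show "0 \<le> unit_gauge 0"
      by (rule unit_gauge_ge) (auto dest: unit_multiple_le)
  qed
  have "unit_gauge (nmul j x) = real j * unit_gauge x" for j x
  proof (rule antisym)
    show "unit_gauge (nmul j x) \<le> real j * unit_gauge x"
    proof (induction j)
      case (Suc j)
      then show ?case using sub[of x "nmul j x"] by (simp add: algebra_simps)
    qed (simp add: zero)
    show "real j * unit_gauge x \<le> unit_gauge (nmul j x)"
    proof (cases "j = 0")
      case False
      show ?thesis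
      proof (rule unit_gauge_ge)
        fix k l n assume n: "0 < n" "nmul n (nmul j x) + nmul l u \<preceq> nmul k u"
        then have "unit_gauge x \<le> (real k - real l) / real (n * j)"
          using False by (intro unit_gauge_le) (simp_all add: nmul_mult)
        then show "real j * unit_gauge x \<le> (real k - real l) / real n"
          using False n(1) by (simp add: field_simps)
      qed
    qed (simp add: zero)
  qed
  with sub show ?thesis by (simp add: sublinear_def)
qed

text \<open>Domination by the gauge already forces positivity and normalisation, since the gauge is
  at most 0 on negatives of elements of \<open>P\<close>, at most 1 at \<open>u\<close> and at most
  -1 at \<open>- u\<close>.\<close>

lemma positive_functional_attaining_gauge:
  obtains s where "positive_functional s" "s x = unit_gauge x"
proof -
  obtain s where s: "\<And>x y. s (x + y) = s x + s y" "\<And>x. s x \<le> unit_gauge x" "s x = unit_gauge x"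
    using additive_below_sublinear[OF sublinear_unit_gauge] by blast
  have s0: "s 0 = 0" using s(1)[of 0 0] by simp
  have neg: "s (- y) = - s y" for y using s(1)[of y "- y"] s0 by simp
  have "0 \<le> s y" if "y \<in> P" for y
    using s(2)[of "- y"] unit_gauge_le[of 1 "- y" 0 0] that by (simp add: neg le_def)
  moreover have "s u = 1"
    using s(2)[of u] s(2)[of "- u"] unit_gauge_le[of 1 u 0 1] unit_gauge_le[of 1 "- u" 1 0]
    by (simp add: neg le_def zero)
  ultimately show ?thesis using s by (intro that[of s]) (auto simp: positive_functional_def)
qed

text \<open>The gauge at \<open>x\<close> is the value of a positive functional, hence at most 0, so
  some fraction bounding \<open>x\<close> lies below \<open>1 / m\<close>. Clearing denominators
  leaves a factor \<open>n\<close>, to be cancelled once the cone is known to be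
  unperforated.\<close>

lemma nonpos_functionals_imp_small:
  assumes "\<And>s. positive_functional s \<Longrightarrow> s x \<le> 0"
  shows "\<exists>n>0. nmul n (u - nmul m x) \<in> P"
proof (cases "m = 0")
  case True
  then show ?thesis using unit_pos by (intro exI[of _ 1]) simp
next
  case False
  have "unit_gauge x \<le> 0" using assms positive_functional_attaining_gauge[of x] by metis
  then have "\<not> 1 / real m \<le> unit_gauge x" using False by (smt (verit) of_nat_0_less_iff neq0_conv zero_less_divide_1_iff)
  then obtain k l n where n: "0 < n" "nmul n x + nmul l u \<preceq> nmul k u" and "(real k - real l) / real n < 1 / real m"
    using unit_gauge_ge[of x "1 / real m"] by (meson not_le)
  then have "real m * real k < real n + real m * real l" using False by (simp add: field_simps)
  then have "m * k \<le> n + m * l" by (metis of_nat_add of_nat_mult of_nat_less_iff less_imp_le)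
  then have "nmul (m * k) u \<preceq> nmul (n + m * l) u" by (rule nmul_mono_left[OF _ unit_pos])
  moreover have "nmul m (nmul n x + nmul l u) \<preceq> nmul (m * k) u"
    using nmul_mono[OF n(2), of m] by (simp add: nmul_mult)
  ultimately have "nmul m (nmul n x + nmul l u) \<preceq> nmul (n + m * l) u" by (meson le_trans)
  moreover have "nmul n (nmul m x) = nmul m (nmul n x)" by (metis nmul_mult mult.commute)
  ultimately have "nmul n (u - nmul m x) \<in> P"
    by (simp add: le_def nmul_plus nmul_add nmul_diff nmul_mult diff_diff_eq)
  with n(1) show ?thesis by blast
qed

end

section \<open>Suprema, the Archimedean property and unperforation\<close>

locale riesz_sigma_cone = unital_cone P u for P :: "'g::ab_group_add set" and u +
  assumes riesz: "x \<in> P \<Longrightarrow> y \<in> P \<Longrightarrow> z \<in> P \<Longrightarrow> x \<preceq> y + z \<Longrightarrow>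
      \<exists>a\<in>P. x - a \<in> P \<and> a \<preceq> y \<and> x - a \<preceq> z"
    and unit_interval_complete: "(\<And>n. f n \<in> P) \<Longrightarrow> (\<And>n. f n \<preceq> f (Suc n)) \<Longrightarrow> (\<And>n. f n \<preceq> u) \<Longrightarrow>
      \<exists>s. (\<forall>n. f n \<preceq> s) \<and> (\<forall>w. w \<preceq> u \<longrightarrow> (\<forall>n. f n \<preceq> w) \<longrightarrow> s \<preceq> w)"
begin

text \<open>Decompose \<open>c - b\<close>, which is below \<open>(c - a) + (d - b)\<close> because
  \<open>d - a\<close> is positive, and subtract from \<open>c\<close> the part lying below
  \<open>c - a\<close>.\<close>

lemma interpolation:
  assumes "a \<preceq> c" "a \<preceq> d" "b \<preceq> c" "b \<preceq> d"
  obtains e where "a \<preceq> e" "b \<preceq> e" "e \<preceq> c" "e \<preceq> d"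
proof -
  have "c - b \<preceq> (c - a) + (d - b)" using assms(2) by (simp add: le_def algebra_simps)
  with assms obtain r where r: "r \<in> P" "c - b - r \<in> P" "r \<preceq> c - a" "c - b - r \<preceq> d - b"
    using riesz[of "c - b" "c - a" "d - b"] by (auto simp: le_def)
  show ?thesis
    by (rule that[of "c - r"]) (use r in \<open>simp_all add: le_def algebra_simps\<close>)
qed

definition incr :: "(nat \<Rightarrow> 'g) \<Rightarrow> bool" where
  "incr f \<longleftrightarrow> (\<forall>n. f n \<in> P \<and> f n \<preceq> f (Suc n))"

definition is_sup :: "(nat \<Rightarrow> 'g) \<Rightarrow> 'g \<Rightarrow> bool" where
  "is_sup f s \<longleftrightarrow> (\<forall>n. f n \<preceq> s) \<and> (\<forall>w. (\<forall>n. f n \<preceq> w) \<longrightarrow> s \<preceq> w)"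

lemma incr_mono:
  assumes "incr f" "m \<le> n"
  shows "f m \<preceq> f n"
  using assms(2) by (induction n rule: dec_induct) (use assms(1) in \<open>auto simp: incr_def intro: le_trans\<close>)

text \<open>Dependent choice: each increment of \<open>f\<close> is split by the Riesz property
  along the room still left in \<open>v\<close> and in \<open>w\<close>, so that both parts
  increase.\<close>

lemma incr_split:
  assumes f: "incr f" and bound: "\<And>n. f n \<preceq> v + w" and vw: "v \<in> P" "w \<in> P"
  obtains g where "incr g" "incr (\<lambda>n. f n - g n)" "\<And>n. g n \<preceq> v" "\<And>n. f n - g n \<preceq> w"
proof -
  have fP: "f n \<in> P" "f (Suc n) - f n \<in> P" for n using f by (auto simp: incr_def le_def)
  have "\<exists>g. \<forall>n. (g n \<in> P \<and> f n - g n \<in> P \<and> g n \<preceq> v \<and> f n - g n \<preceq> w)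
      \<and> (g n \<preceq> g (Suc n) \<and> f n - g n \<preceq> f (Suc n) - g (Suc n))"
  proof (rule dependent_nat_choice)
    show "\<exists>x. x \<in> P \<and> f 0 - x \<in> P \<and> x \<preceq> v \<and> f 0 - x \<preceq> w"
      using riesz[OF fP(1) vw bound] by blast
  next
    fix x n
    assume x: "x \<in> P \<and> f n - x \<in> P \<and> x \<preceq> v \<and> f n - x \<preceq> w"
    have "f (Suc n) - f n \<preceq> (v - x) + (w - (f n - x))"
      using bound[of "Suc n"] by (simp add: le_def algebra_simps)
    with x fP(2) obtain a where a: "a \<in> P" "f (Suc n) - f n - a \<in> P" "a \<preceq> v - x"
        "f (Suc n) - f n - a \<preceq> w - (f n - x)"
      using riesz[of "f (Suc n) - f n" "v - x" "w - (f n - x)"] by (auto simp: le_def)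
    have "f (Suc n) - (x + a) \<in> P"
      using add[of "f n - x" "f (Suc n) - f n - a"] x a(2) by (simp add: algebra_simps)
    with x a show "\<exists>y. (y \<in> P \<and> f (Suc n) - y \<in> P \<and> y \<preceq> v \<and> f (Suc n) - y \<preceq> w)
        \<and> (x \<preceq> y \<and> f n - x \<preceq> f (Suc n) - y)"
      by (intro exI[of _ "x + a"]) (auto simp: le_def algebra_simps intro: add)
  qed
  then show ?thesis using that by (auto simp: incr_def)
qed

text \<open>Monotonicity bounds \<open>f m + g n\<close> for independent indices; the two suprema
  can then be taken one after the other.\<close>

lemma sum_upper_bound:
  assumes f: "incr f" "is_sup f s" and g: "incr g" "is_sup g t"
  shows "is_sup (\<lambda>n. f n + g n) (s + t)"
  unfolding is_sup_def
proof (intro conjI allI impI)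
  fix n show "f n + g n \<preceq> s + t" using f(2) g(2) by (simp add: is_sup_def le_add_mono)
next
  fix w assume w: "\<forall>n. f n + g n \<preceq> w"
  have "f m \<preceq> w - g n" for m n
  proof -
    have "f m + g n \<preceq> f (max m n) + g (max m n)"
      using f(1) g(1) by (intro le_add_mono incr_mono) auto
    then show ?thesis using w by (auto simp: le_diff_iff intro: le_trans)
  qed
  then have "s \<preceq> w - g n" for n using f(2) by (auto simp: is_sup_def)
  then have "g n \<preceq> w - s" for n by (metis le_diff_iff add.commute)
  then have "t \<preceq> w - s" using g(2) by (auto simp: is_sup_def)
  then show "s + t \<preceq> w" by (simp add: le_diff_iff add.commute)
qed

text \<open>A supremum relative to the unit interval is below an arbitrary upper bound \<open>w\<close>: split the
  sequence along a decomposition of \<open>w\<close> into elements of the unit interval.\<close>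

lemma unit_interval_sup_le:
  assumes "incr f" "\<And>n. f n \<preceq> u"
    and "\<And>n. f n \<preceq> s" "\<And>v. v \<preceq> u \<Longrightarrow> (\<And>n. f n \<preceq> v) \<Longrightarrow> s \<preceq> v"
    and "w \<preceq> nmul k u" "\<And>n. f n \<preceq> w"
  shows "s \<preceq> w"
  using assms
proof (induction k arbitrary: f s w)
  case 0
  have "0 \<preceq> u" using unit_pos by (simp add: nonneg_iff)
  then have "w \<preceq> u" using 0(5) by (metis nmul.simps(1) le_trans)
  then show ?case using 0 by blast
next
  case (Suc k)
  have wP: "w \<in> P" using Suc.prems(1,6) by (metis incr_def le_trans nonneg_iff)
  have "w \<preceq> u + nmul k u" using Suc.prems(5) by simp
  from riesz[OF wP unit_pos nmul_pos[OF unit_pos] this]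
  obtain a where a: "a \<in> P" "w - a \<in> P" "a \<preceq> u" "w - a \<preceq> nmul k u" by blast
  have "f n \<preceq> a + (w - a)" for n using Suc.prems(6) by simp
  from incr_split[OF Suc.prems(1) this a(1,2)]
  obtain g where g: "incr g" "incr (\<lambda>n. f n - g n)" "\<And>n. g n \<preceq> a" "\<And>n. f n - g n \<preceq> w - a" by blast
  define h where "h n = f n - g n" for n
  have h: "incr h" "\<And>n. h n \<preceq> w - a" using g by (auto simp: h_def[abs_def])
  have gP: "g n \<in> P" "h n \<in> P" for n using g(1) h(1) by (auto simp: incr_def)
  have fu: "g m + h n \<preceq> u" for m n
  proof -
    have "g m + h n \<preceq> g (max m n) + h (max m n)"
      using g(1) h(1) by (intro le_add_mono incr_mono) auto
    then show ?thesis using Suc.prems(2)[of "max m n"] by (auto simp: h_def intro: le_trans)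
  qed
  have gu: "g n \<preceq> u" and hu: "h n \<preceq> u" for n
    using le_trans[OF _ fu[of n n]] gP[of n] by (simp_all add: le_def)
  obtain s1 where s1: "\<And>n. g n \<preceq> s1" "\<And>v. v \<preceq> u \<Longrightarrow> (\<And>n. g n \<preceq> v) \<Longrightarrow> s1 \<preceq> v"
    using unit_interval_complete[of g] g(1) gu by (auto simp: incr_def)
  obtain s2 where s2: "\<And>n. h n \<preceq> s2" "\<And>v. v \<preceq> u \<Longrightarrow> (\<And>n. h n \<preceq> v) \<Longrightarrow> s2 \<preceq> v"
    using unit_interval_complete[of h] h(1) hu by (auto simp: incr_def)
  have "s2 \<preceq> w - a" using Suc.IH[OF h(1) hu s2 a(4) h(2)] .
  moreover have "s1 \<preceq> a" using s1(2) a(3) g(3) by blast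
  ultimately have "s1 + s2 \<preceq> w" using le_add_mono[of s1 a s2 "w - a"] by simp
  \<comment> \<open>Leastness of \<open>s\<close> is known only among bounds below \<open>u\<close>,
    so \<open>s1 + s2\<close> must first be placed below \<open>u\<close>; this follows from
    \<open>g m + h n\<close> lying below \<open>u\<close> for independent indices.\<close>
  moreover have "s \<preceq> s1 + s2"
  proof (rule Suc.prems(4))
    have "s1 \<preceq> u - h n" for n
      using gP[of n] fu by (intro s1(2)) (auto simp: le_def algebra_simps)
    then have "h n \<preceq> u - s1" for n by (metis le_diff_iff add.commute)
    moreover have "0 \<preceq> s1" using s1(1)[of 0] gP(1)[of 0] by (metis le_trans nonneg_iff)
    then have "u - s1 \<preceq> u" by (simp add: le_def)
    ultimately have "s2 \<preceq> u - s1" using s2(2) by blast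
    then show "s1 + s2 \<preceq> u" by (metis le_diff_iff add.commute)
    show "f n \<preceq> s1 + s2" for n
      using le_add_mono[OF s1(1)[of n] s2(1)[of n]] by (simp add: h_def)
  qed
  ultimately show ?case by (rule le_trans[rotated])
qed

text \<open>For sequences below \<open>u\<close> the relative supremum is a genuine one by the
  preceding lemma. Below larger multiples of \<open>u\<close>, split off a sequence below
  \<open>u\<close> and add the suprema.\<close>

lemma bounded_incr_has_sup:
  assumes "incr f" "\<And>n. f n \<preceq> y"
  obtains s where "is_sup f s"
proof -
  have unit_sup: "\<exists>s. is_sup f s" if f: "incr f" "\<And>n. f n \<preceq> u" for f
  proof -
    obtain s where s: "\<And>n. f n \<preceq> s" "\<And>v. v \<preceq> u \<Longrightarrow> (\<And>n. f n \<preceq> v) \<Longrightarrow> s \<preceq> v"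
      using unit_interval_complete[of f] f by (auto simp: incr_def)
    have "s \<preceq> w" if "\<forall>n. f n \<preceq> w" for w
    proof -
      obtain k where "w \<preceq> nmul k u" using unit[of w] by (auto simp: le_def)
      then show ?thesis using unit_interval_sup_le[OF f s] that by blast
    qed
    then show ?thesis using s(1) by (auto simp: is_sup_def)
  qed
  have multiple: "\<exists>s. is_sup f s" if "incr f" "\<And>n. f n \<preceq> nmul k u" for f k
    using that
  proof (induction k arbitrary: f)
    case 0
    have "0 \<preceq> w" if "\<forall>n. f n \<preceq> w" for w
      using 0(1) that by (metis incr_def le_trans nonneg_iff)
    then show ?case using 0 by (intro exI[of _ 0]) (auto simp: is_sup_def)
  next
    case (Suc k)
    have "f n \<preceq> u + nmul k u" for n using Suc.prems(2) by simp
    from incr_split[OF Suc.prems(1) this unit_pos nmul_pos[OF unit_pos]]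
    obtain g where g: "incr g" "incr (\<lambda>n. f n - g n)" "\<And>n. g n \<preceq> u" "\<And>n. f n - g n \<preceq> nmul k u" by blast
    obtain s t where "is_sup g s" "is_sup (\<lambda>n. f n - g n) t"
      using unit_sup[OF g(1,3)] Suc.IH[OF g(2,4)] by blast
    from sum_upper_bound[OF g(1) this(1) g(2) this(2)] show ?case by auto
  qed
  obtain k where "y \<preceq> nmul k u" using unit[of y] by (auto simp: le_def)
  then have "f n \<preceq> nmul k u" for n using assms(2) le_trans by blast
  from multiple[OF assms(1) this] that show ?thesis by blast
qed

text \<open>If all multiples of \<open>x\<close> are below \<open>y\<close>, interpolate \<open>z (n + 1)\<close> between all multiples of \<open>x\<close> and
  \<open>{z n, z n - x}\<close>. Then \<open>i + x \<preceq> i\<close> for the infimum \<open>i\<close> of this decreasing sequence.\<close>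

lemma archimedean:
  assumes "\<And>m. nmul m x \<preceq> y"
  shows "x \<preceq> 0"
proof -
  \<comment> \<open>Infinitely many lower bounds are handled one at a time: starting above 0,
    interpolate an increasing sequence whose \<open>n\<close>-th term dominates
    \<open>nmul n x\<close>, and take its supremum.\<close>
  have between: "\<exists>z. (\<forall>m. nmul m x \<preceq> z) \<and> z \<preceq> p \<and> z \<preceq> q"
    if pq: "\<And>m. nmul m x \<preceq> p" "\<And>m. nmul m x \<preceq> q" for p q
  proof -
    have p0: "0 \<preceq> p" "0 \<preceq> q" using pq[of 0] by simp_all
    have "\<exists>f. \<forall>n. (nmul n x \<preceq> f n \<and> 0 \<preceq> f n \<and> f n \<preceq> p \<and> f n \<preceq> q) \<and> f n \<preceq> f (Suc n)"
    proof (rule dependent_nat_choice)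
      show "\<exists>z. nmul 0 x \<preceq> z \<and> 0 \<preceq> z \<and> z \<preceq> p \<and> z \<preceq> q"
        using p0 by (intro exI[of _ 0]) simp
    next
      fix z n assume z: "nmul n x \<preceq> z \<and> 0 \<preceq> z \<and> z \<preceq> p \<and> z \<preceq> q"
      obtain z' where z': "z \<preceq> z'" "nmul (Suc n) x \<preceq> z'" "z' \<preceq> p" "z' \<preceq> q"
        by (rule interpolation[of z p q "nmul (Suc n) x"]) (use z pq in blast)+
      moreover have "0 \<preceq> z'" using le_trans[of 0 z z'] z z'(1) by blast
      ultimately show "\<exists>z'. (nmul (Suc n) x \<preceq> z' \<and> 0 \<preceq> z' \<and> z' \<preceq> p \<and> z' \<preceq> q) \<and> z \<preceq> z'"
        by blast
    qed
    then obtain f where f: "\<And>n. nmul n x \<preceq> f n" "\<And>n. 0 \<preceq> f n" "\<And>n. f n \<preceq> p" "\<And>n. f n \<preceq> q"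
        "\<And>n. f n \<preceq> f (Suc n)" by blast
    then have "incr f" by (simp add: incr_def nonneg_iff)
    from bounded_incr_has_sup[OF this f(3)] obtain s where s: "is_sup f s" .
    then have "s \<preceq> p" "s \<preceq> q" using f(3,4) by (auto simp: is_sup_def)
    moreover have "nmul m x \<preceq> s" for m
      using f(1)[of m] s le_trans[of "nmul m x" "f m" s] by (auto simp: is_sup_def)
    ultimately show ?thesis by blast
  qed
  have "\<exists>z. \<forall>n. ((\<forall>m. nmul m x \<preceq> z n) \<and> z n \<preceq> y) \<and> (z (Suc n) \<preceq> z n \<and> z (Suc n) + x \<preceq> z n)"
  proof (rule dependent_nat_choice)
    show "\<exists>z. (\<forall>m. nmul m x \<preceq> z) \<and> z \<preceq> y" using assms by (intro exI[of _ y]) simp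
  next
    fix z and n :: nat assume z: "(\<forall>m. nmul m x \<preceq> z) \<and> z \<preceq> y"
    have "nmul m x \<preceq> z - x" for m
      using z[THEN conjunct1, rule_format, of "Suc m"] by (simp add: le_diff_iff add.commute)
    with z obtain z' where z': "\<forall>m. nmul m x \<preceq> z'" "z' \<preceq> z" "z' \<preceq> z - x"
      using between[of z "z - x"] by blast
    moreover have "z' \<preceq> y" using le_trans[OF z'(2)] z by blast
    ultimately show "\<exists>z'. ((\<forall>m. nmul m x \<preceq> z') \<and> z' \<preceq> y) \<and> (z' \<preceq> z \<and> z' + x \<preceq> z)"
      by (auto simp: le_diff_iff)
  qed
  then obtain z where z: "\<And>n m. nmul m x \<preceq> z n" "\<And>n. z n \<preceq> y" "\<And>n. z (Suc n) \<preceq> z n" "\<And>n. z (Suc n) + x \<preceq> z n"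
    by blast
  \<comment> \<open>Suprema are available only for increasing sequences in the cone, so the infimum
    of \<open>z\<close> is obtained as \<open>y - s\<close> with \<open>s\<close> the supremum of
    \<open>y - z n\<close>.\<close>
  have "y - z n \<preceq> y" for n using z(1)[of 0 n] by (simp add: le_def)
  moreover have "incr (\<lambda>n. y - z n)" using z(2,3) by (simp add: incr_def le_def)
  ultimately obtain s where s: "is_sup (\<lambda>n. y - z n) s"
    using bounded_incr_has_sup by blast
  have "y - z n \<preceq> s - x" for n
  proof -
    have "y - z (Suc n) \<preceq> s" using s by (auto simp: is_sup_def)
    from le_add_mono[OF this z(4)[of n]] show ?thesis by (simp add: le_def algebra_simps)
  qed
  then have "s \<preceq> s - x" using s by (auto simp: is_sup_def)
  then show ?thesis by (simp add: le_def)
qed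

text \<open>Division of \<open>m\<close> by \<open>n\<close> with remainder bounds every multiple of
  \<open>x\<close>: the quotient contributes a nonpositive element and fewer than \<open>n\<close>
  copies of \<open>x\<close> remain. The Archimedean property then applies.\<close>

lemma unperforated:
  assumes "0 < n" "nmul n x \<preceq> 0"
  shows "x \<preceq> 0"
proof -
  obtain k where k: "x \<preceq> nmul k u" using unit[of x] by (auto simp: le_def)
  show ?thesis
  proof (rule archimedean)
    fix m
    have "nmul m x = nmul (m div n) (nmul n x) + nmul (m mod n) x"
      using nmul_add[of "m div n * n" "m mod n" x] by (simp add: nmul_mult)
    also have "\<dots> \<preceq> 0 + nmul (m mod n) (nmul k u)"
      using le_add_mono[OF nmul_mono[OF assms(2), of "m div n"] nmul_mono[OF k]] by simp
    also have "\<dots> \<preceq> nmul n (nmul k u)"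
      using nmul_mono_left[OF _ nmul_pos[OF unit_pos]] assms(1) by simp
    finally show "nmul m x \<preceq> nmul n (nmul k u)" .
  qed
qed

text \<open>Unperforation cancels the factor left by the gauge argument, so all multiples of
  \<open>x\<close> stay below \<open>u\<close>, and the Archimedean property finishes.\<close>

theorem nonpos_if_functionals_nonpos:
  assumes "\<And>s. positive_functional s \<Longrightarrow> s x \<le> 0"
  shows "x \<preceq> 0"
proof (rule archimedean[of x u])
  fix m
  obtain n where n: "0 < n" "nmul n (u - nmul m x) \<in> P"
    using nonpos_functionals_imp_small[of x m] assms by auto
  have "0 - nmul n (nmul m x - u) = nmul n (u - nmul m x)"
    by (simp add: nmul_diff)
  with n(2) have "nmul n (nmul m x - u) \<preceq> 0"
    by (simp only: le_def)
  from unperforated[OF n(1) this] show "nmul m x \<preceq> u" by (simp add: le_def)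
qed

end

section \<open>Extreme points of compact convex sets of functions\<close>

lemma compact_imp_closed_fun:
  fixes C :: "('i \<Rightarrow> real) set"
  assumes "compact C"
  shows "closed C"
proof -
  have "Hausdorff_space (euclidean :: ('i \<Rightarrow> real) topology)"
    by (simp add: Hausdorff_space_product_topology flip: euclidean_product_topology)
  then show ?thesis
    using compactin_imp_closedin[of euclidean C] assms by simp
qed

lemma continuous_on_coordinate: "continuous_on S (\<lambda>x. x i :: real)"
  by (rule continuous_on_subset[OF continuous_on_product_coordinates]) simp

lemma open_fun_contains_box:
  fixes x :: "'i \<Rightarrow> real"
  assumes "open V" "x \<in> V"
  obtains J e where "finite J" "0 < e" "\<And>y. (\<And>j. j \<in> J \<Longrightarrow> \<bar>y j - x j\<bar> < e) \<Longrightarrow> y \<in> V"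
proof -
  have "openin (product_topology (\<lambda>i. euclidean) UNIV) V"
    using assms(1) by (simp add: open_fun_def)
  from product_topology_open_contains_basis[OF this assms(2)]
  obtain X where X: "x \<in> Pi\<^sub>E UNIV X" "\<And>i. open (X i)" "finite {i. X i \<noteq> UNIV}" "Pi\<^sub>E UNIV X \<subseteq> V"
    by auto
  define J where "J = {i. X i \<noteq> UNIV}"
  have "\<exists>d>0. ball (x i) d \<subseteq> X i" for i
    using X(1,2) by (simp add: open_contains_ball PiE_iff)
  then obtain d where d: "\<And>i. d i > 0" "\<And>i. ball (x i) (d i) \<subseteq> X i" by metis
  define e where "e = Min (insert 1 (d ` J))"
  have fin: "finite J" using X(3) by (simp add: J_def)
  have "e > 0" using fin d(1) by (simp add: e_def)
  moreover have "y \<in> V" if y: "\<And>j. j \<in> J \<Longrightarrow> \<bar>y j - x j\<bar> < e" for y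
  proof -
    have "y j \<in> X j" for j
    proof (cases "j \<in> J")
      case True
      then have "e \<le> d j" using fin by (simp add: e_def)
      then have "y j \<in> ball (x j) (d j)" using y[OF True] by (simp add: dist_real_def abs_minus_commute)
      then show ?thesis using d(2) by blast
    qed (simp add: J_def)
    then show ?thesis using X(4) by (auto simp: PiE_iff)
  qed
  ultimately show ?thesis using fin that by blast
qed

section \<open>Convexity, faces and Bauer's maximum principle\<close>

definition mix :: "real \<Rightarrow> ('i \<Rightarrow> real) \<Rightarrow> ('i \<Rightarrow> real) \<Rightarrow> 'i \<Rightarrow> real" where
  "mix t x y = (\<lambda>i. t * x i + (1 - t) * y i)"

definition mix_closed :: "('i \<Rightarrow> real) set \<Rightarrow> bool" where
  "mix_closed C \<longleftrightarrow> (\<forall>x\<in>C. \<forall>y\<in>C. \<forall>t. 0 \<le> t \<and> t \<le> 1 \<longrightarrow> mix t x y \<in> C)"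

lemma mix_closedD: "mix_closed C \<Longrightarrow> x \<in> C \<Longrightarrow> y \<in> C \<Longrightarrow> 0 \<le> t \<Longrightarrow> t \<le> 1 \<Longrightarrow> mix t x y \<in> C"
  by (simp add: mix_closed_def)

lemma mix_0 [simp]: "mix 0 x y = y" and mix_1 [simp]: "mix 1 x y = x"
  by (simp_all add: mix_def)

text \<open>The four weights are regrouped: \<open>r\<close> is the total weight of \<open>a\<close>
  and \<open>a'\<close>, while \<open>p\<close> and \<open>q\<close> are the relative weights inside
  the two groups. This is what makes the join of two convex sets convex.\<close>

lemma mix_mix:
  assumes t: "0 \<le> t" "t \<le> 1" "0 \<le> t'" "t' \<le> 1" "0 \<le> s" "s \<le> 1"
  obtains r p q where "0 \<le> r" "r \<le> 1" "0 \<le> p" "p \<le> 1" "0 \<le> q" "q \<le> 1"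
    "\<And>a b a' b'. mix s (mix t a b) (mix t' a' b') = mix r (mix p a a') (mix q b b')"
proof -
  define r where "r = s * t + (1 - s) * t'"
  have r': "1 - r = s * (1 - t) + (1 - s) * (1 - t')" by (simp add: r_def algebra_simps)
  have nn: "0 \<le> s * t" "0 \<le> (1 - s) * t'" "0 \<le> s * (1 - t)" "0 \<le> (1 - s) * (1 - t')" using t by simp_all
  have "0 \<le> r" unfolding r_def using nn by simp
  have "0 \<le> 1 - r" unfolding r' using nn by (intro add_nonneg_nonneg)
  have ex: "\<exists>p. 0 \<le> p \<and> p \<le> 1 \<and> (c + d) * p = c" if "0 \<le> c" "0 \<le> d" for c d :: real
  proof (cases "c + d = 0")
    case True
    then show ?thesis using that by (intro exI[of _ 0]) auto
  next
    case False
    then show ?thesis using that by (intro exI[of _ "c / (c + d)"]) (auto simp: divide_le_eq)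
  qed
  obtain p where p: "0 \<le> p" "p \<le> 1" "r * p = s * t" using ex[OF nn(1,2)] unfolding r_def by blast
  obtain q where q: "0 \<le> q" "q \<le> 1" "(1 - r) * q = s * (1 - t)" using ex[OF nn(3,4)] unfolding r' by blast
  have p': "r * (1 - p) = (1 - s) * t'" using p(3) by (simp add: r_def algebra_simps)
  have "(1 - r) * (1 - q) = (1 - r) - (1 - r) * q" by (simp add: algebra_simps)
  then have q': "(1 - r) * (1 - q) = (1 - s) * (1 - t')" using q(3) r' by linarith
  have "mix s (mix t a b) (mix t' a' b') = mix r (mix p a a') (mix q b b')" for a b a' b' :: "'a \<Rightarrow> real"
  proof
    fix i
    have "mix r (mix p a a') (mix q b b') i =
        (r * p) * a i + (r * (1 - p)) * a' i + ((1 - r) * q) * b i + ((1 - r) * (1 - q)) * b' i"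
      by (simp add: mix_def algebra_simps)
    also have "\<dots> = mix s (mix t a b) (mix t' a' b') i"
      unfolding p(3) p' q(3) q' by (simp add: mix_def algebra_simps)
    finally show "mix s (mix t a b) (mix t' a' b') i = mix r (mix p a a') (mix q b b') i" by simp
  qed
  with p q \<open>0 \<le> r\<close> \<open>0 \<le> 1 - r\<close> show ?thesis by (intro that[of r p q]) auto
qed

locale compact_convex_set =
  fixes K :: "('i \<Rightarrow> real) set"
  assumes compact: "compact K" and convex: "mix_closed K"
begin

definition extreme :: "('i \<Rightarrow> real) set" where
  "extreme = {x \<in> K. \<forall>y\<in>K. \<forall>z\<in>K. \<forall>t. 0 < t \<and> t < 1 \<and> x = mix t y z \<longrightarrow> y = x \<and> z = x}"

definition cvx :: "(('i \<Rightarrow> real) \<Rightarrow> real) \<Rightarrow> bool" where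
  "cvx f \<longleftrightarrow> (\<forall>x\<in>K. \<forall>y\<in>K. \<forall>t. 0 \<le> t \<and> t \<le> 1 \<longrightarrow> f (mix t x y) \<le> t * f x + (1 - t) * f y)"

text \<open>A compact extremal set, which may fail to be convex: maximisers of a convex function can
  be the two ends of a segment.\<close>

definition face :: "('i \<Rightarrow> real) set \<Rightarrow> bool" where
  "face E \<longleftrightarrow> compact E \<and> E \<noteq> {} \<and> E \<subseteq> K \<and>
    (\<forall>y\<in>K. \<forall>z\<in>K. \<forall>t. 0 < t \<and> t < 1 \<and> mix t y z \<in> E \<longrightarrow> y \<in> E \<and> z \<in> E)"

lemma faceD:
  assumes "face E"
  shows "compact E" "E \<noteq> {}" "E \<subseteq> K"
    "y \<in> K \<Longrightarrow> z \<in> K \<Longrightarrow> 0 < t \<Longrightarrow> t < 1 \<Longrightarrow> mix t y z \<in> E \<Longrightarrow> y \<in> E \<and> z \<in> E"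
  using assms by (auto simp: face_def)

lemma convex_combination_max:
  fixes m :: real
  assumes "0 < t" "t < 1" "p \<le> m" "q \<le> m" "m \<le> t * p + (1 - t) * q"
  shows "p = m" "q = m"
proof -
  have "t * p \<le> t * m" "(1 - t) * q \<le> (1 - t) * m" using assms by (simp_all add: mult_left_mono)
  moreover have "t * m + (1 - t) * m = m" by (simp add: algebra_simps)
  ultimately have "t * p = t * m" "(1 - t) * q = (1 - t) * m" using assms(5) by linarith+
  then show "p = m" "q = m" using assms(1,2) by simp_all
qed

text \<open>If a convex function reaches its maximum over \<open>E\<close> strictly inside a segment
  with ends in \<open>E\<close>, it reaches it at both ends.\<close>

lemma face_argmax:
  assumes E: "face E" and cont: "continuous_on E f" and f: "cvx f"
  shows "face {x \<in> E. \<forall>y\<in>E. f y \<le> f x}" (is "face ?F")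
proof -
  obtain x where x: "x \<in> E" "\<And>y. y \<in> E \<Longrightarrow> f y \<le> f x"
    using continuous_attains_sup[OF faceD(1,2)[OF E] cont] by blast
  have F: "?F = {y \<in> E. f x \<le> f y}" using x by (auto intro: order.trans)
  obtain D where "closed D" "D \<inter> E = f -` {f x..} \<inter> E"
    using continuous_on_closed_invariant[THEN iffD1, OF cont, rule_format, of "{f x..}"] by auto
  then have "?F = E \<inter> D" using F by auto
  then have "compact ?F" using faceD(1)[OF E] \<open>closed D\<close> by (simp add: compact_Int_closed)
  moreover have "y \<in> ?F \<and> z \<in> ?F" if y: "y \<in> K" "z \<in> K" "0 < t" "t < 1" "mix t y z \<in> ?F" for y z t
  proof -
    have yz: "y \<in> E" "z \<in> E" using faceD(4)[OF E y(1-4)] y(5) by simp_all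
    have "f x \<le> t * f y + (1 - t) * f z"
      using f y F unfolding cvx_def by (smt (verit) mem_Collect_eq)
    from convex_combination_max[OF y(3,4) x(2)[OF yz(1)] x(2)[OF yz(2)] this]
    show ?thesis using yz F by simp
  qed
  ultimately show ?thesis using x faceD(3)[OF E] unfolding face_def F by blast
qed

lemma cvx_coordinate: "cvx (\<lambda>x. x i)"
  by (simp add: cvx_def mix_def)

text \<open>Zorn's lemma; by compactness a chain of faces has a nonempty intersection, which is
  again extremal.\<close>

lemma minimal_face_exists:
  assumes "face E0"
  obtains E where "face E" "E \<subseteq> E0" "\<And>F. face F \<Longrightarrow> F \<subseteq> E \<Longrightarrow> F = E"
proof -
  define A where "A = {E. face E \<and> E \<subseteq> E0}"
  have "\<exists>m\<in>A. \<forall>a\<in>A. m \<supseteq> a \<longrightarrow> a = m"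
  proof (rule predicate_Zorn)
    show "partial_order_on A (relation_of (\<supseteq>) A)"
      unfolding partial_order_on_def preorder_on_def refl_on_def trans_def antisym_def relation_of_def
      by auto
  next
    fix C assume C: "C \<in> Chains (relation_of (\<supseteq>) A)"
    then have CA: "C \<subseteq> A" and lin: "\<And>E F. E \<in> C \<Longrightarrow> F \<in> C \<Longrightarrow> E \<subseteq> F \<or> F \<subseteq> E"
      unfolding Chains_def relation_of_def by auto
    have fC: "face E" "E \<subseteq> E0" if "E \<in> C" for E using CA that by (auto simp: A_def)
    show "\<exists>b\<in>A. \<forall>a\<in>C. a \<supseteq> b"
    proof (cases "C = {}")
      case True
      then show ?thesis using assms by (auto simp: A_def)
    next
      case False
      have ne: "K \<inter> \<Inter>C \<noteq> {}"
      proof (rule compact_imp_fip[OF compact])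
        show "closed E" if "E \<in> C" for E using faceD(1)[OF fC(1)[OF that]] by (rule compact_imp_closed_fun)
        fix B assume B: "finite B" "B \<subseteq> C"
        have "\<exists>E\<in>C. E \<subseteq> \<Inter>B"
          using B
        proof (induction B)
          case empty
          then show ?case using False by auto
        next
          case (insert F B)
          then obtain E where E: "E \<in> C" "E \<subseteq> \<Inter>B" and F: "F \<in> C" by auto
          from lin[OF F E(1)] show ?case
          proof
            assume "F \<subseteq> E"
            with E F show ?thesis by (intro bexI[of _ F]) auto
          next
            assume "E \<subseteq> F"
            with E show ?thesis by (intro bexI[of _ E]) auto
          qed
        qed
        then obtain E where E: "E \<in> C" "E \<subseteq> \<Inter>B" by blast
        show "K \<inter> \<Inter>B \<noteq> {}" using faceD(2,3)[OF fC(1)[OF E(1)]] E(2) by blast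
      qed
      obtain E where E: "E \<in> C" using False by blast
      have "closed (\<Inter>C)" by (intro closed_Inter ballI compact_imp_closed_fun faceD(1)[OF fC(1)])
      then have "compact (E \<inter> \<Inter>C)" using faceD(1)[OF fC(1)[OF E]] by (simp add: compact_Int_closed)
      moreover have "E \<inter> \<Inter>C = \<Inter>C" using E by blast
      ultimately have cpt: "compact (\<Inter>C)" by simp
      have sub: "\<Inter>C \<subseteq> K" using E faceD(3)[OF fC(1)[OF E]] by blast
      have "y \<in> \<Inter>C \<and> z \<in> \<Inter>C"
        if "y \<in> K" "z \<in> K" "0 < t" "t < 1" "mix t y z \<in> \<Inter>C" for y z t
        using faceD(4)[OF fC(1) that(1-4)] that(5) by blast
      with cpt sub ne have "face (\<Inter>C)"
        unfolding face_def by blast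
      then show ?thesis using fC(2) E by (intro bexI[of _ "\<Inter>C"]) (auto simp: A_def)
    qed
  qed
  then obtain E where "face E" "E \<subseteq> E0" "\<And>F. face F \<Longrightarrow> F \<subseteq> E0 \<Longrightarrow> F \<subseteq> E \<Longrightarrow> F = E"
    unfolding A_def by blast
  then show ?thesis using that[of E] by (meson subset_trans)
qed

text \<open>A minimal face among the maximisers is a single point: each coordinate is affine, so its
  maximisers form a smaller face and it must be constant. A one-point face is an extreme
  point.\<close>

theorem bauer_maximum_principle:
  assumes "K \<noteq> {}" "continuous_on K f" "cvx f"
  obtains x where "x \<in> extreme" "\<And>y. y \<in> K \<Longrightarrow> f y \<le> f x"
proof -
  have "face K" using compact assms(1) by (auto simp: face_def)
  from face_argmax[OF this assms(2,3)] obtain E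
    where E: "face E" "E \<subseteq> {x \<in> K. \<forall>y\<in>K. f y \<le> f x}" and min: "\<And>F. face F \<Longrightarrow> F \<subseteq> E \<Longrightarrow> F = E"
    by (rule minimal_face_exists) blast
  obtain x where x: "x \<in> E" using faceD(2)[OF E(1)] by blast
  have "y = x" if y: "y \<in> E" for y
  proof
    fix i
    have "{x \<in> E. \<forall>y\<in>E. y i \<le> x i} = E"
      by (rule min[OF face_argmax[OF E(1) continuous_on_coordinate cvx_coordinate]]) simp
    then have "x i \<le> y i" "y i \<le> x i" using x y by blast+
    then show "y i = x i" by simp
  qed
  then have Ex: "E = {x}" using x by blast
  have "x \<in> extreme"
    using faceD(3,4)[OF E(1)] unfolding Ex extreme_def by blast
  with E(2) x that show ?thesis by blast
qed

text \<open>The join of \<open>A\<close> and \<open>B\<close> is a continuous image of a compact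
  product. It misses \<open>x\<close> because an extreme point lies on a segment only as an
  endpoint. If one set is empty the product is empty, so the other set is used instead.\<close>

lemma extreme_join:
  assumes x: "x \<in> extreme"
    and A: "compact A" "A \<subseteq> K" "mix_closed A" "x \<notin> A" and B: "compact B" "B \<subseteq> K" "mix_closed B" "x \<notin> B"
  shows "\<exists>C. compact C \<and> C \<subseteq> K \<and> mix_closed C \<and> x \<notin> C \<and> A \<subseteq> C \<and> B \<subseteq> C"
proof (cases "A = {} \<or> B = {}")
  case True
  then show ?thesis using A B by blast
next
  case False
  define C where "C = (\<lambda>(t, a, b). mix t a b) ` ({0..1} \<times> A \<times> B)"
  have "continuous_on ({0..1} \<times> A \<times> B) (\<lambda>(t, a, b). mix t a b)"
  proof (rule continuous_on_coordinatewise_then_product)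
    fix i
    have c: "continuous_on ({0..1} \<times> A \<times> B) (\<lambda>z. fst (snd z) i)" "continuous_on ({0..1} \<times> A \<times> B) (\<lambda>z. snd (snd z) i)"
      by (rule continuous_on_product_then_coordinatewise, intro continuous_intros)+
    have "continuous_on ({0..1} \<times> A \<times> B) (\<lambda>z. fst z * fst (snd z) i + (1 - fst z) * snd (snd z) i)"
      by (intro continuous_intros c)
    then show "continuous_on ({0..1} \<times> A \<times> B) (\<lambda>z. (case z of (t, a, b) \<Rightarrow> mix t a b) i)"
      by (simp add: case_prod_beta mix_def)
  qed
  then have "compact C" unfolding C_def using A(1) B(1)
    by (intro compact_continuous_image compact_Times) auto
  moreover have "C \<subseteq> K" unfolding C_def using mix_closedD[OF convex subsetD[OF A(2)] subsetD[OF B(2)]] by auto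
  moreover have "mix_closed C"
    unfolding mix_closed_def
  proof (intro ballI allI impI)
    fix c c' s assume "c \<in> C" "c' \<in> C" and s: "0 \<le> s \<and> s \<le> (1::real)"
    then obtain t a b t' a' b' where c: "c = mix t a b" "0 \<le> t" "t \<le> 1" "a \<in> A" "b \<in> B"
      and c': "c' = mix t' a' b'" "0 \<le> t'" "t' \<le> 1" "a' \<in> A" "b' \<in> B" by (auto simp: C_def)
    obtain r p q where r: "0 \<le> r" "r \<le> 1" "0 \<le> p" "p \<le> 1" "0 \<le> q" "q \<le> 1"
      "mix s c c' = mix r (mix p a a') (mix q b b')"
      using mix_mix[OF c(2,3) c'(2,3), of s] s unfolding c(1) c'(1) by metis
    then have "mix p a a' \<in> A" "mix q b b' \<in> B" using mix_closedD[OF A(3)] mix_closedD[OF B(3)] c c' by simp_all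
    then show "mix s c c' \<in> C" using r(1,2,7) by (force simp: C_def)
  qed
  moreover have "x \<notin> C"
  proof
    assume "x \<in> C"
    then obtain t a b where t: "x = mix t a b" "0 \<le> t" "t \<le> 1" "a \<in> A" "b \<in> B" by (auto simp: C_def)
    show False
    proof (cases "t = 0 \<or> t = 1")
      case True
      then show False using t A(4) B(4) by auto
    next
      case False
      then have "a = x" using x t A(2) B(2) unfolding extreme_def by (smt (verit) mem_Collect_eq subsetD)
      then show False using t(4) A(4) by simp
    qed
  qed
  moreover have "A \<subseteq> C"
  proof
    fix a assume "a \<in> A"
    moreover obtain b where "b \<in> B" using False by blast
    ultimately have "mix 1 a b \<in> C" unfolding C_def by (intro image_eqI[of _ _ "(1, a, b)"]) auto
    then show "a \<in> C" by simp
  qed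
  moreover have "B \<subseteq> C"
  proof
    fix b assume "b \<in> B"
    moreover obtain a where "a \<in> A" using False by blast
    ultimately have "mix 0 a b \<in> C" unfolding C_def by (intro image_eqI[of _ _ "(0, a, b)"]) auto
    then show "b \<in> C" by simp
  qed
  ultimately show ?thesis by blast
qed

text \<open>Outside a box around \<open>x\<close> the points of \<open>K\<close> lie in finitely
  many closed half-spaces, two for each coordinate. Their slices of \<open>K\<close> are joined one
  by one without ever reaching \<open>x\<close>.\<close>

lemma extreme_hull:
  assumes x: "x \<in> extreme" and "finite J" and e: "0 < e"
  shows "\<exists>C. compact C \<and> C \<subseteq> K \<and> mix_closed C \<and> x \<notin> C \<and> (\<forall>y\<in>K. \<forall>j\<in>J. e \<le> \<bar>y j - x j\<bar> \<longrightarrow> y \<in> C)"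
  using assms(2)
proof (induction J)
  case empty
  then show ?case by (intro exI[of _ "{}"]) (simp add: mix_closed_def)
next
  case (insert j J)
  then obtain C where C: "compact C" "C \<subseteq> K" "mix_closed C" "x \<notin> C"
    "\<forall>y\<in>K. \<forall>j\<in>J. e \<le> \<bar>y j - x j\<bar> \<longrightarrow> y \<in> C" by blast
  \<comment> \<open>The factor \<open>b\<close> is a sign, 1 or -1, so that upper and lower
    half-spaces are treated together.\<close>
  have half: "compact (K \<inter> {y. c \<le> b * y j})" "K \<inter> {y. c \<le> b * y j} \<subseteq> K" "mix_closed (K \<inter> {y. c \<le> b * y j})" for b c
  proof -
    have "closed {y. c \<le> b * y j}"
      by (intro closed_Collect_le continuous_intros) (rule continuous_on_coordinate)
    then show "compact (K \<inter> {y. c \<le> b * y j})" using compact by (simp add: compact_Int_closed)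
    have "c \<le> b * mix t y z j" if "c \<le> b * y j" "c \<le> b * z j" "0 \<le> t" "t \<le> 1" for t y z
    proof -
      have "t * c + (1 - t) * c \<le> t * (b * y j) + (1 - t) * (b * z j)"
        using that by (intro add_mono mult_left_mono) auto
      then show ?thesis by (simp add: mix_def algebra_simps)
    qed
    then show "mix_closed (K \<inter> {y. c \<le> b * y j})" using convex by (auto simp: mix_closed_def)
  qed simp
  let ?A = "K \<inter> {y. x j + e \<le> 1 * y j}" and ?B = "K \<inter> {y. e - x j \<le> -1 * y j}"
  have "x \<notin> ?A" using e by simp
  from extreme_join[OF x C(1-4) half[where b=1 and c="x j + e"] this]
  obtain D where D: "compact D" "D \<subseteq> K" "mix_closed D" "x \<notin> D" "C \<subseteq> D" "?A \<subseteq> D" by blast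
  have "x \<notin> ?B" using e by simp
  from extreme_join[OF x D(1-4) half[where b="-1" and c="e - x j"] this]
  obtain F where F: "compact F" "F \<subseteq> K" "mix_closed F" "x \<notin> F" "D \<subseteq> F" "?B \<subseteq> F" by blast
  have "y \<in> F" if "y \<in> K" "i \<in> insert j J" "e \<le> \<bar>y i - x i\<bar>" for y i
  proof (cases "i \<in> J")
    case True
    then show ?thesis using that C(5) D(5) F(5) by blast
  next
    case False
    then have "i = j" using that by simp
    then have "y \<in> ?A \<or> y \<in> ?B" using that by (auto simp: abs_if split: if_splits)
    then show ?thesis using D F by blast
  qed
  then show ?case using F by blast
qed

text \<open>The bump is the distance to a compact convex \<open>C\<close> that contains
  \<open>K - V\<close> but not \<open>x\<close>: distance to a convex set is convex and vanishes on
  the set. A sum over finitely many coordinates suffices as seminorm, since some box around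
  \<open>x\<close> misses \<open>C\<close>.\<close>

lemma extreme_bump:
  assumes x: "x \<in> extreme" and V: "open V" "x \<in> V"
  obtains f where "continuous_on K f" "cvx f" "\<And>y. y \<in> K \<Longrightarrow> 0 \<le> f y" "\<And>y. y \<in> K \<Longrightarrow> y \<notin> V \<Longrightarrow> f y = 0" "0 < f x"
proof -
  obtain J e where J: "finite J" "0 < e" "\<And>y. (\<And>j. j \<in> J \<Longrightarrow> \<bar>y j - x j\<bar> < e) \<Longrightarrow> y \<in> V"
    using open_fun_contains_box[OF V] by metis
  obtain C where C: "compact C" "C \<subseteq> K" "mix_closed C" "x \<notin> C"
    and C': "\<And>y j. y \<in> K \<Longrightarrow> j \<in> J \<Longrightarrow> e \<le> \<bar>y j - x j\<bar> \<Longrightarrow> y \<in> C"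
    using extreme_hull[OF x J(1,2)] by blast
  have VC: "y \<in> C" if "y \<in> K" "y \<notin> V" for y using J(3)[of y] C' that not_less by blast
  show ?thesis
  proof (cases "C = {}")
    \<comment> \<open>Distance to the empty set would be meaningless, but then \<open>K\<close> lies
      inside \<open>V\<close> and a constant will do.\<close>
    case True
    show ?thesis by (rule that[of "\<lambda>_. 1"]) (use VC True in \<open>auto simp: cvx_def\<close>)
  next
    case False
    have "open (- C)" using compact_imp_closed_fun[OF C(1)] by (simp add: open_Compl)
    then obtain I d where I: "finite I" "0 < d" "\<And>y. (\<And>j. j \<in> I \<Longrightarrow> \<bar>y j - x j\<bar> < d) \<Longrightarrow> y \<in> - C"
      using open_fun_contains_box[of "- C" x] C(4) by (metis ComplI)
    define D where "D y z = (\<Sum>j\<in>I. \<bar>y j - z j\<bar>)" for y z :: "'i \<Rightarrow> real"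
    define f where "f y = (INF c\<in>C. D y c)" for y
    have D0: "0 \<le> D y z" for y z by (simp add: D_def sum_nonneg)
    have low: "f y \<le> D y c" if "c \<in> C" for y c
      unfolding f_def by (rule cINF_lower) (use that D0 in \<open>auto intro!: bdd_belowI2[where m = 0]\<close>)
    have ge: "b \<le> f y" if "\<And>c. c \<in> C \<Longrightarrow> b \<le> D y c" for b y
      unfolding f_def using False that by (rule cINF_greatest)
    have tri: "D y z \<le> D y w + D w z" for y z w
      unfolding D_def sum.distrib[symmetric] by (rule sum_mono) linarith
    have sym: "D y z = D z y" for y z by (simp add: D_def abs_minus_commute)
    have lip: "f y \<le> f z + D y z" for y z
    proof -
      have "f y - D y z \<le> f z"
        by (rule ge) (use low tri in \<open>smt (verit)\<close>)
      then show ?thesis by simp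
    qed
    have "continuous_on K f"
      unfolding continuous_on_def
    proof
      fix y assume "y \<in> K"
      have "continuous_on K (\<lambda>z. D z y)"
        unfolding D_def by (intro continuous_intros continuous_on_coordinate)
      then have "((\<lambda>z. D z y) \<longlongrightarrow> D y y) (at y within K)" using \<open>y \<in> K\<close> by (simp add: continuous_on_def)
      then have lim: "((\<lambda>z. D z y) \<longlongrightarrow> 0) (at y within K)" by (simp add: D_def)
      have "norm (f z - f y) \<le> D z y" for z
        using lip[of y z] lip[of z y] sym[of y z] by (simp add: abs_le_iff)
      then have "\<forall>\<^sub>F z in at y within K. norm (f z - f y) \<le> D z y" by simp
      from Lim_null_comparison[OF this lim] show "(f \<longlongrightarrow> f y) (at y within K)"
        by (rule LIM_zero_cancel)
    qed
    moreover have "cvx f"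
      unfolding cvx_def
    proof (intro ballI allI impI)
      fix y z and t :: real assume t: "0 \<le> t \<and> t \<le> 1"
      have D_mix: "D (mix t y z) (mix t c c') \<le> t * D y c + (1 - t) * D z c'" for c c'
      proof -
        have "\<bar>mix t y z j - mix t c c' j\<bar> \<le> t * \<bar>y j - c j\<bar> + (1 - t) * \<bar>z j - c' j\<bar>" for j
        proof -
          have "mix t y z j - mix t c c' j = t * (y j - c j) + (1 - t) * (z j - c' j)"
            by (simp add: mix_def algebra_simps)
          then show ?thesis using t abs_triangle_ineq[of "t * (y j - c j)" "(1 - t) * (z j - c' j)"]
            by (simp add: abs_mult)
        qed
        then have "D (mix t y z) (mix t c c') \<le> (\<Sum>j\<in>I. t * \<bar>y j - c j\<bar> + (1 - t) * \<bar>z j - c' j\<bar>)"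
          unfolding D_def by (rule sum_mono)
        then show ?thesis by (simp add: D_def sum.distrib sum_distrib_left)
      qed
      show "f (mix t y z) \<le> t * f y + (1 - t) * f z"
      proof (rule field_le_epsilon)
        fix \<epsilon> :: real assume \<epsilon>: "0 < \<epsilon>"
        have "\<exists>c\<in>C. D w c < f w + \<epsilon>" for w
          using ge[of "f w + \<epsilon>" w] \<epsilon> by (smt (verit))
        then obtain c c' where c: "c \<in> C" "D y c < f y + \<epsilon>" and c': "c' \<in> C" "D z c' < f z + \<epsilon>" by metis
        have "f (mix t y z) \<le> D (mix t y z) (mix t c c')"
          using low mix_closedD[OF C(3) c(1) c'(1)] t by simp
        also note D_mix
        also have "t * D y c + (1 - t) * D z c' \<le> t * (f y + \<epsilon>) + (1 - t) * (f z + \<epsilon>)"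
          using t c c' by (intro add_mono mult_left_mono) auto
        also have "\<dots> = t * f y + (1 - t) * f z + \<epsilon>" by (simp add: algebra_simps)
        finally show "f (mix t y z) \<le> t * f y + (1 - t) * f z + \<epsilon>" .
      qed
    qed
    moreover have f0: "0 \<le> f y" for y using D0 by (intro ge)
    moreover have "f y = 0" if "y \<in> K" "y \<notin> V" for y
      using low[OF VC[OF that], of y] f0[of y] by (simp add: D_def)
    moreover have "d \<le> f x"
    proof (rule ge)
      fix c assume "c \<in> C"
      then obtain j where j: "j \<in> I" "d \<le> \<bar>c j - x j\<bar>" using I(3)[of c] not_less by blast
      then have "d \<le> \<bar>x j - c j\<bar>" by (simp add: abs_minus_commute)
      also have "\<dots> \<le> D x c" unfolding D_def using I(1) j(1) by (intro member_le_sum) auto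
      finally show "d \<le> D x c" .
    qed
    ultimately show ?thesis using I(2) by (intro that[of f]) auto
  qed
qed

text \<open>All maximisers over \<open>K\<close> then lie in \<open>V\<close>. The witness need not
  be a maximiser: later perturbations only raise the value there and change nothing outside later
  sets inside \<open>V\<close>.\<close>

definition peaks_in :: "(('i \<Rightarrow> real) \<Rightarrow> real) \<Rightarrow> ('i \<Rightarrow> real) set \<Rightarrow> bool" where
  "peaks_in f V \<longleftrightarrow> continuous_on K f \<and> cvx f \<and> open V \<and> (\<exists>e\<in>K. \<forall>y\<in>K - V. f y < f e)"

text \<open>Some extreme maximiser lies in \<open>V\<close>. As \<open>N\<close> is nowhere dense,
  an extreme point \<open>x\<close> near it avoids the closure of \<open>N\<close>, and a bump near
  \<open>x\<close> moves all maximisers into a set \<open>W\<close> disjoint from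
  \<open>N\<close>.\<close>

lemma peak_step:
  assumes f: "peaks_in f V" and \<eta>: "0 < \<eta>"
    and N: "top_of_set extreme interior_of (top_of_set extreme closure_of N) = {}" "N \<subseteq> extreme"
  obtains g W where "peaks_in g W" "K \<inter> W \<subseteq> V" "W \<inter> N = {}"
    "\<And>y. y \<in> K \<Longrightarrow> f y \<le> g y \<and> g y \<le> f y + \<eta>" "\<And>y. y \<in> K \<Longrightarrow> y \<notin> W \<Longrightarrow> g y = f y"
proof -
  have fc: "continuous_on K f" "cvx f" "open V" using f by (auto simp: peaks_in_def)
  obtain e' where e': "e' \<in> K" "\<And>y. y \<in> K \<Longrightarrow> y \<notin> V \<Longrightarrow> f y < f e'" using f by (auto simp: peaks_in_def)
  then obtain e where e: "e \<in> extreme" "\<And>y. y \<in> K \<Longrightarrow> f y \<le> f e"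
    using bauer_maximum_principle[OF _ fc(1,2)] by blast
  have eK: "e \<in> K" using e(1) by (simp add: extreme_def)
  have "e \<in> V" using e' e(2)[OF e'(1)] eK by force
  \<comment> \<open>Inside \<open>T\<close> at most \<open>\<eta> / 2\<close> of the maximum is
    lost, less than the height \<open>\<eta>\<close> of the bump to be added.\<close>
  obtain T where T: "open T" "T \<inter> K = f -` {f e - \<eta> / 2<..} \<inter> K"
    using continuous_on_open_invariant[THEN iffD1, OF fc(1), rule_format, of "{f e - \<eta> / 2<..}"] by auto
  have Tf: "f e - \<eta> / 2 < f y" if "y \<in> T" "y \<in> K" for y using T(2) that by auto
  have "e \<in> T" using T(2) eK \<eta> by auto
  let ?X = "top_of_set extreme"
  have "\<not> extreme \<inter> (T \<inter> V) \<subseteq> ?X closure_of N"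
  proof
    assume "extreme \<inter> (T \<inter> V) \<subseteq> ?X closure_of N"
    moreover have "openin ?X (extreme \<inter> (T \<inter> V))" using T(1) fc(3) by (simp add: openin_open_Int open_Int)
    ultimately have "extreme \<inter> (T \<inter> V) \<subseteq> ?X interior_of (?X closure_of N)" by (rule interior_of_maximal)
    then show False using N(1) e(1) \<open>e \<in> T\<close> \<open>e \<in> V\<close> by blast
  qed
  then obtain x where x: "x \<in> extreme" "x \<in> T" "x \<in> V" "x \<notin> ?X closure_of N" by blast
  have "openin ?X (extreme - ?X closure_of N)"
    using openin_diff[OF openin_topspace closedin_closure_of, of ?X N] by simp
  then obtain U where U: "open U" "extreme - ?X closure_of N = extreme \<inter> U" by (auto simp: openin_open)
  have UN: "U \<inter> N = {}"
    using U(2) N(2) closure_of_subset[of N ?X] by auto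
  define W where "W = T \<inter> V \<inter> U"
  have W: "open W" "x \<in> W" using T(1) fc(3) U x by (auto simp: W_def open_Int)
  obtain b where b: "continuous_on K b" "cvx b" "\<And>y. y \<in> K \<Longrightarrow> 0 \<le> b y"
      "\<And>y. y \<in> K \<Longrightarrow> y \<notin> W \<Longrightarrow> b y = 0" "0 < b x"
    using extreme_bump[OF x(1) W] by blast
  have xK: "x \<in> K" using x(1) by (simp add: extreme_def)
  \<comment> \<open>The bump is scaled by its maximum over \<open>K\<close> rather than by its value
    at \<open>x\<close>, so that the perturbation never exceeds \<open>\<eta>\<close> while some
    point of \<open>W\<close> gains all of it.\<close>
  obtain p where p: "p \<in> K" "\<And>y. y \<in> K \<Longrightarrow> b y \<le> b p"
    using continuous_attains_sup[OF compact _ b(1)] xK by blast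
  have bp: "0 < b p" using b(5) p(2)[OF xK] by simp
  then have "p \<in> W" using b(4)[OF p(1)] by fastforce
  define k where "k = \<eta> / b p"
  have k: "0 < k" "k * b p = \<eta>" using \<eta> bp by (simp_all add: k_def)
  define g where "g y = f y + k * b y" for y
  have "continuous_on K g" unfolding g_def by (intro continuous_intros fc b(1))
  moreover have "cvx g"
    unfolding cvx_def
  proof (intro ballI allI impI)
    fix y z and t :: real assume yz: "y \<in> K" "z \<in> K" "0 \<le> t \<and> t \<le> 1"
    have "k * b (mix t y z) \<le> k * (t * b y + (1 - t) * b z)"
      using b(2) yz k(1) unfolding cvx_def by (intro mult_left_mono) auto
    moreover have "f (mix t y z) \<le> t * f y + (1 - t) * f z" using fc(2) yz unfolding cvx_def by blast
    ultimately show "g (mix t y z) \<le> t * g y + (1 - t) * g z"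
      unfolding g_def by (simp add: algebra_simps)
  qed
  moreover have gW: "g y = f y" if "y \<in> K" "y \<notin> W" for y using b(4)[OF that] by (simp add: g_def)
  moreover have "g y < g p" if "y \<in> K - W" for y
  proof -
    have "g y \<le> f e" using gW e(2) that by simp
    moreover have "f e - \<eta> / 2 < f p" using Tf p(1) \<open>p \<in> W\<close> by (simp add: W_def)
    moreover have "g p = f p + \<eta>" using k(2) by (simp add: g_def)
    ultimately show ?thesis using \<eta> by simp
  qed
  ultimately have "peaks_in g W" using W(1) p(1) by (auto simp: peaks_in_def)
  moreover have "f y \<le> g y \<and> g y \<le> f y + \<eta>" if "y \<in> K" for y
  proof -
    have "0 \<le> k * b y" using k(1) b(3)[OF that] by simp
    moreover have "k * b y \<le> k * b p" using k(1) p(2)[OF that] by (intro mult_left_mono) auto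
    ultimately show ?thesis using k(2) by (simp add: g_def)
  qed
  ultimately show ?thesis using that[of g W] gW UN by (auto simp: W_def)
qed

text \<open>Choquet's theorem that the extreme boundary is a Baire space, combined with the maximum
  principle: perturb \<open>f\<close> by a rapidly converging series of bumps that push the set of maximisers
  off one nowhere dense set after another.\<close>

theorem extreme_avoiding_meager:
  assumes f: "continuous_on K f" "cvx f" and y: "y \<in> K" "c < f y"
    and N: "\<And>n :: nat. top_of_set extreme interior_of (top_of_set extreme closure_of N n) = {}" "\<And>n. N n \<subseteq> extreme"
  obtains x where "x \<in> extreme" "c < f x" "\<And>n. x \<notin> N n"
proof -
  \<comment> \<open>The point found will maximise a perturbed function, not \<open>f\<close>;
    confining it to \<open>V0\<close> is what yields \<open>c < f x\<close>.\<close>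
  obtain V0 where V0: "open V0" "V0 \<inter> K = f -` {c<..} \<inter> K"
    using continuous_on_open_invariant[THEN iffD1, OF f(1), rule_format, of "{c<..}"] by auto
  have V0f: "z \<in> V0 \<longleftrightarrow> c < f z" if "z \<in> K" for z using V0(2) that by auto
  have pk0: "peaks_in f V0"
    unfolding peaks_in_def using f V0(1) V0f y by (auto intro!: bexI[of _ y])
  have "\<exists>P. \<forall>n. (peaks_in (fst (P n)) (snd (P n)) \<and> K \<inter> snd (P n) \<subseteq> V0)
      \<and> (K \<inter> snd (P (Suc n)) \<subseteq> snd (P n) \<and> snd (P (Suc n)) \<inter> N n = {}
        \<and> (\<forall>y\<in>K. fst (P n) y \<le> fst (P (Suc n)) y \<and> fst (P (Suc n)) y \<le> fst (P n) y + (1/2) ^ n)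
        \<and> (\<forall>y\<in>K - snd (P (Suc n)). fst (P (Suc n)) y = fst (P n) y))"
  proof (rule dependent_nat_choice)
    show "\<exists>p. peaks_in (fst p) (snd p) \<and> K \<inter> snd p \<subseteq> V0"
      using pk0 by (intro exI[of _ "(f, V0)"]) auto
  next
    fix p n assume p: "peaks_in (fst p) (snd p) \<and> K \<inter> snd p \<subseteq> V0"
    obtain g W where "peaks_in g W" "K \<inter> W \<subseteq> snd p" "W \<inter> N n = {}"
      "\<And>y. y \<in> K \<Longrightarrow> fst p y \<le> g y \<and> g y \<le> fst p y + (1/2) ^ n" "\<And>y. y \<in> K \<Longrightarrow> y \<notin> W \<Longrightarrow> g y = fst p y"
      using peak_step[OF p[THEN conjunct1] _ N, of "(1/2) ^ n" n] by auto
    then show "\<exists>q. (peaks_in (fst q) (snd q) \<and> K \<inter> snd q \<subseteq> V0)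
      \<and> (K \<inter> snd q \<subseteq> snd p \<and> snd q \<inter> N n = {}
        \<and> (\<forall>y\<in>K. fst p y \<le> fst q y \<and> fst q y \<le> fst p y + (1/2) ^ n)
        \<and> (\<forall>y\<in>K - snd q. fst q y = fst p y))"
      using p by (intro exI[of _ "(g, W)"]) auto
  qed
  then obtain P where P: "\<forall>n. (peaks_in (fst (P n)) (snd (P n)) \<and> K \<inter> snd (P n) \<subseteq> V0)
      \<and> (K \<inter> snd (P (Suc n)) \<subseteq> snd (P n) \<and> snd (P (Suc n)) \<inter> N n = {}
        \<and> (\<forall>y\<in>K. fst (P n) y \<le> fst (P (Suc n)) y \<and> fst (P (Suc n)) y \<le> fst (P n) y + (1/2) ^ n)
        \<and> (\<forall>y\<in>K - snd (P (Suc n)). fst (P (Suc n)) y = fst (P n) y))" ..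
  define F where "F n = fst (P n)" for n
  define V where "V n = snd (P n)" for n
  have pk: "peaks_in (F n) (V n)" and V0V: "K \<inter> V n \<subseteq> V0" and nest: "K \<inter> V (Suc n) \<subseteq> V n"
    and VN: "V (Suc n) \<inter> N n = {}"
    and F: "\<And>y. y \<in> K \<Longrightarrow> F n y \<le> F (Suc n) y" "\<And>y. y \<in> K \<Longrightarrow> F (Suc n) y \<le> F n y + (1/2) ^ n"
      "\<And>y. y \<in> K \<Longrightarrow> y \<notin> V (Suc n) \<Longrightarrow> F (Suc n) y = F n y" for n
    using P by (auto simp: F_def V_def)
  \<comment> \<open>The limit is written as a telescoping series so that the geometric bounds on the
    increments give uniform convergence.\<close>
  define G where "G y = F 0 y + suminf (\<lambda>n. F (Suc n) y - F n y)" for y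
  have "uniform_limit K (\<lambda>n y. \<Sum>i<n. F (Suc i) y - F i y) (\<lambda>y. suminf (\<lambda>i. F (Suc i) y - F i y)) sequentially"
    using F(1,2) by (intro Weierstrass_m_test[where M = "\<lambda>n. (1/2) ^ n"]) (auto simp: abs_le_iff algebra_simps)
  moreover have "(\<Sum>i<n. F (Suc i) y - F i y) = F n y - F 0 y" for n y
    using sum_lessThan_telescope[of "\<lambda>i. F i y" n] .
  ultimately have ul: "uniform_limit K (\<lambda>n y. F n y - F 0 y) (\<lambda>y. suminf (\<lambda>i. F (Suc i) y - F i y)) sequentially"
    by simp
  have lim: "(\<lambda>n. F n y) \<longlonglongrightarrow> G y" if "y \<in> K" for y
    using tendsto_add[OF tendsto_const[of "F 0 y"] tendsto_uniform_limitI[OF ul that]] by (simp add: G_def)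
  have Fc: "continuous_on K (F n)" "cvx (F n)" for n using pk by (auto simp: peaks_in_def)
  have "continuous_on K (\<lambda>y. suminf (\<lambda>i. F (Suc i) y - F i y))"
    by (rule uniform_limit_theorem[OF _ ul]) (auto intro!: always_eventually continuous_intros Fc)
  then have "continuous_on K G" unfolding G_def by (intro continuous_intros Fc)
  moreover have "cvx G"
    unfolding cvx_def
  proof (intro ballI allI impI)
    fix y z and t :: real assume yz: "y \<in> K" "z \<in> K" "0 \<le> t \<and> t \<le> 1"
    show "G (mix t y z) \<le> t * G y + (1 - t) * G z"
    proof (rule LIMSEQ_le)
      show "(\<lambda>n. F n (mix t y z)) \<longlonglongrightarrow> G (mix t y z)" using yz convex by (intro lim) (simp add: mix_closedD)
      show "(\<lambda>n. t * F n y + (1 - t) * F n z) \<longlonglongrightarrow> t * G y + (1 - t) * G z"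
        using yz by (intro tendsto_intros lim)
      show "\<exists>N. \<forall>n\<ge>N. F n (mix t y z) \<le> t * F n y + (1 - t) * F n z"
        using Fc(2) yz by (simp add: cvx_def)
    qed
  qed
  ultimately obtain x where x: "x \<in> extreme" "\<And>y. y \<in> K \<Longrightarrow> G y \<le> G x"
    using bauer_maximum_principle[of G] y(1) by blast
  have xK: "x \<in> K" using x(1) by (simp add: extreme_def)
  \<comment> \<open>Outside \<open>V n\<close> the values no longer change after stage
    \<open>n\<close>, whereas at the witness of the peak they can only grow, so a maximiser of
    \<open>G\<close> cannot lie there.\<close>
  have xV: "x \<in> V n" for n
  proof (rule ccontr)
    assume "x \<notin> V n"
    then have out: "x \<notin> V (n + k)" for k by (induction k) (use nest xK in auto)
    have "F (n + k) x = F n x" for k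
      by (induction k) (use F(3)[OF xK] out[of "Suc _"] in auto)
    moreover have "(\<lambda>k. F (k + n) x) \<longlonglongrightarrow> G x" using lim[OF xK] by (rule LIMSEQ_ignore_initial_segment)
    ultimately have "G x = F n x" by (simp add: add.commute LIMSEQ_const_iff)
    moreover obtain e where e: "e \<in> K" "F n x < F n e" using pk[of n] xK \<open>x \<notin> V n\<close> by (auto simp: peaks_in_def)
    moreover have "incseq (\<lambda>n. F n e)" using F(1)[OF e(1)] by (rule incseq_SucI)
    then have "F n e \<le> G e" using lim[OF e(1)] by (rule incseq_le)
    ultimately show False using x(2)[OF e(1)] by simp
  qed
  have "x \<in> V0" using V0V xV[of 0] xK by blast
  then have "c < f x" using V0f xK by simp
  moreover have "x \<notin> N n" for n using VN[of n] xV[of "Suc n"] by blast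
  ultimately show ?thesis using x(1) that by blast
qed

end

section \<open>The universal group of an effect algebra with Riesz decomposition\<close>

context effect_algebra
begin

section \<open>Arithmetic of the partial addition\<close>

definition esum :: "'a \<Rightarrow> 'a \<Rightarrow> 'a \<Rightarrow> bool" where
  "esum a b c \<longleftrightarrow> a \<in> ecarrier M \<and> b \<in> ecarrier M \<and> eplus M a b = Some c"

lemma esum_closed:
  assumes "esum a b c"
  shows "a \<in> ecarrier M" "b \<in> ecarrier M" "c \<in> ecarrier M"
  using assms plus_closed by (auto simp: esum_def)

lemma esum_commute: "esum a b c \<Longrightarrow> esum b a c"
  using plus_commute by (auto simp: esum_def)

lemma esum_unique: "esum a b c \<Longrightarrow> esum a b d \<Longrightarrow> c = d"
  by (auto simp: esum_def)

lemma esum_assoc: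
  assumes "esum a b d" "esum d c e"
  obtains f where "esum b c f" "esum a f e"
proof -
  have C: "a \<in> ecarrier M" "b \<in> ecarrier M" "c \<in> ecarrier M"
    and e: "eplus M a b = Some d" "eplus M d c = Some e"
    using assms by (auto simp: esum_def)
  from plus_assoc[OF C] e have "Option.bind (eplus M b c) (eplus M a) = Some e" by simp
  then obtain f where f: "eplus M b c = Some f" "eplus M a f = Some e"
    by (auto simp: bind_eq_Some_conv)
  moreover have "f \<in> ecarrier M" using plus_closed[OF C(2,3) f(1)] .
  ultimately show ?thesis using C by (intro that[of f]) (simp_all add: esum_def)
qed

lemma esum_assoc':
  assumes "esum b c f" "esum a f e"
  obtains d where "esum a b d" "esum d c e"
  using assms esum_assoc[of c b f a e] esum_commute by metis

lemma esum_compl: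
  assumes "a \<in> ecarrier M"
  obtains b where "esum a b (eone M)"
  using ex1_compl[OF assms] assms by (auto simp: esum_def)

lemma esum_compl_unique: "esum a b (eone M) \<Longrightarrow> esum a c (eone M) \<Longrightarrow> b = c"
  using ex1_compl[of a] unfolding esum_def by blast

text \<open>Add the complement \<open>d\<close> of \<open>c\<close>: both \<open>b\<close> and
  \<open>b'\<close> become the complement of the sum of \<open>a\<close> and
  \<open>d\<close>.\<close>

lemma esum_cancel:
  assumes "esum a b c" "esum a b' c"
  shows "b = b'"
proof -
  obtain d where d: "esum c d (eone M)" using esum_closed(3)[OF assms(1)] by (rule esum_compl)
  obtain f where f: "esum a d f" "esum b f (eone M)"
    using esum_assoc[OF esum_commute[OF assms(1)] d] by blast
  obtain f' where f': "esum a d f'" "esum b' f' (eone M)"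
    using esum_assoc[OF esum_commute[OF assms(2)] d] by blast
  show ?thesis
    using f f' esum_unique esum_commute esum_compl_unique by metis
qed

text \<open>The complement of the unit can only be zero. Adding it to \<open>b + a = 1\<close> and
  cancelling \<open>b\<close> gives the claim for \<open>a\<close>.\<close>

lemma esum_zero: "a \<in> ecarrier M \<Longrightarrow> esum a (ezero M) a"
proof -
  assume a: "a \<in> ecarrier M"
  obtain z where z: "esum (eone M) z (eone M)" using one_closed by (rule esum_compl)
  have "z = ezero M"
    using plus_one[of z] esum_commute[OF z] by (auto simp: esum_def)
  with z have z: "esum (eone M) (ezero M) (eone M)" by simp
  obtain b where b: "esum b a (eone M)" using esum_compl[OF a] esum_commute by metis
  obtain f where f: "esum a (ezero M) f" "esum b f (eone M)" using esum_assoc[OF b z] .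
  then show ?thesis using esum_cancel[OF f(2) b] by simp
qed

lemma esum_zero_left: "a \<in> ecarrier M \<Longrightarrow> esum (ezero M) a a"
  by (rule esum_commute[OF esum_zero])

lemma esum_eq_zero:
  assumes "esum a b (ezero M)"
  shows "a = ezero M"
proof -
  obtain f where "esum b (eone M) f"
    using esum_assoc[OF assms esum_zero_left[OF one_closed]] by blast
  then have "b = ezero M" using plus_one[of b] by (auto simp: esum_def)
  with assms have "esum a (ezero M) (ezero M)" by simp
  from esum_unique[OF esum_zero[OF esum_closed(1)[OF assms]] this] show ?thesis .
qed

lemma ele_iff: "ele M a b \<longleftrightarrow> (\<exists>c. esum a c b)"
  using plus_closed by (auto simp: ele_def esum_def)

section \<open>Sums of multisets and their refinements\<close>

inductive msum :: "'a multiset \<Rightarrow> 'a \<Rightarrow> bool" where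
  empty: "msum {#} (ezero M)"
| add: "msum A b \<Longrightarrow> esum a b c \<Longrightarrow> msum (add_mset a A) c"

lemma msum_closed: "msum A a \<Longrightarrow> set_mset A \<subseteq> ecarrier M \<and> a \<in> ecarrier M"
  by (induction rule: msum.induct) (auto simp: zero_closed dest: esum_closed)

lemma msum_single: "a \<in> ecarrier M \<Longrightarrow> msum {#a#} a"
  using msum.add[OF msum.empty esum_zero] .

text \<open>The sum is built by adding members in some order; associativity and commutativity
  exchange neighbours, so any chosen member can be the last one.\<close>

lemma msum_add_msetD:
  assumes "msum (add_mset a A) c"
  obtains b where "msum A b" "esum a b c"
proof -
  have "\<exists>b. msum A b \<and> esum a b c" if "msum X c" "X = add_mset a A" for X
    using that
  proof (induction arbitrary: A rule: msum.induct)
    case (add A' b' a' c')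
    show ?case
    proof (cases "a' = a")
      case True
      then show ?thesis using add by auto
    next
      case False
      then obtain B where B: "A' = add_mset a B" "A = add_mset a' B"
        using add.prems by (auto simp: add_eq_conv_ex)
      obtain e where e: "msum B e" "esum a e b'" using add.IH[OF B(1)] by blast
      obtain d where "esum a' a d" "esum d e c'" using esum_assoc'[OF e(2) add.hyps(2)] .
      then obtain f where "esum a' e f" "esum a f c'"
        using esum_assoc esum_commute by metis
      then show ?thesis using msum.add[OF e(1)] B(2) by blast
    qed
  qed simp
  with assms that show ?thesis by blast
qed

lemma msum_unique: "msum A a \<Longrightarrow> msum A b \<Longrightarrow> a = b"
proof (induction A arbitrary: a b)
  case empty
  have "c = ezero M" if "msum {#} c" for c using that by cases auto
  with empty show ?case by metis
next
  case (add x A)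
  then show ?case using msum_add_msetD esum_unique by metis
qed

lemma msum_plusD:
  assumes "msum (A + B) c"
  obtains a b where "msum A a" "msum B b" "esum a b c"
  using assms
proof (induction A arbitrary: c thesis)
  case empty
  then show ?case using msum.empty esum_zero_left msum_closed by auto
next
  case (add x A)
  obtain d where d: "msum (A + B) d" "esum x d c" using add.prems(2) by (auto elim: msum_add_msetD)
  obtain a b where ab: "msum A a" "msum B b" "esum a b d" using add.IH[OF _ d(1)] by blast
  then show ?case using add.prems(1) esum_assoc'[OF ab(3) d(2)] msum.add by metis
qed

lemma msum_plus: "msum A a \<Longrightarrow> msum B b \<Longrightarrow> esum a b c \<Longrightarrow> msum (A + B) c"
proof (induction arbitrary: c rule: msum.induct)
  case empty
  then show ?case using esum_unique[OF esum_zero_left] esum_closed(2) by auto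
next
  case (add A b' a c')
  then show ?case using esum_assoc msum.add by (metis union_mset_add_mset_left)
qed

text \<open>The base case admits zeros: a member equal to \<open>0\<close> may split into zeros or into nothing, and
  common refinements exist only if the two are not distinguished.\<close>

inductive refines :: "'a multiset \<Rightarrow> 'a multiset \<Rightarrow> bool" where
  empty: "set_mset Z \<subseteq> {ezero M} \<Longrightarrow> refines {#} Z"
| add: "refines X Z \<Longrightarrow> msum A a \<Longrightarrow> refines (add_mset a X) (A + Z)"

lemma refines_refl: "set_mset X \<subseteq> ecarrier M \<Longrightarrow> refines X X"
proof (induction X)
  case (add x X)
  then show ?case using refines.add[OF _ msum_single, of X X x] by simp
qed (simp add: refines.empty)

lemma refines_single: "msum A a \<Longrightarrow> refines {#a#} A"
  using refines.add[OF refines.empty[of "{#}"], of A a] by simp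

lemma refines_add_zeros:
  assumes "refines X Z" "set_mset Y \<subseteq> {ezero M}"
  shows "refines X (Y + Z)"
  using assms(1)
proof (induction rule: refines.induct)
  case (empty Z)
  then show ?case using assms(2) by (intro refines.empty) auto
next
  case (add X Z A a)
  from refines.add[OF add.IH add.hyps(2)] show ?case by (simp add: ac_simps)
qed

lemma msum_zeroD: "msum A c \<Longrightarrow> c = ezero M \<Longrightarrow> set_mset A \<subseteq> {ezero M}"
proof (induction rule: msum.induct)
  case (add A b a c)
  then have "a = ezero M" "b = ezero M" using esum_eq_zero esum_commute by blast+
  with add show ?case by simp
qed simp

lemma msum_zeros: "set_mset A \<subseteq> {ezero M} \<Longrightarrow> msum A (ezero M)"
proof (induction A)
  case (add x A)
  then show ?case using msum.add[OF _ esum_zero[OF zero_closed]] by auto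
qed (rule msum.empty)

lemma refines_zeros: "refines X Z \<Longrightarrow> set_mset X \<subseteq> {ezero M} \<Longrightarrow> set_mset Z \<subseteq> {ezero M}"
  by (induction rule: refines.induct) (auto dest: msum_zeroD)

lemma refines_plus: "refines X Z \<Longrightarrow> refines X' Z' \<Longrightarrow> refines (X + X') (Z + Z')"
proof (induction rule: refines.induct)
  case (empty Z)
  then show ?case using refines_add_zeros by simp
next
  case (add X Z A a)
  then show ?case using refines.add[of "X + X'" "Z + Z'" A a] by (simp add: add.assoc)
qed

lemma refines_closed: "refines X Z \<Longrightarrow> set_mset X \<subseteq> ecarrier M \<and> set_mset Z \<subseteq> ecarrier M"
proof (induction rule: refines.induct)
  case (add X Z A a)
  then show ?case using msum_closed[OF add.hyps(2)] by auto
qed (use zero_closed in auto)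

lemma refines_add_msetD:
  assumes "refines (add_mset x X) Z"
  obtains A Z' where "Z = A + Z'" "msum A x" "refines X Z'"
proof -
  have "\<exists>A Z'. Z = A + Z' \<and> msum A x \<and> refines X Z'" if "refines Y Z" "Y = add_mset x X" for Y
    using that
  proof (induction arbitrary: X rule: refines.induct)
    case (add X' Z' A a)
    show ?case
    proof (cases "a = x")
      case True
      then show ?thesis using add by auto
    next
      case False
      then obtain B where B: "X' = add_mset x B" "X = add_mset a B"
        using add.prems by (auto simp: add_eq_conv_ex)
      obtain D W where "Z' = D + W" "msum D x" "refines B W" using add.IH[OF B(1)] by blast
      then have "A + Z' = D + (A + W) \<and> msum D x \<and> refines X (A + W)"
        using refines.add[OF \<open>refines B W\<close> add.hyps(2)] B(2) by (simp add: ac_simps)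
      then show ?thesis by blast
    qed
  qed simp
  with assms that show ?thesis by blast
qed

lemma refines_plusD:
  assumes "refines (X + Y) Z"
  obtains A B where "Z = A + B" "refines X A" "refines Y B"
  using assms
proof (induction X arbitrary: Z thesis)
  case empty
  then show ?case using empty(1)[of "{#}" Z] refines.empty[of "{#}"] by simp
next
  case (add x X)
  from add.prems(2) have "refines (add_mset x (X + Y)) Z" by simp
  then obtain A Z' where A: "Z = A + Z'" "msum A x" "refines (X + Y) Z'"
    by (rule refines_add_msetD)
  obtain B D where B: "Z' = B + D" "refines X B" "refines Y D" using add.IH[OF _ A(3)] by blast
  show ?case
    using add.prems(1)[of "A + B" D] refines.add[OF B(2) A(2)] A(1) B(1,3) by (simp add: add.assoc)
qed

lemma refines_msum: "refines X Z \<Longrightarrow> msum X c \<Longrightarrow> msum Z c"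
proof (induction arbitrary: c rule: refines.induct)
  case (empty Z)
  then show ?case using msum_zeros msum_unique[OF msum.empty] by blast
next
  case (add X Z A a)
  obtain b where "msum X b" "esum a b c" using msum_add_msetD[OF add.prems] .
  then show ?case using msum_plus[OF add.hyps(2) add.IH] by blast
qed

lemma refines_msum_rev: "refines X Z \<Longrightarrow> msum Z c \<Longrightarrow> msum X c"
proof (induction arbitrary: c rule: refines.induct)
  case (add X Z A a)
  obtain b d where "msum A b" "msum Z d" "esum b d c" using msum_plusD[OF add.prems] .
  then show ?case using msum.add[OF add.IH] msum_unique[OF add.hyps(2)] by blast
next
  case (empty Z)
  then show ?case using msum.empty msum_unique[OF msum_zeros] by blast
qed

lemma refines_trans: "refines X Y \<Longrightarrow> refines Y Z \<Longrightarrow> refines X Z"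
proof (induction arbitrary: Z rule: refines.induct)
  case (add X Y A a)
  obtain B D where "Z = B + D" "refines A B" "refines Y D" using refines_plusD[OF add.prems] .
  then show ?case using refines.add[OF add.IH] refines_msum[OF _ add.hyps(2)] by blast
next
  case (empty Y)
  from refines_zeros[OF empty(2,1)] show ?case by (rule refines.empty)
qed

definition equi :: "'a multiset \<Rightarrow> 'a multiset \<Rightarrow> bool" where
  "equi X Y \<longleftrightarrow> (\<exists>Z. refines X Z \<and> refines Y Z)"

lemma equi_sym: "equi X Y \<Longrightarrow> equi Y X"
  by (auto simp: equi_def)

lemma equi_refl: "set_mset X \<subseteq> ecarrier M \<Longrightarrow> equi X X"
  using refines_refl by (auto simp: equi_def)

lemma equi_refines: "refines X Y \<Longrightarrow> equi X Y"
  using refines_refl refines_closed by (auto simp: equi_def)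

lemma equi_plus: "equi X Y \<Longrightarrow> equi X' Y' \<Longrightarrow> equi (X + X') (Y + Y')"
  unfolding equi_def using refines_plus by blast

lemma equi_closed: "equi X Y \<Longrightarrow> set_mset X \<subseteq> ecarrier M \<and> set_mset Y \<subseteq> ecarrier M"
  using refines_closed by (auto simp: equi_def)

lemma equi_msum: "equi X Y \<Longrightarrow> msum X c \<Longrightarrow> msum Y c"
  unfolding equi_def using refines_msum refines_msum_rev by blast

text \<open>This identifies \<open>M\<close> inside the monoid of formal sums: refinement both
  preserves and reflects sums in \<open>M\<close>, so formal sums equivalent to \<open>c\<close> are
  those that already add up to \<open>c\<close>.\<close>

lemma equi_single_iff: "equi X {#c#} \<longleftrightarrow> msum X c"
proof
  assume *: "equi X {#c#}"
  then have "msum {#c#} c" using equi_closed[OF *] msum_single[of c] by simp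
  from equi_msum[OF equi_sym[OF *] this] show "msum X c" .
next
  assume "msum X c"
  then show "equi X {#c#}" using refines_single equi_refines equi_sym by blast
qed

end

section \<open>The cancellative refinement monoid\<close>

locale rdp_effect_algebra = effect_algebra M for M :: "'a effect_alg" +
  assumes rdp: "RDP M"
begin

lemma esum_refine:
  assumes "esum a1 a2 e" "esum b1 b2 e"
  obtains c11 c12 c21 c22 where "esum c11 c12 a1" "esum c21 c22 a2" "esum c11 c21 b1" "esum c12 c22 b2"
  using rdp assms unfolding RDP_def esum_def by (metis option.distinct(1))

text \<open>Riesz decomposition applied to one member of \<open>B\<close> at a time cuts it into a
  piece for \<open>a\<close> and a piece for \<open>r\<close>.\<close>

lemma msum_split:
  assumes "msum B e" "esum a r e"
  obtains V B' where "refines B (V + B')" "msum V a" "msum B' r"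
  using assms
proof (induction arbitrary: a r thesis rule: msum.induct)
  case empty
  have "a = ezero M" "r = ezero M"
    using esum_eq_zero esum_commute empty.prems(2) by blast+
  then show ?case using empty.prems(1)[of "{#}" "{#}"] refines.empty[of "{#}"] msum.empty by simp
next
  case (add B t b e)
  obtain c11 c12 c21 c22 where c: "esum c11 c12 a" "esum c21 c22 r" "esum c11 c21 b" "esum c12 c22 t"
    using esum_refine[OF add.prems(2) add.hyps(2)] .
  obtain V B' where V: "refines B (V + B')" "msum V c12" "msum B' c22" using add.IH[OF _ c(4)] by blast
  have "msum ({#c11#} + {#c21#}) b"
    using msum_plus[OF msum_single msum_single c(3)] esum_closed c(3) by blast
  from refines.add[OF V(1) this]
  have "refines (add_mset b B) (add_mset c11 V + add_mset c21 B')" by simp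
  from add.prems(1)[OF this msum.add[OF V(2) c(1)] msum.add[OF V(3) c(2)]] show ?case .
qed

text \<open>For each member \<open>a\<close> of \<open>A\<close>, cut from a refinement of
  \<open>B\<close> a part with sum \<open>a\<close>; what remains matches the rest of
  \<open>A\<close> by induction.\<close>

lemma msum_common_refinement:
  assumes "msum A e" "msum B e"
  shows "\<exists>V. refines A V \<and> refines B V"
  using assms
proof (induction arbitrary: B rule: msum.induct)
  case empty
  have "refines {#} B" by (rule refines.empty[OF msum_zeroD[OF empty refl]])
  moreover have "refines B B" using msum_closed[OF empty] by (simp add: refines_refl)
  ultimately show ?case by blast
next
  case (add A r a e)
  obtain V B' where V: "refines B (V + B')" "msum V a" "msum B' r"
    using msum_split[OF add.prems add.hyps(2)] .
  obtain V' where V': "refines A V'" "refines B' V'" using add.IH[OF V(3)] by blast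
  have "refines (V + B') (V + V')"
    using refines_plus[OF refines_refl V'(2)] msum_closed[OF V(2)] by blast
  from refines_trans[OF V(1) this] have "refines B (V + V')" .
  then show ?case using refines.add[OF V'(1) V(2)] by blast
qed

text \<open>Any two refinements of the same member have the same sum in \<open>M\<close>, hence a
  common refinement. Transitivity of \<open>equi\<close> rests on this.\<close>

lemma refines_confluent:
  assumes "refines Y Z" "refines Y Z'"
  shows "\<exists>V. refines Z V \<and> refines Z' V"
  using assms
proof (induction arbitrary: Z' rule: refines.induct)
  case (empty Z)
  then have zeros: "set_mset Z' \<subseteq> {ezero M}" using refines_zeros by force
  have "set_mset (Z + Z') \<subseteq> ecarrier M" using empty zeros zero_closed by auto
  then have "refines Z Z" "refines Z' Z'" by (simp_all add: refines_refl)
  from refines_add_zeros[OF this(1) zeros] refines_add_zeros[OF this(2) empty(1)]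
  show ?case by (auto simp: add.commute)
next
  case (add X Z A a)
  obtain A' W where W: "Z' = A' + W" "msum A' a" "refines X W"
    using refines_add_msetD[OF add.prems] .
  obtain V where "refines Z V" "refines W V" using add.IH[OF W(3)] by blast
  moreover obtain V' where "refines A V'" "refines A' V'"
    using msum_common_refinement[OF add.hyps(2) W(2)] by blast
  ultimately show ?case using refines_plus W(1) by blast
qed

lemma equi_trans:
  assumes "equi X Y" "equi Y Z"
  shows "equi X Z"
proof -
  obtain V W where V: "refines X V" "refines Y V" and W: "refines Y W" "refines Z W"
    using assms unfolding equi_def by blast
  obtain U where "refines V U" "refines W U" using refines_confluent[OF V(2) W(1)] by blast
  then show ?thesis unfolding equi_def using refines_trans V(1) W(2) by blast
qed

lemma equi_refine:
  assumes "equi (X1 + X2) (Y1 + Y2)"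
  obtains V11 V12 V21 V22 where "refines X1 (V11 + V12)" "refines X2 (V21 + V22)"
    "refines Y1 (V11 + V21)" "refines Y2 (V12 + V22)"
proof -
  obtain V where "refines (X1 + X2) V" "refines (Y1 + Y2) V" using assms unfolding equi_def by blast
  then obtain A1 A2 B1 B2 where A: "refines X1 A1" "refines X2 A2" and B: "refines Y1 B1" "refines Y2 B2"
    and eq: "A1 + A2 = B1 + B2"
    by (metis refines_plusD)
  \<comment> \<open>Two splittings of one multiset always admit a two-by-two table; here the upper
    left entry is chosen as large as possible.\<close>
  define V11 V12 V21 V22
    where V: "V11 = A1 \<inter># B1" "V12 = A1 - B1" "V21 = B1 - A1" "V22 = A2 - (B1 - A1)"
  have "count A1 x + count A2 x = count B1 x + count B2 x" for x using eq by (metis count_union)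
  then have "A1 = V11 + V12" "A2 = V21 + V22" "B1 = V11 + V21" "B2 = V12 + V22"
    unfolding V by (auto intro!: multiset_eqI simp: min_def) (smt (verit) add_diff_cancel_left' add_diff_inverse_nat diff_diff_left nat_add_left_cancel_less not_less diff_is_0_eq le_add_diff_inverse2 add.commute nat_le_linear)+
  with A B that show ?thesis by metis
qed

text \<open>Cancel one element \<open>z\<close> at a time. In the refinement table
  \<open>V21 + V22\<close> and \<open>V12 + V22\<close> both have sum \<open>z\<close>, so
  cancellation in \<open>M\<close> gives \<open>V12\<close> and \<open>V21\<close> equal sums and
  thus a common refinement.\<close>

lemma equi_cancel:
  assumes "equi (X + Z) (Y + Z)"
  shows "equi X Y"
  using assms
proof (induction Z arbitrary: X Y)
  case (add z Z)
  have "equi (add_mset z X + Z) (add_mset z Y + Z)" using add.prems by simp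
  then have "equi (X + {#z#}) (Y + {#z#})" using add.IH by simp
  then obtain V11 V12 V21 V22 where V: "refines X (V11 + V12)" "refines {#z#} (V21 + V22)"
      "refines Y (V11 + V21)" "refines {#z#} (V12 + V22)"
    by (rule equi_refine)
  have z: "z \<in> ecarrier M" using refines_closed[OF V(2)] by simp
  have m: "msum (V21 + V22) z" "msum (V12 + V22) z"
    using refines_msum[OF V(2) msum_single[OF z]] refines_msum[OF V(4) msum_single[OF z]] .
  obtain p q where pq: "msum V21 p" "msum V22 q" "esum p q z" using msum_plusD[OF m(1)] .
  obtain p' q' where pq': "msum V12 p'" "msum V22 q'" "esum p' q' z" using msum_plusD[OF m(2)] .
  have "q' = q" using msum_unique[OF pq'(2) pq(2)] .
  then have "p' = p"
    using esum_cancel[OF esum_commute[OF pq'(3)]] esum_commute[OF pq(3)] by simp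
  then have "equi V12 V21" using msum_common_refinement pq(1) pq'(1) unfolding equi_def by simp
  moreover have "equi V11 V11" using equi_refl refines_closed[OF V(1)] by simp
  ultimately have "equi (V11 + V12) (V11 + V21)" by (rule equi_plus[rotated])
  from equi_trans[OF equi_refines[OF V(1)] equi_trans[OF this equi_sym[OF equi_refines[OF V(3)]]]]
  show ?case .
qed simp

definition leq :: "'a multiset \<Rightarrow> 'a multiset \<Rightarrow> bool" where
  "leq X Y \<longleftrightarrow> (\<exists>Z. equi (X + Z) Y)"

lemma leq_plus: "leq X Y \<Longrightarrow> leq X' Y' \<Longrightarrow> leq (X + X') (Y + Y')"
proof -
  assume "leq X Y" "leq X' Y'"
  then obtain Z Z' where "equi (X + Z) Y" "equi (X' + Z') Y'" unfolding leq_def by blast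
  from equi_plus[OF this] have "equi ((X + X') + (Z + Z')) (Y + Y')" by (simp add: ac_simps)
  then show ?thesis unfolding leq_def by blast
qed

lemma leq_refl: "set_mset X \<subseteq> ecarrier M \<Longrightarrow> leq X X"
  unfolding leq_def using equi_refl by (metis add_0_right)

lemma leq_cancel: "leq (X + Z) (Y + Z) \<Longrightarrow> leq X Y"
proof -
  assume "leq (X + Z) (Y + Z)"
  then obtain W where "equi ((X + Z) + W) (Y + Z)" unfolding leq_def by blast
  then have "equi ((X + W) + Z) (Y + Z)" by (simp add: ac_simps)
  from equi_cancel[OF this] show ?thesis unfolding leq_def by blast
qed

lemma equi_leq: "equi X Y \<Longrightarrow> leq X Y"
  unfolding leq_def by (metis add_0_right)

lemma leq_single_iff: "leq {#a#} {#b#} \<longleftrightarrow> ele M a b"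
proof
  assume "leq {#a#} {#b#}"
  then obtain Z where "equi (add_mset a Z) {#b#}" unfolding leq_def by auto
  then have "msum (add_mset a Z) b" by (simp add: equi_single_iff)
  then show "ele M a b" by (auto simp: ele_iff elim: msum_add_msetD)
next
  assume "ele M a b"
  then obtain c where c: "esum a c b" by (auto simp: ele_iff)
  then have "msum {#a, c#} b"
    using msum.add[OF msum_single c] esum_closed(2) by (metis add_mset_commute)
  then have "equi {#a, c#} {#b#}" by (simp only: equi_single_iff)
  then have "equi ({#a#} + {#c#}) {#b#}" by (simp add: add_mset_commute)
  then show "leq {#a#} {#b#}" unfolding leq_def by blast
qed

end

section \<open>The universal group as a preordered free abelian group\<close>

definition formal_sum :: "'a multiset \<Rightarrow> 'a \<Rightarrow>\<^sub>0 int" where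
  "formal_sum X = (\<Sum>a\<in>#X. Poly_Mapping.single a 1)"

lemma formal_sum_plus: "formal_sum (X + Y) = formal_sum X + formal_sum Y"
  by (simp add: formal_sum_def)

lemma formal_sum_empty [simp]: "formal_sum {#} = 0"
  by (simp add: formal_sum_def)

lemma lookup_formal_sum: "Poly_Mapping.lookup (formal_sum X) a = int (count X a)"
  by (induction X) (auto simp: formal_sum_def lookup_add lookup_single when_def)

lemma formal_sum_eqD: "formal_sum X = formal_sum Y \<Longrightarrow> X = Y"
proof (rule multiset_eqI)
  fix a
  assume "formal_sum X = formal_sum Y"
  then show "count X a = count Y a" using lookup_formal_sum[of X a] lookup_formal_sum[of Y a] by simp
qed

lemma formal_sum_diff:
  obtains X Y where "x = formal_sum X - formal_sum Y"
proof -
  have fin: "finite {a. 0 < nat (f (Poly_Mapping.lookup x a))}" if "f 0 = 0" for f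
    by (rule finite_subset[OF _ finite_keys[of x]]) (auto simp: in_keys_iff that)
  define X where "X = Abs_multiset (\<lambda>a. nat (Poly_Mapping.lookup x a))"
  define Y where "Y = Abs_multiset (\<lambda>a. nat (- Poly_Mapping.lookup x a))"
  have "count X a = nat (Poly_Mapping.lookup x a)" "count Y a = nat (- Poly_Mapping.lookup x a)" for a
    using fin[of id] fin[of uminus] by (simp_all add: X_def Y_def)
  then have "x = formal_sum X - formal_sum Y"
    by (intro poly_mapping_eqI) (simp add: lookup_minus lookup_formal_sum)
  with that show ?thesis .
qed

context rdp_effect_algebra
begin

text \<open>Generators outside the carrier are identified with \<open>0\<close>, so that the whole free abelian group
  is bounded by multiples of the unit.\<close>

definition retract :: "'a multiset \<Rightarrow> 'a multiset" where
  "retract = image_mset (\<lambda>a. if a \<in> ecarrier M then a else ezero M)"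

lemma retract_plus: "retract (X + Y) = retract X + retract Y"
  by (simp add: retract_def)

lemma retract_closed: "set_mset (retract X) \<subseteq> ecarrier M"
  using zero_closed by (auto simp: retract_def)

lemma retract_id: "set_mset X \<subseteq> ecarrier M \<Longrightarrow> retract X = X"
  by (induction X) (simp_all add: retract_def)

text \<open>This encodes the Grothendieck group of the refinement monoid: elements whose differences
  in both directions lie in the cone play the role of equal ones.\<close>

definition cone :: "('a \<Rightarrow>\<^sub>0 int) set" where
  "cone = {formal_sum X - formal_sum Y |X Y. leq (retract Y) (retract X)}"

text \<open>Two representations of the same difference agree after adding multisets crosswise, and
  cancellation in the monoid removes what was added.\<close>

lemma diff_in_cone_iff: "formal_sum X - formal_sum Y \<in> cone \<longleftrightarrow> leq (retract Y) (retract X)"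
proof
  assume "formal_sum X - formal_sum Y \<in> cone"
  then obtain X' Y' where eq: "formal_sum X - formal_sum Y = formal_sum X' - formal_sum Y'"
    and l: "leq (retract Y') (retract X')" by (auto simp: cone_def)
  from eq have "formal_sum (X + Y') = formal_sum (X' + Y)"
    by (simp add: formal_sum_plus algebra_simps)
  then have e: "X + Y' = X' + Y" by (rule formal_sum_eqD)
  have "leq (retract Y' + retract Y) (retract X' + retract Y)"
    using l by (intro leq_plus leq_refl retract_closed)
  also have "retract X' + retract Y = retract X + retract Y'"
    using e by (metis retract_plus)
  finally show "leq (retract Y) (retract X)"
    by (intro leq_cancel[of "retract Y" "retract Y'"]) (simp add: add.commute)
qed (auto simp: cone_def)

lemma formal_sum_in_cone: "formal_sum X \<in> cone"
  using diff_in_cone_iff[of X "{#}"] equi_refl[OF retract_closed, of X]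
  by (auto simp: leq_def retract_def)

lemma cone_add: "x \<in> cone \<Longrightarrow> y \<in> cone \<Longrightarrow> x + y \<in> cone"
proof -
  assume "x \<in> cone" "y \<in> cone"
  then obtain X Y X' Y' where xy: "x = formal_sum X - formal_sum Y" "y = formal_sum X' - formal_sum Y'"
    and l: "leq (retract Y) (retract X)" "leq (retract Y') (retract X')" by (auto simp: cone_def)
  have "x + y = formal_sum (X + X') - formal_sum (Y + Y')"
    using xy by (simp add: formal_sum_plus)
  then show ?thesis using leq_plus[OF l] by (simp add: diff_in_cone_iff retract_plus)
qed

text \<open>If \<open>Y\<close> is below \<open>X\<close> in the monoid, the multiset completing it
  to \<open>X\<close> represents the difference up to equivalence. This reduces questions about the
  cone to multisets.\<close>

lemma cone_representative:
  assumes "x \<in> cone"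
  obtains Z where "set_mset Z \<subseteq> ecarrier M" "x - formal_sum Z \<in> cone" "formal_sum Z - x \<in> cone"
proof -
  obtain X Y where x: "x = formal_sum X - formal_sum Y" and "leq (retract Y) (retract X)"
    using assms by (auto simp: cone_def)
  then obtain Z where Z: "equi (retract Y + Z) (retract X)" by (auto simp: leq_def)
  then have ZC: "set_mset Z \<subseteq> ecarrier M" using equi_closed by fastforce
  have "x - formal_sum Z = formal_sum X - formal_sum (Y + Z)"
    "formal_sum Z - x = formal_sum (Y + Z) - formal_sum X"
    using x by (simp_all add: formal_sum_plus algebra_simps)
  then show ?thesis
    using equi_leq[OF Z] equi_leq[OF equi_sym[OF Z]] ZC
    by (intro that[of Z]) (simp_all add: diff_in_cone_iff retract_plus retract_id)
qed

abbreviation unit :: "'a \<Rightarrow>\<^sub>0 int" where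
  "unit \<equiv> formal_sum {#eone M#}"

lemma leq_unit_multiple: "set_mset X \<subseteq> ecarrier M \<Longrightarrow> leq X (replicate_mset (size X) (eone M))"
proof (induction X)
  case empty
  then show ?case using leq_refl by simp
next
  case (add x X)
  obtain y where "esum x y (eone M)" using add.prems esum_compl by auto
  then have "leq {#x#} {#eone M#}" by (auto simp: leq_single_iff ele_iff)
  from leq_plus[OF this add.IH] add.prems show ?case by simp
qed

lemma nmul_formal_sum: "nmul n (formal_sum {#a#}) = formal_sum (replicate_mset n a)"
  by (induction n) (simp_all add: formal_sum_def)

lemma size_retract [simp]: "size (retract X) = size X"
  by (simp add: retract_def)

sublocale unital_cone cone unit
proof
  show "0 \<in> cone" using formal_sum_in_cone[of "{#}"] by simp
  show "unit \<in> cone" by (rule formal_sum_in_cone)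
  show "\<exists>n. nmul n unit - x \<in> cone" for x
  proof -
    obtain X Y where x: "x = formal_sum X - formal_sum Y" using formal_sum_diff by blast
    let ?U = "replicate_mset (size X) (eone M)"
    have U: "retract ?U = ?U" using one_closed by (simp add: retract_def)
    have "leq (retract X + {#}) (?U + retract Y)"
      using leq_unit_multiple[OF retract_closed, of X] diff_in_cone_iff[of Y "{#}"] formal_sum_in_cone[of Y]
      by (intro leq_plus) (simp_all add: retract_def)
    then have "formal_sum (?U + Y) - formal_sum X \<in> cone"
      by (simp add: diff_in_cone_iff retract_plus U)
    then have "nmul (size X) unit - x \<in> cone"
      by (simp add: nmul_formal_sum x formal_sum_plus algebra_simps)
    then show ?thesis by blast
  qed
  show "- unit \<notin> cone"
  proof
    assume "- unit \<in> cone"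
    then have "leq {#eone M#} {#}"
      using diff_in_cone_iff[of "{#}" "{#eone M#}"] one_closed by (simp add: retract_def)
    then obtain Z where "equi (add_mset (eone M) Z) {#}" by (auto simp: leq_def)
    then have "msum (add_mset (eone M) Z) (ezero M)" using equi_msum[OF equi_sym msum.empty] by blast
    then show False using zero_neq_one esum_eq_zero by (metis msum_add_msetD)
  qed
qed (rule cone_add)

notation le (infix "\<preceq>" 50)

lemma cone_equivD:
  assumes "x - formal_sum Z \<in> cone" "formal_sum Z - x \<in> cone" "y - formal_sum W \<in> cone" "formal_sum W - y \<in> cone"
  shows "x \<preceq> y \<longleftrightarrow> formal_sum Z \<preceq> formal_sum W"
proof
  have xZ: "formal_sum Z \<preceq> x" "x \<preceq> formal_sum Z" and yW: "formal_sum W \<preceq> y" "y \<preceq> formal_sum W"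
    using assms by (simp_all add: le_def)
  show "formal_sum Z \<preceq> formal_sum W" if "x \<preceq> y"
    by (rule le_trans[OF le_trans[OF xZ(1) that] yW(2)])
  show "x \<preceq> y" if "formal_sum Z \<preceq> formal_sum W"
    by (rule le_trans[OF le_trans[OF xZ(2) that] yW(1)])
qed

lemma formal_sum_le_iff:
  assumes "set_mset X \<subseteq> ecarrier M" "set_mset Y \<subseteq> ecarrier M"
  shows "formal_sum X \<preceq> formal_sum Y \<longleftrightarrow> leq X Y"
  using assms by (simp add: le_def diff_in_cone_iff retract_id)

text \<open>On representatives the inequality reads \<open>equi (X + W) (Y + Z)\<close> for some
  \<open>W\<close>. The refinement table splits \<open>X\<close> into a part inside \<open>Y\<close>
  and a part inside \<open>Z\<close>, and the former gives \<open>a\<close>.\<close>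

lemma cone_riesz:
  assumes x: "x \<in> cone" and y: "y \<in> cone" and z: "z \<in> cone" and le: "x \<preceq> y + z"
  shows "\<exists>a\<in>cone. x - a \<in> cone \<and> a \<preceq> y \<and> x - a \<preceq> z"
proof -
  obtain X where X: "set_mset X \<subseteq> ecarrier M" "x - formal_sum X \<in> cone" "formal_sum X - x \<in> cone"
    using cone_representative[OF x] .
  obtain Y where Y: "set_mset Y \<subseteq> ecarrier M" "y - formal_sum Y \<in> cone" "formal_sum Y - y \<in> cone"
    using cone_representative[OF y] .
  obtain Z where Z: "set_mset Z \<subseteq> ecarrier M" "z - formal_sum Z \<in> cone" "formal_sum Z - z \<in> cone"
    using cone_representative[OF z] .
  have "(y + z) - formal_sum (Y + Z) \<in> cone" "formal_sum (Y + Z) - (y + z) \<in> cone"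
    using cone_add[OF Y(2) Z(2)] cone_add[OF Y(3) Z(3)] by (simp_all add: formal_sum_plus algebra_simps)
  from cone_equivD[OF X(2,3) this] le have "formal_sum X \<preceq> formal_sum (Y + Z)" by simp
  then have "leq X (Y + Z)" using X(1) Y(1) Z(1) by (simp add: formal_sum_le_iff)
  then obtain W where "equi (X + W) (Y + Z)" by (auto simp: leq_def)
  then obtain V11 V12 V21 V22 where V: "refines X (V11 + V12)" "refines W (V21 + V22)"
      "refines Y (V11 + V21)" "refines Z (V12 + V22)"
    by (rule equi_refine)
  have C: "set_mset V11 \<subseteq> ecarrier M" "set_mset V12 \<subseteq> ecarrier M" "set_mset V21 \<subseteq> ecarrier M"
      "set_mset V22 \<subseteq> ecarrier M"
    using refines_closed[OF V(1)] refines_closed[OF V(2)] by auto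
  have X1: "leq (V11 + V12) X" "leq X (V11 + V12)" and Y1: "leq (V11 + V21) Y" and Z1: "leq (V12 + V22) Z"
    using equi_leq[OF equi_refines[OF V(1)]] equi_leq[OF equi_sym[OF equi_refines[OF V(1)]]]
      equi_leq[OF equi_sym[OF equi_refines[OF V(3)]]] equi_leq[OF equi_sym[OF equi_refines[OF V(4)]]] by simp_all
  then have s: "formal_sum V11 + formal_sum V12 \<preceq> formal_sum X" "formal_sum X \<preceq> formal_sum V11 + formal_sum V12"
      "formal_sum V11 + formal_sum V21 \<preceq> formal_sum Y" "formal_sum V12 + formal_sum V22 \<preceq> formal_sum Z"
    using X(1) Y(1) Z(1) C by (simp_all flip: formal_sum_plus add: formal_sum_le_iff)
  have pos: "0 \<preceq> formal_sum U" for U by (simp add: nonneg_iff formal_sum_in_cone)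
  have xX: "formal_sum X \<preceq> x" "x \<preceq> formal_sum X" and yY: "formal_sum Y \<preceq> y" and zZ: "formal_sum Z \<preceq> z"
    using X Y Z by (simp_all add: le_def)
  have "0 + formal_sum V11 \<preceq> formal_sum V12 + formal_sum V11"
    using pos by (simp only: le_add_right)
  then have "formal_sum V11 \<preceq> x"
    using le_trans[OF le_trans[OF _ s(1)] xX(1)] by (simp add: add.commute)
  moreover have "formal_sum V11 + 0 \<preceq> formal_sum V11 + formal_sum V21"
    by (rule le_add_mono[OF le_refl pos])
  then have "formal_sum V11 \<preceq> y" using le_trans[OF le_trans[OF _ s(3)] yY] by simp
  moreover have "x \<preceq> formal_sum V12 + formal_sum V11"
    using le_trans[OF xX(2) s(2)] by (simp add: add.commute)
  then have "x - formal_sum V11 \<preceq> formal_sum V12" by (simp add: diff_le_iff)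
  moreover have "formal_sum V12 + 0 \<preceq> formal_sum V12 + formal_sum V22"
    by (rule le_add_mono[OF le_refl pos])
  then have "formal_sum V12 \<preceq> z" using le_trans[OF le_trans[OF _ s(4)] zZ] by simp
  ultimately show ?thesis
    using formal_sum_in_cone[of V11] le_trans by (intro bexI[of _ "formal_sum V11"]) (auto simp: le_def[of _ x])
qed

text \<open>A representative \<open>X\<close> extends to a multiset with sum \<open>eone M\<close>,
  so \<open>X\<close> itself has a sum in \<open>M\<close>. Thus the unit interval of the group is
  \<open>M\<close> up to equivalence.\<close>

lemma below_unit_representative:
  assumes "x \<in> cone" "x \<preceq> unit"
  obtains a where "a \<in> ecarrier M" "x - formal_sum {#a#} \<in> cone" "formal_sum {#a#} - x \<in> cone"
proof -
  obtain X where X: "set_mset X \<subseteq> ecarrier M" "x - formal_sum X \<in> cone" "formal_sum X - x \<in> cone"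
    using cone_representative[OF assms(1)] .
  have "formal_sum X \<preceq> x" using X(2) by (simp add: le_def)
  from le_trans[OF this assms(2)] have "leq X {#eone M#}"
    using X(1) one_closed by (simp add: formal_sum_le_iff)
  then obtain Z where "msum (X + Z) (eone M)" by (auto simp: leq_def equi_single_iff)
  then obtain a where a: "msum X a" by (rule msum_plusD)
  then have aC: "a \<in> ecarrier M" using msum_closed by simp
  from a have "equi X {#a#}" by (simp add: equi_single_iff)
  then have l: "formal_sum X \<preceq> formal_sum {#a#}" "formal_sum {#a#} \<preceq> formal_sum X"
    using X(1) aC equi_leq equi_sym by (simp_all add: formal_sum_le_iff)
  have "formal_sum {#a#} \<preceq> x" "x \<preceq> formal_sum {#a#}"
    using le_trans[OF l(2)] le_trans[OF _ l(1)] X(2,3) by (simp_all add: le_def)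
  with aC that show ?thesis by (simp add: le_def)
qed

lemma single_le_iff: "a \<in> ecarrier M \<Longrightarrow> b \<in> ecarrier M \<Longrightarrow> formal_sum {#a#} \<preceq> formal_sum {#b#} \<longleftrightarrow> ele M a b"
  by (simp add: formal_sum_le_iff leq_single_iff)

lemma positive_functional_state:
  assumes s: "positive_functional s"
  shows "(\<lambda>a\<in>ecarrier M. s (formal_sum {#a#})) \<in> states M"
proof -
  have add: "s (x + y) = s x + s y" and pos: "x \<in> cone \<Longrightarrow> 0 \<le> s x" and one: "s unit = 1" for x y
    using s by (auto simp: positive_functional_def)
  have mono: "s x \<le> s y" if "x \<preceq> y" for x y
    using add[of x "y - x"] pos[of "y - x"] that by (simp add: le_def)
  have plus: "s (formal_sum {#c#}) = s (formal_sum {#a#}) + s (formal_sum {#b#})" if "esum a b c" for a b c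
  proof -
    have "msum {#a, b#} c" using msum.add[OF msum_single that] esum_closed(2)[OF that] by blast
    then have "equi {#a, b#} {#c#}" by (simp only: equi_single_iff)
    then have "formal_sum {#a, b#} \<preceq> formal_sum {#c#}" "formal_sum {#c#} \<preceq> formal_sum {#a, b#}"
      using equi_leq equi_sym esum_closed[OF that] by (simp_all add: formal_sum_le_iff)
    then have "s (formal_sum {#a, b#}) = s (formal_sum {#c#})" using mono by (simp add: antisym)
    then show ?thesis using add formal_sum_plus[of "{#b#}" "{#a#}"] by simp
  qed
  have "ele M a (eone M)" if "a \<in> ecarrier M" for a
    using that esum_compl ele_iff by metis
  then have range: "s (formal_sum {#a#}) \<in> {0..1}" if "a \<in> ecarrier M" for a
    using that mono[of "formal_sum {#a#}" unit] one_closed pos[OF formal_sum_in_cone] one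
    by (simp add: single_le_iff)
  have additive: "s (formal_sum {#c#}) = s (formal_sum {#a#}) + s (formal_sum {#b#})" "c \<in> ecarrier M"
    if "a \<in> ecarrier M" "b \<in> ecarrier M" "eplus M a b = Some c" for a b c
    using plus[of a b c] plus_closed[OF that] that by (simp_all add: esum_def)
  show ?thesis
    unfolding states_def mem_Collect_eq
  proof (intro conjI ballI allI impI)
    show "(\<lambda>a\<in>ecarrier M. s (formal_sum {#a#})) \<in> ecarrier M \<rightarrow>\<^sub>E {0..1}"
      by (rule restrict_PiE_iff[THEN iffD2]) (use range in blast)
  next
    fix a b c assume abc: "a \<in> ecarrier M" "b \<in> ecarrier M" "eplus M a b = Some c"
    then show "(\<lambda>a\<in>ecarrier M. s (formal_sum {#a#})) c =
        (\<lambda>a\<in>ecarrier M. s (formal_sum {#a#})) a + (\<lambda>a\<in>ecarrier M. s (formal_sum {#a#})) b"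
      using additive[OF abc] by simp
  qed (simp add: one_closed one)
qed

end

section \<open>Transfer of sigma-completeness to the group\<close>

locale sigma_effect_algebra = rdp_effect_algebra M for M :: "'a effect_alg" +
  assumes sigma_complete: "monotone_sigma_complete M"
begin

notation le (infix "\<preceq>" 50)

sublocale riesz_sigma_cone cone unit
proof
  show "\<exists>a\<in>cone. x - a \<in> cone \<and> a \<preceq> y \<and> x - a \<preceq> z"
    if "x \<in> cone" "y \<in> cone" "z \<in> cone" "x \<preceq> y + z" for x y z
    using cone_riesz[OF that] .
next
  fix f :: "nat \<Rightarrow> 'a \<Rightarrow>\<^sub>0 int"
  assume f: "\<And>n. f n \<in> cone" "\<And>n. f n \<preceq> f (Suc n)" "\<And>n. f n \<preceq> unit"
  have "\<exists>a\<in>ecarrier M. f n - formal_sum {#a#} \<in> cone \<and> formal_sum {#a#} - f n \<in> cone" for n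
    using below_unit_representative[OF f(1,3)] by blast
  then obtain a where a: "\<And>n. a n \<in> ecarrier M" "\<And>n. f n - formal_sum {#a n#} \<in> cone"
      "\<And>n. formal_sum {#a n#} - f n \<in> cone" by metis
  have "ele M (a n) (a (Suc n))" for n
    using cone_equivD[OF a(2,3) a(2,3), of n "Suc n"] f(2) a(1) by (simp add: single_le_iff)
  then have "eincseq M a" using a(1) by (simp add: eincseq_def)
  then obtain b where b: "is_esup M (range a) b"
    using sigma_complete by (auto simp: monotone_sigma_complete_def)
  then have bC: "b \<in> ecarrier M" and up: "\<And>n. ele M (a n) b"
    and least: "\<And>c. c \<in> ecarrier M \<Longrightarrow> (\<And>n. ele M (a n) c) \<Longrightarrow> ele M b c"
    by (auto simp: is_esup_def)
  have zero: "formal_sum {#b#} - formal_sum {#b#} \<in> cone" using formal_sum_in_cone[of "{#}"] by simp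
  show "\<exists>s. (\<forall>n. f n \<preceq> s) \<and> (\<forall>w. w \<preceq> unit \<longrightarrow> (\<forall>n. f n \<preceq> w) \<longrightarrow> s \<preceq> w)"
  proof (intro exI[of _ "formal_sum {#b#}"] conjI allI impI)
    show "f n \<preceq> formal_sum {#b#}" for n
      using cone_equivD[OF a(2,3) zero zero, of n] up[of n] a(1) bC by (simp add: single_le_iff)
  next
    fix w assume w: "w \<preceq> unit" "\<forall>n. f n \<preceq> w"
    \<comment> \<open>Only positive elements below the unit have representatives in
      \<open>M\<close>; \<open>w\<close> is positive because it lies above
      \<open>f 0\<close>.\<close>
    have "0 \<preceq> f 0" using f(1) by (simp add: nonneg_iff)
    from le_trans[OF this] w(2) have "w \<in> cone" by (simp add: nonneg_iff)
    then obtain c where c: "c \<in> ecarrier M" "w - formal_sum {#c#} \<in> cone" "formal_sum {#c#} - w \<in> cone"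
      using below_unit_representative w(1) by blast
    have "ele M (a n) c" for n
      using cone_equivD[OF a(2,3) c(2,3), of n] w(2) a(1) c(1) by (simp add: single_le_iff)
    then have "ele M b c" using least c(1) by blast
    then show "formal_sum {#b#} \<preceq> w"
      using cone_equivD[OF zero zero c(2,3)] bC c(1) by (simp add: single_le_iff)
  qed
qed

theorem states_determine_order:
  assumes C: "a \<in> ecarrier M" "b \<in> ecarrier M" and le: "\<And>m. m \<in> states M \<Longrightarrow> m a \<le> m b"
  shows "ele M a b"
proof -
  have "formal_sum {#a#} - formal_sum {#b#} \<preceq> 0"
  proof (rule nonpos_if_functionals_nonpos)
    fix s assume s: "positive_functional s"
    then have "s (formal_sum {#a#}) = s (formal_sum {#a#} - formal_sum {#b#}) + s (formal_sum {#b#})"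
      unfolding positive_functional_def by (metis diff_add_cancel)
    moreover have "s (formal_sum {#a#}) \<le> s (formal_sum {#b#})"
      using le[OF positive_functional_state[OF s]] C by simp
    ultimately show "s (formal_sum {#a#} - formal_sum {#b#}) \<le> 0" by simp
  qed
  then have "formal_sum {#a#} \<preceq> formal_sum {#b#}" by (simp add: le_def)
  with C show ?thesis by (simp add: single_le_iff)
qed

end

section \<open>Inequalities off a meager set of extreme states\<close>

lemma topology_eq_if_id_continuous:
  assumes "continuous_map X Y id" "continuous_map Y X id"
  shows "X = Y"
proof -
  have "openin X U" if "continuous_map X Y id" "continuous_map Y X id" "openin Y U" for X Y :: "'x topology" and U
  proof -
    have "topspace X = topspace Y" using that(1,2) by (auto simp: continuous_map_def)
    then have "{x \<in> topspace X. id x \<in> U} = U" using openin_subset[OF that(3)] by auto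
    with openin_continuous_map_preimage[OF that(1,3)] show ?thesis by simp
  qed
  with assms show ?thesis unfolding topology_eq by blast
qed

text \<open>Coordinates outside \<open>I\<close> are constant on extensional functions, so they
  contribute nothing to the topology. This carries the results on the full function space over to
  states.\<close>

lemma subtopology_product_extensional:
  fixes S :: "('i \<Rightarrow> real) set"
  assumes "S \<subseteq> extensional I"
  shows "subtopology (product_topology (\<lambda>_. euclideanreal) I) S = top_of_set S"
proof (rule topology_eq_if_id_continuous)
  let ?X = "subtopology (product_topology (\<lambda>_. euclideanreal) I) S"
  have coord: "continuous_map ?X euclideanreal (\<lambda>s. s i)" for i
  proof (cases "i \<in> I")
    case True
    then show ?thesis
      by (intro continuous_map_from_subtopology continuous_map_product_projection)
  next
    case False
    show ?thesis
    proof (rule continuous_map_eq)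
      show "continuous_map ?X euclideanreal (\<lambda>_. undefined)" by simp
      show "undefined = s i" if "s \<in> topspace ?X" for s
        using that assms False by (auto simp: extensional_def)
    qed
  qed
  then have "continuous_map ?X euclidean id"
    by (simp add: continuous_map_componentwise_UNIV flip: euclidean_product_topology)
  then show "continuous_map ?X (top_of_set S) id"
    by (simp add: continuous_map_in_subtopology)
  have "continuous_map (top_of_set S) (product_topology (\<lambda>_. euclideanreal) I) id"
    using assms by (auto simp: continuous_map_componentwise continuous_on_coordinate)
  then show "continuous_map (top_of_set S) ?X id"
    by (simp add: continuous_map_in_subtopology)
qed

lemma meager_in_Union:
  assumes "\<And>n :: nat. meager_in X (A n)"
  shows "meager_in X (\<Union>n. A n)"
proof -
  obtain F :: "nat \<Rightarrow> nat \<Rightarrow> _" where F: "\<And>n k. nowhere_dense_in X (F n k)" "\<And>n. A n = (\<Union>k. F n k)"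
    using assms unfolding meager_in_def by metis
  define G where "G i = F (fst (prod_decode i)) (snd (prod_decode i))" for i
  have "(\<Union>n. A n) = (\<Union>i. G i)"
  proof
    show "(\<Union>n. A n) \<subseteq> (\<Union>i. G i)"
    proof
      fix x assume "x \<in> (\<Union>n. A n)"
      then obtain n k where "x \<in> F n k" using F(2) by blast
      then have "x \<in> G (prod_encode (n, k))" by (simp add: G_def)
      then show "x \<in> (\<Union>i. G i)" by blast
    qed
    show "(\<Union>i. G i) \<subseteq> (\<Union>n. A n)" using F(2) by (auto simp: G_def)
  qed
  moreover have "nowhere_dense_in X (G i)" for i using F(1) by (simp add: G_def)
  ultimately show ?thesis unfolding meager_in_def by blast
qed

lemma borel01_space [simp]: "space borel01 = {0..1}"
  and borel01_sets_iff: "E \<in> sets borel01 \<longleftrightarrow> E \<in> sets borel \<and> E \<subseteq> {0..1}"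
  by (auto simp: borel01_def space_restrict_space sets_restrict_space_iff)

lemma ele_sets_alg_iff: "ele (sets_alg S) A B \<longleftrightarrow> A \<in> sets S \<and> B \<in> sets S \<and> A \<subseteq> B"
proof -
  have "\<exists>C\<in>sets S. A \<inter> C = {} \<and> A \<union> C = B" if "A \<in> sets S" "B \<in> sets S" "A \<subseteq> B"
    using that by (intro bexI[of _ "B - A"]) auto
  then show ?thesis by (auto simp: ele_def sets_alg_def)
qed

lemma increases_to_sets_algI:
  assumes "\<And>n. A n \<in> sets S" "\<And>n. A n \<subseteq> A (Suc n)" "B = (\<Union>n. A n)"
  shows "increases_to (sets_alg S) A B"
proof -
  have "ecarrier (sets_alg S) = sets S" by (simp add: sets_alg_def)
  moreover have "(\<Union>n. A n) \<in> sets S" using assms(1) by blast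
  ultimately show ?thesis
    using assms by (auto simp: increases_to_def eincseq_def is_esup_def ele_sets_alg_iff)
qed

lemma increases_to_sets_algD:
  assumes "increases_to (sets_alg S) A B"
  shows "A n \<in> sets S" "A n \<subseteq> A (Suc n)" "B = (\<Union>n. A n)"
proof -
  have A: "A n \<in> sets S" "A n \<subseteq> A (Suc n)" "A n \<subseteq> B" for n
    using assms by (auto simp: increases_to_def eincseq_def is_esup_def ele_sets_alg_iff)
  then show "A n \<in> sets S" "A n \<subseteq> A (Suc n)" by blast+
  have "(\<Union>n. A n) \<in> sets S" using A(1) by blast
  moreover have "ecarrier (sets_alg S) = sets S" by (simp add: sets_alg_def)
  then have "\<forall>u\<in>sets S. (\<forall>n. ele (sets_alg S) (A n) u) \<longrightarrow> ele (sets_alg S) B u"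
    using assms by (simp add: increases_to_def is_esup_def)
  moreover have "\<forall>n. ele (sets_alg S) (A n) (\<Union>n. A n)"
    using A(1) \<open>(\<Union>n. A n) \<in> sets S\<close> by (auto simp: ele_sets_alg_iff)
  ultimately have "ele (sets_alg S) B (\<Union>n. A n)" by blast
  then have "B \<subseteq> (\<Union>n. A n)" by (simp add: ele_sets_alg_iff)
  with A(3) show "B = (\<Union>n. A n)" by blast
qed

context effect_algebra
begin

section \<open>The state space as a compact convex set\<close>

lemma statesD:
  assumes "s \<in> states M"
  shows "a \<in> ecarrier M \<Longrightarrow> 0 \<le> s a" "a \<in> ecarrier M \<Longrightarrow> s a \<le> 1" "a \<notin> ecarrier M \<Longrightarrow> s a = undefined"
    "s (eone M) = 1" "esum a b c \<Longrightarrow> s c = s a + s b"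
  using assms by (auto simp: states_def PiE_iff extensional_def esum_def)

lemma state_zero: "s \<in> states M \<Longrightarrow> s (ezero M) = 0"
  using statesD(5)[OF _ esum_zero[OF zero_closed], of s] by simp

lemma state_mono:
  assumes s: "s \<in> states M" and "ele M a b"
  shows "s a \<le> s b"
proof -
  obtain c where c: "esum a c b" using assms(2) unfolding ele_iff ..
  then show ?thesis using statesD(5)[OF s c] statesD(1)[OF s esum_closed(2)[OF c]] by simp
qed

lemma ele_antisym:
  assumes "ele M a b" "ele M b a"
  shows "a = b"
proof -
  obtain c d where c: "esum a c b" and d: "esum b d a" using assms by (auto simp: ele_iff)
  obtain f where f: "esum c d f" "esum a f a" using esum_assoc[OF c d] .
  have "a \<in> ecarrier M" using esum_closed(1)[OF c] .
  then have "f = ezero M" using esum_cancel[OF f(2) esum_zero] by simp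
  then have "c = ezero M" using esum_eq_zero f(1) by simp
  then show ?thesis using esum_unique[OF c] esum_zero[OF \<open>a \<in> ecarrier M\<close>] by simp
qed

lemma ele_zero: "a \<in> ecarrier M \<Longrightarrow> ele M (ezero M) a"
  using esum_zero_left by (auto simp: ele_iff)

lemma esum_ecompl:
  assumes "a \<in> ecarrier M"
  shows "esum a (ecompl M a) (eone M)"
  using theI'[OF ex1_compl[OF assms]] assms by (simp add: esum_def ecompl_def)

lemma compact_states: "compact (states M)"
proof -
  \<comment> \<open>Outside the carrier the factor is the singleton of the default value, so
    extensional functions form a compact product by Tychonoff's theorem.\<close>
  define B where "B = (\<Pi>\<^sub>E i\<in>UNIV. if i \<in> ecarrier M then {0..1} else {undefined :: real})"
  have "compactin (product_topology (\<lambda>i. euclideanreal) UNIV) B"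
    unfolding B_def by (subst compactin_PiE) auto
  then have "compact B" by (simp add: euclidean_product_topology)
  moreover define D where "D = (\<Inter>(a, b, c)\<in>{(a, b, c). esum a b c}. {s :: 'a \<Rightarrow> real. s c = s a + s b})"
  have "closed D"
    unfolding D_def by (auto intro!: closed_INT closed_Collect_eq continuous_intros continuous_on_coordinate)
  moreover have "closed {s :: 'a \<Rightarrow> real. s (eone M) = 1}"
    by (auto intro!: closed_Collect_eq continuous_intros continuous_on_coordinate)
  moreover have "states M = B \<inter> ({s. s (eone M) = 1} \<inter> D)"
  proof -
    have "s \<in> B \<longleftrightarrow> s \<in> ecarrier M \<rightarrow>\<^sub>E {0..1}" for s
      unfolding B_def by (auto simp: PiE_iff extensional_def)
    then show ?thesis by (auto simp: states_def D_def esum_def)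
  qed
  ultimately show ?thesis by (simp add: compact_Int_closed closed_Int)
qed

sublocale state_space: compact_convex_set "states M"
proof
  show "mix_closed (states M)"
    unfolding mix_closed_def
  proof (intro ballI allI impI)
    fix x y and t :: real assume x: "x \<in> states M" and y: "y \<in> states M" and t: "0 \<le> t \<and> t \<le> 1"
    have "mix t x y a \<in> {0..1}" if "a \<in> ecarrier M" for a
    proof -
      have "t * x a + (1 - t) * y a \<le> t * 1 + (1 - t) * 1"
        using t statesD(2)[OF x that] statesD(2)[OF y that] by (intro add_mono mult_left_mono) auto
      moreover have "0 \<le> t * x a + (1 - t) * y a"
        using t statesD(1)[OF x that] statesD(1)[OF y that] by simp
      ultimately show ?thesis by (simp add: mix_def)
    qed
    \<comment> \<open>A mixture of the default value with itself is that value, so extensionality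
      survives.\<close>
    moreover have "mix t x y a = undefined" if "a \<notin> ecarrier M" for a
      using statesD(3)[OF x that] statesD(3)[OF y that] by (simp add: mix_def algebra_simps)
    moreover have "mix t x y c = mix t x y a + mix t x y b" if "esum a b c" for a b c
      using statesD(5)[OF x that] statesD(5)[OF y that] by (simp add: mix_def algebra_simps)
    moreover have "mix t x y (eone M) = 1" by (simp add: mix_def statesD(4)[OF x] statesD(4)[OF y])
    ultimately show "mix t x y \<in> states M" by (auto simp: states_def esum_def PiE_iff extensional_def)
  qed
qed (rule compact_states)

lemma extreme_eq: "state_space.extreme = extreme_states M"
proof -
  have "x = mix t y z \<longleftrightarrow> (\<forall>a\<in>ecarrier M. x a = t * y a + (1 - t) * z a)"
    if "x \<in> states M" "y \<in> states M" "z \<in> states M" for x y z t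
  proof
    assume r: "\<forall>a\<in>ecarrier M. x a = t * y a + (1 - t) * z a"
    show "x = mix t y z"
    proof
      fix a show "x a = mix t y z a"
        using r statesD(3)[OF that(1), of a] statesD(3)[OF that(2), of a] statesD(3)[OF that(3), of a]
        by (cases "a \<in> ecarrier M") (simp_all add: mix_def algebra_simps)
    qed
  qed (simp add: mix_def)
  then show ?thesis
    unfolding state_space.extreme_def extreme_states_def by blast
qed

lemma extreme_topology_eq: "extreme_topology M = top_of_set (extreme_states M)"
proof -
  have "states M \<subseteq> extensional (ecarrier M)" by (auto simp: states_def PiE_iff)
  from subtopology_product_extensional[OF this]
  have "state_topology M = top_of_set (states M)" by (simp add: state_topology_def)
  moreover have "extreme_states M \<subseteq> states M" by (auto simp: extreme_states_def)
  ultimately show ?thesis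
    by (simp add: extreme_topology_def subtopology_subtopology inf_absorb2)
qed

text \<open>The exceptional set may be larger than the set where \<open>P\<close> fails, which makes
  weakening of \<open>P\<close> immediate.\<close>

definition nearly_all :: "(('a \<Rightarrow> real) \<Rightarrow> bool) \<Rightarrow> bool" where
  "nearly_all P \<longleftrightarrow> (\<exists>A. meager_in (extreme_topology M) A \<and> (\<forall>s\<in>extreme_states M. s \<notin> A \<longrightarrow> P s))"

lemma nearly_all_mono: "nearly_all P \<Longrightarrow> (\<And>s. s \<in> states M \<Longrightarrow> P s \<Longrightarrow> Q s) \<Longrightarrow> nearly_all Q"
  unfolding nearly_all_def extreme_states_def by blast

lemma nearly_all_countable: "(\<And>n :: nat. nearly_all (P n)) \<Longrightarrow> nearly_all (\<lambda>s. \<forall>n. P n s)"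
proof -
  assume "\<And>n. nearly_all (P n)"
  then obtain A where A: "\<And>n. meager_in (extreme_topology M) (A n)"
      "\<And>n s. s \<in> extreme_states M \<Longrightarrow> s \<notin> A n \<Longrightarrow> P n s"
    unfolding nearly_all_def by metis
  then show ?thesis
    unfolding nearly_all_def using meager_in_Union[of "extreme_topology M" A] by blast
qed

lemma nearly_all_conj: "nearly_all P \<Longrightarrow> nearly_all Q \<Longrightarrow> nearly_all (\<lambda>s. P s \<and> Q s)"
proof -
  assume "nearly_all P" "nearly_all Q"
  then have "nearly_all ((\<lambda>n :: nat. if n = 0 then P else Q) n)" for n by simp
  from nearly_all_countable[OF this] show ?thesis
  proof (rule nearly_all_mono)
    fix s assume s: "\<forall>n :: nat. (if n = 0 then P else Q) s"
    show "P s \<and> Q s" using s[rule_format, of 0] s[rule_format, of 1] by simp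
  qed
qed

text \<open>A violation at any state would produce an extreme state with a violation outside the
  meager exceptional set.\<close>

theorem nearly_all_cvx_le:
  assumes "continuous_on (states M) f" "state_space.cvx f" "nearly_all (\<lambda>s. f s \<le> c)" "s \<in> states M"
  shows "f s \<le> c"
proof (rule ccontr)
  assume "\<not> f s \<le> c"
  then have fs: "c < f s" by simp
  obtain A where A: "meager_in (extreme_topology M) A" "\<And>s. s \<in> extreme_states M \<Longrightarrow> s \<notin> A \<Longrightarrow> f s \<le> c"
    using assms(3) unfolding nearly_all_def by blast
  obtain N :: "nat \<Rightarrow> _" where N: "\<And>n. nowhere_dense_in (extreme_topology M) (N n)" "A = (\<Union>n. N n)"
    using A(1) unfolding meager_in_def by blast
  have N': "top_of_set state_space.extreme interior_of (top_of_set state_space.extreme closure_of N n) = {}"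
    "N n \<subseteq> state_space.extreme" for n
    using N(1)[of n] by (simp_all add: nowhere_dense_in_def extreme_topology_eq extreme_eq)
  obtain x where "x \<in> state_space.extreme" "c < f x" "\<And>n. x \<notin> N n"
    by (rule state_space.extreme_avoiding_meager[where N = N, OF assms(1,2,4) fs N']) (rule that)
  then show False using A(2)[of x] N(2) by (simp add: extreme_eq)
qed

lemma cvx_sum: "state_space.cvx (\<lambda>s. \<Sum>k\<in>I. c k * s (b k))"
proof -
  have "(\<Sum>k\<in>I. c k * mix t x y (b k)) = t * (\<Sum>k\<in>I. c k * x (b k)) + (1 - t) * (\<Sum>k\<in>I. c k * y (b k))" for t x y
    by (simp add: mix_def sum_distrib_left algebra_simps flip: sum.distrib)
  then show ?thesis by (simp add: state_space.cvx_def)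
qed

lemma continuous_sum: "continuous_on S (\<lambda>s. \<Sum>k\<in>I. c k * s (b k) :: real)"
  by (intro continuous_intros continuous_on_coordinate)

lemma nearly_all_linear_le:
  assumes "nearly_all (\<lambda>s. (\<Sum>k\<in>I. c k * s (b k)) \<le> d)" "s \<in> states M"
  shows "(\<Sum>k\<in>I. c k * s (b k)) \<le> d"
  using nearly_all_cvx_le[OF continuous_sum cvx_sum assms] .

text \<open>Shows that the fallback to the null measure does not occur. Finite additivity comes from
  the homomorphism and the state; the limit along increasing unions comes from their
  sigma-properties.\<close>

lemma observable_distr_emeasure:
  assumes x: "observable S M x" and m: "m \<in> states M" "sigma_additive M m" and E: "E \<in> sets S"
  shows "emeasure (observable_distr S m x) E = ennreal (m (x E))"
proof (rule emeasure_measure_of[OF observable_distr_def])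
  have hom: "effect_hom (sets_alg S) M x"
    and sup: "\<And>A B. increases_to (sets_alg S) A B \<Longrightarrow> increases_to M (\<lambda>n. x (A n)) (x B)"
    using x by (auto simp: observable_def sigma_hom_def)
  have xC: "x A \<in> ecarrier M" if "A \<in> sets S" for A
    using hom that by (auto simp: effect_hom_def sets_alg_def)
  have add: "m (x (A \<union> B)) = m (x A) + m (x B)" if "A \<in> sets S" "B \<in> sets S" "A \<inter> B = {}" for A B
  proof -
    have "eplus M (x A) (x B) = Some (x (A \<union> B))"
      using hom that by (auto simp: effect_hom_def sets_alg_def)
    then show ?thesis using statesD(5)[OF m(1), of "x A" "x B"] xC that by (simp add: esum_def)
  qed
  have empty: "m (x {}) = 0" using add[of "{}" "{}"] by simp
  show "sets S \<subseteq> Pow (space S)" by (rule sets.space_closed)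
  have sets_eq: "sets (observable_distr S m x) = sets S" by (simp add: observable_distr_def sets.sigma_sets_eq sets.space_closed)
  show "positive (sets (observable_distr S m x)) (\<lambda>E. ennreal (m (x E)))"
    by (simp add: positive_def empty)
  show "E \<in> sets (observable_distr S m x)" using E sets_eq by simp
  show "countably_additive (sets (observable_distr S m x)) (\<lambda>E. ennreal (m (x E)))"
    unfolding countably_additive_def sets_eq
  proof (intro allI impI)
    fix A :: "nat \<Rightarrow> _" assume A: "range A \<subseteq> sets S" "disjoint_family A" "(\<Union>i. A i) \<in> sets S"
    define B where "B n = (\<Union>i<n. A i)" for n
    have B: "B n \<in> sets S" for n using A(1) by (auto simp: B_def)
    have "B n \<subseteq> B (Suc n)" for n by (auto simp: B_def lessThan_Suc)
    moreover have "(\<Union>n. B n) = (\<Union>i. A i)"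
      unfolding B_def by (auto intro: lessI)
    ultimately have "increases_to (sets_alg S) B (\<Union>i. A i)"
      using B A(3) by (intro increases_to_sets_algI) auto
    then have "increases_to M (\<lambda>n. x (B n)) (x (\<Union>i. A i))" by (rule sup)
    then have "(\<lambda>n. m (x (B n))) \<longlonglongrightarrow> m (x (\<Union>i. A i))" using m(2) by (auto simp: sigma_additive_def)
    moreover have "m (x (B n)) = (\<Sum>i<n. m (x (A i)))" for n
    proof (induction n)
      case (Suc n)
      have "A i \<inter> A n = {}" if "i < n" for i using A(2) that by (auto simp: disjoint_family_on_def)
      then have "B n \<inter> A n = {}" by (auto simp: B_def)
      moreover have "B (Suc n) = B n \<union> A n" by (auto simp: B_def lessThan_Suc)
      ultimately show ?case using Suc add[of "B n" "A n"] A(1) B by auto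
    qed (simp add: B_def empty)
    ultimately have "(\<lambda>i. m (x (A i))) sums m (x (\<Union>i. A i))" by (simp add: sums_def)
    moreover have "0 \<le> m (x (A i))" for i using statesD(1)[OF m(1) xC] A(1) by auto
    ultimately show "suminf (\<lambda>i. ennreal (m (x (A i)))) = ennreal (m (x (\<Union>i. A i)))"
      by (intro suminf_ennreal_eq)
  qed
qed

end

context sigma_effect_algebra
begin

lemma nearly_all_le_imp_ele:
  assumes "a \<in> ecarrier M" "b \<in> ecarrier M" "nearly_all (\<lambda>s. s a \<le> s b)"
  shows "ele M a b"
proof (rule states_determine_order[OF assms(1,2)])
  fix m assume m: "m \<in> states M"
  \<comment> \<open>The two truth values index the terms of the difference of the evaluations at
    \<open>a\<close> and \<open>b\<close>.\<close>
  have "nearly_all (\<lambda>s. (\<Sum>k\<in>{True, False}. (if k then 1 else -1) * s (if k then a else b)) \<le> 0)"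
    using assms(3) by (rule nearly_all_mono) simp
  from nearly_all_linear_le[OF this m] show "m a \<le> m b" by simp
qed

lemma nearly_all_eq_imp_eq:
  assumes "a \<in> ecarrier M" "b \<in> ecarrier M" "nearly_all (\<lambda>s. s a = s b)"
  shows "a = b"
  using assms by (intro ele_antisym nearly_all_le_imp_ele) (auto elim: nearly_all_mono)

lemma canonical_rel_imp_nearly_all: "canonical_rel M f b \<Longrightarrow> nearly_all (\<lambda>s. f s = s b)"
  unfolding canonical_rel_def nearly_all_def Nset_def hat_def extreme_states_def by fastforce

text \<open>Two elements related to the same \<open>f\<close> agree at nearly all extreme states and
  are therefore equal, so the definite description is justified.\<close>

lemma canonical_hom:
  assumes "f \<in> canonical_tribe M"
  shows "canonical_hom M f \<in> ecarrier M" "nearly_all (\<lambda>s. f s = s (canonical_hom M f))"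
proof -
  obtain b where b: "b \<in> ecarrier M" "canonical_rel M f b"
    using assms by (auto simp: canonical_tribe_def)
  have uniq: "c = b" if "c \<in> ecarrier M" "canonical_rel M f c" for c
  proof (rule nearly_all_eq_imp_eq[OF that(1) b(1)])
    show "nearly_all (\<lambda>s. s c = s b)"
      using nearly_all_conj[OF canonical_rel_imp_nearly_all[OF that(2)] canonical_rel_imp_nearly_all[OF b(2)]]
      by (rule nearly_all_mono) simp
  qed
  have "(THE b. b \<in> ecarrier M \<and> canonical_rel M f b) = b"
    by (rule the_equality) (use b uniq in blast)+
  then have hom: "canonical_hom M f = b" using assms by (simp add: canonical_hom_def)
  show "canonical_hom M f \<in> ecarrier M" unfolding hom by (rule b(1))
  show "nearly_all (\<lambda>s. f s = s (canonical_hom M f))"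
    unfolding hom by (rule canonical_rel_imp_nearly_all[OF b(2)])
qed

lemma hat_in_canonical_tribe:
  assumes "a \<in> ecarrier M"
  shows "hat M a \<in> canonical_tribe M"
proof -
  have "meager_in (extreme_topology M) {}"
    unfolding meager_in_def nowhere_dense_in_def by (intro exI[of _ "\<lambda>_. {}"]) simp
  moreover have "Nset M (\<lambda>s. hat M a s - hat M a s) = {}" by (simp add: Nset_def)
  ultimately have "canonical_rel M (hat M a) a" by (simp add: canonical_rel_def)
  moreover have "hat M a \<in> states M \<rightarrow>\<^sub>E {0..1}"
    using statesD(1,2) assms by (simp add: hat_def)
  ultimately show ?thesis using assms by (auto simp: canonical_tribe_def)
qed

end

text \<open>Half-open cells of length \<open>1 / N\<close>. For positive \<open>N\<close> the cell
  \<open>k = N\<close> is the single point 1, which is why sums over the grid include that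
  index.\<close>

abbreviation grid :: "nat \<Rightarrow> nat \<Rightarrow> real set" where
  "grid N k \<equiv> {0..1} \<inter> {real k / real N..<(real k + 1) / real N}"

lemma grid_approx:
  assumes N: "0 < N" and t: "t \<in> {0..1}"
  shows "\<bar>t - (\<Sum>k\<le>N. real k / real N * indicator (grid N k) t)\<bar> \<le> 1 / real N"
proof -
  define k0 where "k0 = nat \<lfloor>real N * t\<rfloor>"
  have k0: "real k0 \<le> real N * t" "real N * t < real k0 + 1"
    using N t by (auto simp: k0_def)
  have "real N * t \<le> real N * 1" using t by (intro mult_left_mono) auto
  then have "k0 \<le> N" using k0(1) by simp
  have "t \<in> grid N k \<longleftrightarrow> k = k0" for k
  proof -
    have "t \<in> grid N k \<longleftrightarrow> real k \<le> real N * t \<and> real N * t < real k + 1"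
      using N t by (auto simp: field_simps)
    also have "\<dots> \<longleftrightarrow> k = k0"
    proof
      assume "real k \<le> real N * t \<and> real N * t < real k + 1"
      with k0 have "real k < real k0 + 1" "real k0 < real k + 1" by linarith+
      then show "k = k0" by linarith
    qed (use k0 in simp)
    finally show ?thesis .
  qed
  then have "(\<Sum>k\<le>N. real k / real N * indicator (grid N k) t) = (\<Sum>k\<le>N. if k = k0 then real k / real N else 0)"
    by (intro sum.cong) (auto simp: indicator_def)
  also have "\<dots> = real k0 / real N" using \<open>k0 \<le> N\<close> by simp
  finally have "t - (\<Sum>k\<le>N. real k / real N * indicator (grid N k) t) = (real N * t - real k0) / real N"
    using N by (simp add: field_simps)
  then show ?thesis using k0 N by (simp add: divide_right_mono)
qed

lemma grid_sets: "grid N k \<in> sets borel01"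
  by (auto simp: borel01_sets_iff)

lemma expectation_approx:
  assumes "prob_space M" and sets: "sets M = sets borel01" and N: "0 < N"
  shows "\<bar>(\<integral>t. t \<partial>M) - (\<Sum>k\<le>N. real k / real N * measure M (grid N k))\<bar> \<le> 1 / real N"
proof -
  interpret prob_space M by fact
  let ?g = "\<lambda>t. \<Sum>k\<le>N. real k / real N * indicator (grid N k) t"
  have space: "space M = {0..1}" using sets_eq_imp_space_eq[OF sets] by simp
  have gs: "grid N k \<in> sets M" for k using grid_sets sets by simp
  have "(\<lambda>t. t) \<in> borel_measurable borel01"
    unfolding borel01_def by (intro measurable_restrict_space1) simp
  then have "(\<lambda>t. t) \<in> borel_measurable M" by (simp add: measurable_cong_sets[OF sets refl])
  then have it: "integrable M (\<lambda>t. t)"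
    by (intro integrable_const_bound[where B = 1]) (auto simp: space)
  have ik: "integrable M (\<lambda>t. real k / real N * indicator (grid N k) t)" for k
    using gs by (intro integrable_mult_right integrable_real_indicator) (auto simp: emeasure_eq_measure)
  then have ig: "integrable M ?g" by (intro Bochner_Integration.integrable_sum)
  have "integral\<^sup>L M ?g = (\<Sum>k\<le>N. integral\<^sup>L M (\<lambda>t. real k / real N * indicator (grid N k) t))"
    by (rule Bochner_Integration.integral_sum) (rule ik)
  also have "\<dots> = (\<Sum>k\<le>N. real k / real N * prob (grid N k))"
    using gs sets.Int_space_eq2[OF gs] by simp
  finally have int: "(\<integral>t. t \<partial>M) - (\<Sum>k\<le>N. real k / real N * prob (grid N k)) = integral\<^sup>L M (\<lambda>t. t - ?g t)"
    using Bochner_Integration.integral_diff[OF it ig] by simp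
  have bound: "- (1 / real N) \<le> t - ?g t \<and> t - ?g t \<le> 1 / real N" if "t \<in> space M" for t
    using grid_approx[OF N, of t] that space by (simp add: abs_le_iff)
  have "integral\<^sup>L M (\<lambda>t. t - ?g t) \<le> 1 / real N"
    using it ig bound by (intro integral_le_const) auto
  moreover have "- (1 / real N) \<le> integral\<^sup>L M (\<lambda>t. t - ?g t)"
    using it ig bound by (intro integral_ge_const) auto
  ultimately show ?thesis unfolding int by (simp add: abs_le_iff)
qed

section \<open>The spectral observables\<close>

locale spectral_effect_algebra = sigma_effect_algebra M for M :: "'a effect_alg" +
  assumes measurable: "f \<in> canonical_tribe M \<Longrightarrow> E \<in> sets borel \<Longrightarrow>
    f -` E \<inter> states M \<in> B0 (states M) (canonical_tribe M)"
begin

definition spectral :: "'a \<Rightarrow> real set \<Rightarrow> 'a" where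
  "spectral a E = canonical_hom M (restrict (indicat_real (hat M a -` E \<inter> states M)) (states M))"

text \<open>Sharp elements of the tribe belong to the tribe, so measurability of
  \<open>hat M a\<close> makes the indicator admissible. The second fact reduces laws of
  \<open>spectral\<close> to pointwise laws of indicators.\<close>

lemma spectral:
  assumes a: "a \<in> ecarrier M" and E: "E \<in> sets borel"
  shows "spectral a E \<in> ecarrier M" "nearly_all (\<lambda>s. s (spectral a E) = indicator E (s a))"
proof -
  let ?f = "restrict (indicat_real (hat M a -` E \<inter> states M)) (states M)"
  have f: "?f \<in> canonical_tribe M"
    using measurable[OF hat_in_canonical_tribe[OF a] E] by (simp add: B0_def Sh_def tribe_alg_def)
  from canonical_hom(1)[OF f] show "spectral a E \<in> ecarrier M" by (simp add: spectral_def)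
  show "nearly_all (\<lambda>s. s (spectral a E) = indicator E (s a))"
    by (rule nearly_all_mono[OF canonical_hom(2)[OF f]]) (auto simp: spectral_def hat_def indicator_def)
qed

lemma spectral_mono:
  assumes a: "a \<in> ecarrier M" and E: "E \<in> sets borel" "F \<in> sets borel" "E \<subseteq> F"
  shows "ele M (spectral a E) (spectral a F)"
proof (rule nearly_all_le_imp_ele[OF spectral(1)[OF a E(1)] spectral(1)[OF a E(2)]])
  show "nearly_all (\<lambda>s. s (spectral a E) \<le> s (spectral a F))"
    by (rule nearly_all_mono[OF nearly_all_conj[OF spectral(2)[OF a E(1)] spectral(2)[OF a E(2)]]])
      (use E(3) in \<open>auto simp: indicator_def\<close>)
qed

text \<open>Definedness of the sum comes from monotonicity, which supplies some \<open>c\<close>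
  completing the value at \<open>E\<close> to the value at the union; comparing states then
  identifies \<open>c\<close>.\<close>

lemma spectral_plus:
  assumes a: "a \<in> ecarrier M" and E: "E \<in> sets borel" "F \<in> sets borel" "E \<inter> F = {}"
  shows "esum (spectral a E) (spectral a F) (spectral a (E \<union> F))"
proof -
  have EF: "E \<union> F \<in> sets borel" using E by simp
  obtain c where c: "esum (spectral a E) c (spectral a (E \<union> F))"
    using spectral_mono[OF a E(1) EF] by (auto simp: ele_iff)
  have "nearly_all (\<lambda>s. (s (spectral a E) = indicator E (s a) \<and> s (spectral a F) = indicator F (s a))
      \<and> s (spectral a (E \<union> F)) = indicator (E \<union> F) (s a))"
    by (intro nearly_all_conj spectral(2) a E EF)
  then have "nearly_all (\<lambda>s. s c = s (spectral a F))"
  proof (rule nearly_all_mono)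
    fix s assume s: "s \<in> states M" and *: "(s (spectral a E) = indicator E (s a) \<and> s (spectral a F) = indicator F (s a))
      \<and> s (spectral a (E \<union> F)) = indicator (E \<union> F) (s a)"
    have "s (spectral a (E \<union> F)) = s (spectral a E) + s c" using statesD(5)[OF s c] .
    moreover have "indicat_real (E \<union> F) (s a) = indicator E (s a) + indicator F (s a)"
      using indicator_add[OF E(3), of "s a", symmetric] .
    ultimately show "s c = s (spectral a F)" using * by linarith
  qed
  then have "c = spectral a F" by (rule nearly_all_eq_imp_eq[OF esum_closed(2)[OF c] spectral(1)[OF a E(2)]])
  with c show ?thesis by simp
qed

lemma spectral_space:
  assumes a: "a \<in> ecarrier M"
  shows "spectral a {0..1} = eone M"
proof (rule nearly_all_eq_imp_eq[OF spectral(1)[OF a] one_closed])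
  show "nearly_all (\<lambda>s. s (spectral a {0..1}) = s (eone M))"
    by (rule nearly_all_mono[OF spectral(2)[OF a, of "{0..1}"]]) (simp_all add: statesD(1,2,4) a)
qed simp

text \<open>Countably many meager exceptions are discarded together. A remaining state has value 1
  at the union only if it already has value 1 at some \<open>A n\<close>, and there \<open>u\<close>
  dominates.\<close>

lemma spectral_increasing:
  assumes a: "a \<in> ecarrier M" and A: "\<And>n. A n \<in> sets borel" "\<And>n. A n \<subseteq> A (Suc n)"
  shows "increases_to M (\<lambda>n. spectral a (A n)) (spectral a (\<Union>n. A n))"
proof -
  have U: "(\<Union>n. A n) \<in> sets borel" using A(1) by blast
  have "ele M (spectral a (\<Union>n. A n)) u" if u: "u \<in> ecarrier M" "\<And>n. ele M (spectral a (A n)) u" for u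
  proof (rule nearly_all_le_imp_ele[OF spectral(1)[OF a U] u(1)])
    have "nearly_all (\<lambda>s. (\<forall>n. s (spectral a (A n)) = indicator (A n) (s a))
        \<and> s (spectral a (\<Union>n. A n)) = indicator (\<Union>n. A n) (s a))"
      by (intro nearly_all_conj nearly_all_countable spectral(2) a A U)
    then show "nearly_all (\<lambda>s. s (spectral a (\<Union>n. A n)) \<le> s u)"
    proof (rule nearly_all_mono)
      fix s assume s: "s \<in> states M" and *: "(\<forall>n. s (spectral a (A n)) = indicator (A n) (s a))
        \<and> s (spectral a (\<Union>n. A n)) = indicator (\<Union>n. A n) (s a)"
      show "s (spectral a (\<Union>n. A n)) \<le> s u"
      proof (cases "s a \<in> (\<Union>n. A n)")
        case True
        then obtain n where "s a \<in> A n" by blast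
        then show ?thesis using * state_mono[OF s u(2)[of n]] True by simp
      next
        case False
        then show ?thesis using * statesD(1)[OF s u(1)] by simp
      qed
    qed
  qed
  moreover have "ele M (spectral a (A n)) (spectral a (A (Suc n)))" for n
    using spectral_mono[OF a A(1) A(1) A(2)] .
  moreover have "ele M (spectral a (A n)) (spectral a (\<Union>n. A n))" for n
    using A(1) by (intro spectral_mono a U) auto
  ultimately show ?thesis
    using spectral(1)[OF a] A(1) U by (auto simp: increases_to_def eincseq_def is_esup_def)
qed

text \<open>At nearly all extreme states the element takes the value 0 or 1, so it or its complement
  vanishes there, and a common lower bound vanishes with it.\<close>

lemma spectral_sharp:
  assumes a: "a \<in> ecarrier M" and E: "E \<in> sets borel"
  shows "spectral a E \<in> Sh M"
proof -
  let ?x = "spectral a E"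
  have x: "?x \<in> ecarrier M" by (rule spectral(1)[OF a E])
  have c: "esum ?x (ecompl M ?x) (eone M)" by (rule esum_ecompl[OF x])
  have "ele M l (ezero M)" if l: "ele M l ?x" "ele M l (ecompl M ?x)" for l
  proof (rule nearly_all_le_imp_ele[OF _ zero_closed])
    show "l \<in> ecarrier M" using l(1) by (simp add: ele_def)
    show "nearly_all (\<lambda>s. s l \<le> s (ezero M))"
    proof (rule nearly_all_mono[OF spectral(2)[OF a E]])
      fix s assume s: "s \<in> states M" and *: "s ?x = indicator E (s a)"
      have "s l \<le> s ?x" "s l \<le> 1 - s ?x"
        using state_mono[OF s l(1)] state_mono[OF s l(2)] statesD(5)[OF s c] statesD(4)[OF s] by simp_all
      then show "s l \<le> s (ezero M)" using * state_zero[OF s] by (cases "s a \<in> E") simp_all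
    qed
  qed
  then show ?thesis
    using x esum_closed(2)[OF c] ele_zero zero_closed by (auto simp: Sh_def is_einf_def)
qed

lemma spectral_observable:
  assumes a: "a \<in> ecarrier M"
  shows "sharp_observable borel01 M (spectral a)"
proof -
  have "effect_hom (sets_alg borel01) M (spectral a)"
    unfolding effect_hom_def
  proof (intro conjI ballI allI impI)
    show "spectral a \<in> ecarrier (sets_alg borel01) \<rightarrow> ecarrier M"
      using spectral(1)[OF a] by (simp add: sets_alg_def borel01_sets_iff)
    show "spectral a (eone (sets_alg borel01)) = eone M"
      using spectral_space[OF a] by (simp add: sets_alg_def)
  next
    fix A B C assume AB: "A \<in> ecarrier (sets_alg borel01)" "B \<in> ecarrier (sets_alg borel01)"
      "eplus (sets_alg borel01) A B = Some C"
    then have "A \<inter> B = {}" "C = A \<union> B" by (simp_all add: sets_alg_def split: if_splits)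
    with AB show "eplus M (spectral a A) (spectral a B) = Some (spectral a C)"
      using spectral_plus[OF a, of A B] by (simp add: esum_def sets_alg_def borel01_sets_iff)
  qed
  moreover have "increases_to M (\<lambda>n. spectral a (A n)) (spectral a B)"
    if "increases_to (sets_alg borel01) A B" for A B
    using spectral_increasing[OF a, of A] increases_to_sets_algD[OF that] by (simp add: borel01_sets_iff)
  ultimately show ?thesis
    using spectral_sharp[OF a] by (simp add: sharp_observable_def observable_def sigma_hom_def borel01_sets_iff)
qed

lemma spectral_inj: "inj_on (\<lambda>a. restrict (spectral a) (sets borel01)) (ecarrier M)"
proof (rule inj_onI)
  fix a b assume a: "a \<in> ecarrier M" and b: "b \<in> ecarrier M"
    and eq: "restrict (spectral a) (sets borel01) = restrict (spectral b) (sets borel01)"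
  \<comment> \<open>Rational thresholds are countably many, so one meager set serves them all, and
    they still separate real numbers.\<close>
  define E where "E n = {0..1} \<inter> {..real_of_rat (nat_to_rat_surj n)}" for n
  have E: "E n \<in> sets borel" "E n \<in> sets borel01" for n by (auto simp: E_def borel01_sets_iff)
  have "spectral a (E n) = spectral b (E n)" for n using fun_cong[OF eq, of "E n"] E(2) by simp
  then have "nearly_all (\<lambda>s. \<forall>n. s (spectral a (E n)) = indicator (E n) (s a) \<and> s (spectral a (E n)) = indicator (E n) (s b))"
    using spectral(2)[OF a E(1)] spectral(2)[OF b E(1)] by (intro nearly_all_countable nearly_all_conj) simp_all
  then have "nearly_all (\<lambda>s. s a = s b)"
  proof (rule nearly_all_mono)
    fix s assume s: "s \<in> states M"
      and *: "\<forall>n. s (spectral a (E n)) = indicator (E n) (s a) \<and> s (spectral a (E n)) = indicator (E n) (s b)"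
    have 01: "s a \<in> {0..1}" "s b \<in> {0..1}" using statesD(1,2)[OF s] a b by auto
    have iff: "s a \<le> real_of_rat q \<longleftrightarrow> s b \<le> real_of_rat q" for q
    proof -
      obtain n where "q = nat_to_rat_surj n" using surj_nat_to_rat_surj by (metis surjD)
      moreover have "indicat_real (E n) (s a) = indicator (E n) (s b)" using * by metis
      then have "s a \<in> E n \<longleftrightarrow> s b \<in> E n" by (metis indicator_eq_1_iff)
      ultimately show ?thesis using 01 by (simp add: E_def)
    qed
    show "s a = s b"
    proof (rule ccontr)
      assume "s a \<noteq> s b"
      then consider "s a < s b" | "s b < s a" by linarith
      then show False
      proof cases
        case 1
        then obtain q where "s a < real_of_rat q" "real_of_rat q < s b" using of_rat_dense by blast
        then show False using iff[of q] by simp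
      next
        case 2
        then obtain q where "s b < real_of_rat q" "real_of_rat q < s a" using of_rat_dense by blast
        then show False using iff[of q] by simp
      qed
    qed
  qed
  then show "a = b" by (rule nearly_all_eq_imp_eq[OF a b])
qed

text \<open>At nearly all extreme states the values of \<open>spectral\<close> are indicators and
  this is the scalar grid estimate. Being a pair of linear inequalities, it extends to every
  state.\<close>

lemma spectral_grid_approx:
  assumes a: "a \<in> ecarrier M" and m: "m \<in> states M" and N: "0 < N"
  shows "\<bar>m a - (\<Sum>k\<le>N. real k / real N * m (spectral a (grid N k)))\<bar> \<le> 1 / real N"
proof -
  \<comment> \<open>The estimate must be one indexed sum: \<open>a\<close> takes index 0 and the
    grid cells are shifted up by one.\<close>
  define b where "b k = (if k = 0 then a else spectral a (grid N (k - 1)))" for k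
  define c where "c k = (if k = 0 then 1 else - (real (k - 1) / real N))" for k
  have split: "(\<Sum>k\<le>Suc N. r * c k * s (b k)) =
      r * (s a - (\<Sum>k\<le>N. real k / real N * s (spectral a (grid N k))))" for s and r :: real
    by (simp only: sum.atMost_Suc_shift) (simp add: b_def c_def sum_distrib_left sum_negf algebra_simps)
  have gb: "grid N k \<in> sets borel" for k by simp
  have "nearly_all (\<lambda>s. \<forall>k. s (spectral a (grid N k)) = indicator (grid N k) (s a))"
    by (intro nearly_all_countable spectral(2) a gb)
  then have "nearly_all (\<lambda>s. \<bar>s a - (\<Sum>k\<le>N. real k / real N * s (spectral a (grid N k)))\<bar> \<le> 1 / real N)"
    by (rule nearly_all_mono) (use grid_approx[OF N] statesD(1,2) a in auto)
  \<comment> \<open>The sign \<open>r\<close> turns the absolute value into two linear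
    inequalities.\<close>
  then have "nearly_all (\<lambda>s. (\<Sum>k\<le>Suc N. r * c k * s (b k)) \<le> 1 / real N)" if "r = 1 \<or> r = -1" for r
    by (rule nearly_all_mono, simp only: split) (use that in \<open>elim disjE; simp only: mult_1 mult_minus1; linarith\<close>)
  from nearly_all_linear_le[OF this m, of 1] nearly_all_linear_le[OF this m, of "-1"]
  show ?thesis unfolding split by simp
qed

lemma spectral_expectation:
  assumes a: "a \<in> ecarrier M" and m: "m \<in> states M" "sigma_additive M m"
  defines "\<mu> \<equiv> observable_distr borel01 m (spectral a)"
  shows "prob_space \<mu>" "E \<in> sets borel01 \<Longrightarrow> emeasure \<mu> E = ennreal (m (spectral a E))" "m a = (\<integral>t. t \<partial>\<mu>)"
proof -
  have "observable borel01 M (spectral a)"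
    using spectral_observable[OF a] by (simp add: sharp_observable_def)
  from observable_distr_emeasure[OF this m]
  have em: "emeasure \<mu> E = ennreal (m (spectral a E))" if "E \<in> sets borel01" for E
    using that by (simp add: \<mu>_def)
  then show "E \<in> sets borel01 \<Longrightarrow> emeasure \<mu> E = ennreal (m (spectral a E))" .
  have sets: "sets \<mu> = sets borel01"
    unfolding \<mu>_def observable_distr_def by (simp add: sets.sigma_sets_eq sets.space_closed del: borel01_space)
  have space: "space \<mu> = {0..1}" using sets_eq_imp_space_eq[OF sets] by simp
  show prob: "prob_space \<mu>"
    using em[of "{0..1}"] spectral_space[OF a] statesD(4)[OF m(1)]
    by (intro prob_spaceI) (simp add: space borel01_sets_iff)
  have meas: "measure \<mu> (grid N k) = m (spectral a (grid N k))" for N k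
    using em[OF grid_sets] statesD(1)[OF m(1) spectral(1)[OF a]] by (simp add: measure_def)
  \<comment> \<open>Both numbers lie within \<open>1 / (n + 1)\<close> of the same grid sum, whose
    coefficients are read off from \<open>m\<close> on one side and from the measure on the
    other.\<close>
  have bound: "\<bar>m a - (\<integral>t. t \<partial>\<mu>)\<bar> \<le> 2 * inverse (real (Suc n))" for n
    using spectral_grid_approx[OF a m(1), of "Suc n"] expectation_approx[OF prob sets, of "Suc n"]
    unfolding meas by (simp add: divide_inverse)
  have "(\<lambda>n. 2 * inverse (real (Suc n))) \<longlonglongrightarrow> 2 * 0"
    by (intro tendsto_intros LIMSEQ_inverse_real_of_nat)
  then have "\<bar>m a - (\<integral>t. t \<partial>\<mu>)\<bar> \<le> 2 * 0"
    by (rule LIMSEQ_le_const) (use bound in blast)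
  then show "m a = (\<integral>t. t \<partial>\<mu>)" by simp
qed

end

theorem theorem4p3:
  fixes M :: "'a effect_alg"
    and \<Omega> :: "('a \<Rightarrow> real) set"
    and T :: "(('a \<Rightarrow> real) \<Rightarrow> real) set"
    and h :: "(('a \<Rightarrow> real) \<Rightarrow> real) \<Rightarrow> 'a"
  assumes "effect_algebra M"
    and "monotone_sigma_complete M"
    and "RDP M"
    and "(\<Omega>, T, h) = canonical_representation M"
    and "\<forall>f\<in>T. \<forall>E\<in>sets borel. f -` E \<inter> \<Omega> \<in> B0 \<Omega> T"
  shows "\<exists>\<Lambda> :: 'a \<Rightarrow> real set \<Rightarrow> 'a.
    (\<forall>a\<in>ecarrier M. sharp_observable borel01 M (\<Lambda> a)) \<and>
    inj_on (\<lambda>a. restrict (\<Lambda> a) (sets borel01)) (ecarrier M) \<and>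
    (\<forall>a\<in>ecarrier M. \<forall>m\<in>states M. sigma_additive M m \<longrightarrow>
      prob_space (observable_distr borel01 m (\<Lambda> a)) \<and>
      (\<forall>E\<in>sets borel01. emeasure (observable_distr borel01 m (\<Lambda> a)) E = ennreal (m (\<Lambda> a E))) \<and>
      m a = (\<integral>t. t \<partial>observable_distr borel01 m (\<Lambda> a)))"
proof -
  have "\<Omega> = states M" "T = canonical_tribe M"
    using assms(4) by (simp_all add: canonical_representation_def)
  with assms interpret spectral_effect_algebra M
    by (intro spectral_effect_algebra.intro sigma_effect_algebra.intro rdp_effect_algebra.intro
        rdp_effect_algebra_axioms.intro sigma_effect_algebra_axioms.intro spectral_effect_algebra_axioms.intro) auto
  show ?thesis
    using spectral_observable spectral_inj spectral_expectation by (intro exI[of _ spectral]) blast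
qed

end
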